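(* Let $d\ge 2$, $0<\alpha\le\beta<\infty$, and let $A\in L^\infty(\Omega,\mathcal M_{\alpha\beta})$ be stationary ergodic coefficients. Let $\xi,\xi'\in\mathbb R^d$ with $|\xi|=|\xi'|=1$, let $\phi,\phi'$ be the corrector in direction $\xi$ and the dual corrector in direction $\xi'$, and let $A_{\mathrm{hom}}$ be the homogenized matrix. For $k\in\mathbb N$ and $T>0$ let $\phi_{T,k},\phi'_{T,k}$ be the Richardson extrapolations of the regularized correctors and $A_{T,k}$ the associated approximation of the homogenized matrix. Then for every $k\in\mathbb N$, $$\lim_{T\uparrow\infty}\mathbb E\big[|\nabla\phi_{T,k}-\nabla\phi|^2\big]=0,\qquad \lim_{T\uparrow\infty}\mathbb E\big[|\nabla\phi'_{T,k}-\nabla\phi'|^2\big]=0,\qquad \lim_{T\uparrow\infty}|A_{T,k}-A_{\mathrm{hom}}|=0.$$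
   Context: $\mathcal M_{\alpha\beta}$ denotes the set of real $d\times d$ matrices $M$ with $\xi\cdot M\xi\ge\alpha|\xi|^2$ and $|M\xi|\le\beta|\xi|$ for all $\xi\in\mathbb R^d$; $M^*$ is the transpose. $(\Omega,\mathcal F,\mathbb P)$ is a probability space (expectation $\mathbb E$) with a measure-preserving, ergodic group of transformations $(\theta_z)_{z\in\mathbb R^d}$ ($\theta_0=\mathrm{Id}$, $\theta_{x+y}=\theta_x\circ\theta_y$, $(\omega,x)\mapsto f(\theta_x\omega)$ measurable for measurable $f$). Stationary ergodic coefficients: $A\in L^\infty(\Omega,\mathcal M_{\alpha\beta})$ extended by $A(x,\omega):=A(\theta_x\omega)$. The corrector in direction $\xi$ is the unique measurable $\phi:\mathbb R^d\times\Omega\to\mathbb R$ with $\phi(0,\cdot)=0$, $\nabla\phi$ stationary, $\mathbb E[\nabla\phi]=0$, and $\phi(\cdot,\omega)\in H^1_{\mathrm{loc}}(\mathbb R^d)$ a distributional solution of $-\nabla\cdot A(\xi+\nabla\phi)=0$ in $\mathbb R^d$ almost surely; the dual corrector $\phi'$ in direction $\xi'$ is defined likewise with $A^*$ and $\xi'$. The homogenized matrix is defined by $\xi'\cdot A_{\mathrm{hom}}\xi=\mathbb E[(\xi'+\nabla\phi'(0))\cdot A(0)(\xi+\nabla\phi(0))]$. For $T>0$, the regularized corrector $\phi_T$ is the unique solution in $H^1_{\mathrm{loc}}(\mathbb R^d)$, among functions $v$ with $\sup_{x}\int_{B_1(x)}(v^2+|\nabla v|^2)<\infty$, of $T^{-1}\phi_T-\nabla\cdot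 A(\xi+\nabla\phi_T)=0$ in $\mathbb R^d$; $\phi'_T$ is defined likewise with $A^*$ and $\xi'$ (these are stationary fields). Richardson extrapolations: $\phi_{T,1}:=\phi_T$ and $\phi_{T,k+1}:=\frac{1}{2^k-1}(2^k\phi_{2T,k}-\phi_{T,k})$ for $k\in\mathbb N$; the same for $\phi'_{T,k}$. The approximation $A_{T,k}$ is defined by $\xi'\cdot A_{T,k}\xi:=\mathbb E[(\xi'+\nabla\phi'_{T,k})\cdot A(\xi+\nabla\phi_{T,k})]$ (evaluated at $x=0$). *)

theory Defs
  imports "HOL-Probability.Probability"
begin

definition partial :: "'d::finite \<Rightarrow> (real^'d \<Rightarrow> real) \<Rightarrow> real^'d \<Rightarrow> real" where
  "partial i f x = deriv (\<lambda>t. f (x + t *\<^sub>R axis i 1)) 0"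

definition grad :: "(real^'d::finite \<Rightarrow> real) \<Rightarrow> real^'d \<Rightarrow> real^'d" where
  "grad f x = (\<chi> i. partial i f x)"

definition smooth_fun :: "(real^'d::finite \<Rightarrow> real) \<Rightarrow> bool" where
  "smooth_fun f \<longleftrightarrow>
     (\<forall>is :: 'd list. continuous_on UNIV (foldr partial is f) \<and>
        (\<forall>i x. (\<lambda>t. foldr partial is f (x + t *\<^sub>R axis i 1)) differentiable (at 0)))"

definition test_fun :: "(real^'d::finite \<Rightarrow> real) \<Rightarrow> bool" where
  "test_fun \<psi> \<longleftrightarrow> smooth_fun \<psi> \<and> compact (closure {x. \<psi> x \<noteq> 0})"

definition weak_grad :: "(real^'d::finite \<Rightarrow> real) \<Rightarrow> (real^'d \<Rightarrow> real^'d) \<Rightarrow> bool" where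
  "weak_grad u g \<longleftrightarrow>
     u \<in> borel_measurable lborel \<and> g \<in> borel_measurable lborel \<and>
     (\<forall>K. compact K \<longrightarrow> set_integrable lborel K (\<lambda>x. (u x)\<^sup>2)
                       \<and> set_integrable lborel K (\<lambda>x. (norm (g x))\<^sup>2)) \<and>
     (\<forall>\<psi>. test_fun \<psi> \<longrightarrow>
        (\<forall>i. (\<integral>x. u x * partial i \<psi> x \<partial>lborel) = - (\<integral>x. g x $ i * \<psi> x \<partial>lborel)))"

definition ergodic_action :: "'w measure \<Rightarrow> (real^'d::finite \<Rightarrow> 'w \<Rightarrow> 'w) \<Rightarrow> bool" where
  "ergodic_action M \<theta> \<longleftrightarrow>
     prob_space M \<and>
     (\<forall>\<omega>\<in>space M. \<theta> 0 \<omega> = \<omega>) \<and>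
     (\<forall>x y. \<forall>\<omega>\<in>space M. \<theta> (x + y) \<omega> = \<theta> x (\<theta> y \<omega>)) \<and>
     (\<forall>x. \<theta> x \<in> M \<rightarrow>\<^sub>M M \<and> distr M M (\<theta> x) = M) \<and>
     (\<lambda>(\<omega>, x). \<theta> x \<omega>) \<in> M \<Otimes>\<^sub>M lborel \<rightarrow>\<^sub>M M \<and>
     (\<forall>E\<in>sets M. (\<forall>x. \<theta> x -` E \<inter> space M = E) \<longrightarrow>
        measure M E = 0 \<or> measure M E = 1)"

definition Mab :: "real \<Rightarrow> real \<Rightarrow> (real^'d::finite^'d) set" where
  "Mab \<alpha> \<beta> = {B. \<forall>\<xi>. \<xi> \<bullet> (B *v \<xi>) \<ge> \<alpha> * (norm \<xi>)\<^sup>2 \<and> norm (B *v \<xi>) \<le> \<beta> * norm \<xi>}"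

definition coeff_field :: "'w measure \<Rightarrow> real \<Rightarrow> real \<Rightarrow> ('w \<Rightarrow> real^'d::finite^'d) \<Rightarrow> bool" where
  "coeff_field M \<alpha> \<beta> A \<longleftrightarrow> A \<in> borel_measurable M \<and> (AE \<omega> in M. A \<omega> \<in> Mab \<alpha> \<beta>)"

text \<open>phi is the corrector in direction xi for coefficients A (use transpose A for the dual);
  G is the stationary field with grad phi(x,omega) = G(theta_x omega).\<close>
definition is_corrector ::
  "'w measure \<Rightarrow> (real^'d::finite \<Rightarrow> 'w \<Rightarrow> 'w) \<Rightarrow> ('w \<Rightarrow> real^'d^'d) \<Rightarrow> real^'d
    \<Rightarrow> (real^'d \<Rightarrow> 'w \<Rightarrow> real) \<Rightarrow> ('w \<Rightarrow> real^'d) \<Rightarrow> bool" where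
  "is_corrector M \<theta> A \<xi> \<phi> G \<longleftrightarrow>
     (\<lambda>(x, \<omega>). \<phi> x \<omega>) \<in> borel_measurable (lborel \<Otimes>\<^sub>M M) \<and>
     (\<forall>\<omega>\<in>space M. \<phi> 0 \<omega> = 0) \<and>
     G \<in> borel_measurable M \<and> integrable M G \<and> integrable M (\<lambda>\<omega>. (norm (G \<omega>))\<^sup>2) \<and>
     (\<integral>\<omega>. G \<omega> \<partial>M) = 0 \<and>
     (AE \<omega> in M. weak_grad (\<lambda>x. \<phi> x \<omega>) (\<lambda>x. G (\<theta> x \<omega>)) \<and>
        (\<forall>\<psi>. test_fun \<psi> \<longrightarrow>
           (\<integral>x. grad \<psi> x \<bullet> (A (\<theta> x \<omega>) *v (\<xi> + G (\<theta> x \<omega>))) \<partial>lborel) = 0))"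

text \<open>Regularized corrector with parameter T in direction xi, given as a stationary field:
  phi_T(x,omega) = Phi(theta_x omega), grad phi_T(x,omega) = G(theta_x omega).\<close>
definition is_reg_corrector ::
  "'w measure \<Rightarrow> (real^'d::finite \<Rightarrow> 'w \<Rightarrow> 'w) \<Rightarrow> ('w \<Rightarrow> real^'d^'d) \<Rightarrow> real \<Rightarrow> real^'d
    \<Rightarrow> ('w \<Rightarrow> real) \<Rightarrow> ('w \<Rightarrow> real^'d) \<Rightarrow> bool" where
  "is_reg_corrector M \<theta> A T \<xi> \<Phi> G \<longleftrightarrow>
     \<Phi> \<in> borel_measurable M \<and> G \<in> borel_measurable M \<and>
     (AE \<omega> in M. weak_grad (\<lambda>x. \<Phi> (\<theta> x \<omega>)) (\<lambda>x. G (\<theta> x \<omega>)) \<and>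
        bdd_above (range (\<lambda>x. set_lebesgue_integral lborel (ball x 1)
            (\<lambda>y. (\<Phi> (\<theta> y \<omega>))\<^sup>2 + (norm (G (\<theta> y \<omega>)))\<^sup>2))) \<and>
        (\<forall>\<psi>. test_fun \<psi> \<longrightarrow>
           (\<integral>x. (1 / T) * \<Phi> (\<theta> x \<omega>) * \<psi> x
                 + grad \<psi> x \<bullet> (A (\<theta> x \<omega>) *v (\<xi> + G (\<theta> x \<omega>))) \<partial>lborel) = 0))"

text \<open>rich f k T = f_{T,k} for k >= 1: f_{T,1} = f_T and
  f_{T,k+1} = (2^k f_{2T,k} - f_{T,k}) / (2^k - 1).  (k = 0 is a dummy case.)\<close>
fun rich :: "(real \<Rightarrow> 'a::real_vector) \<Rightarrow> nat \<Rightarrow> real \<Rightarrow> 'a" where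
  "rich f 0 T = f T"
| "rich f (Suc 0) T = f T"
| "rich f (Suc (Suc k)) T =
     (1 / (2 ^ Suc k - 1)) *\<^sub>R (2 ^ Suc k *\<^sub>R rich f (Suc k) (2 * T) - rich f (Suc k) T)"

text \<open>Entry (i,j) is e_i . A_hom e_j = E[(e_i + grad phi'_{e_i}) . A (e_j + grad phi_{e_j})].\<close>
definition hom_matrix ::
  "'w measure \<Rightarrow> ('w \<Rightarrow> real^'d::finite^'d) \<Rightarrow> (real^'d \<Rightarrow> 'w \<Rightarrow> real^'d)
     \<Rightarrow> (real^'d \<Rightarrow> 'w \<Rightarrow> real^'d) \<Rightarrow> real^'d^'d" where
  "hom_matrix M A G G' = (\<chi> i j. \<integral>\<omega>. (axis i 1 + G' (axis i 1) \<omega>) \<bullet>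
                                     (A \<omega> *v (axis j 1 + G (axis j 1) \<omega>)) \<partial>M)"

text \<open>A_{T,k}: Gr xi S = stationary gradient of phi_S in direction xi.\<close>
definition approx_matrix ::
  "'w measure \<Rightarrow> ('w \<Rightarrow> real^'d::finite^'d) \<Rightarrow> (real^'d \<Rightarrow> real \<Rightarrow> 'w \<Rightarrow> real^'d)
     \<Rightarrow> (real^'d \<Rightarrow> real \<Rightarrow> 'w \<Rightarrow> real^'d) \<Rightarrow> nat \<Rightarrow> real \<Rightarrow> real^'d^'d" where
  "approx_matrix M A Gr Gr' k T =
     (\<chi> i j. \<integral>\<omega>. (axis i 1 + rich (\<lambda>S. Gr' (axis i 1) S \<omega>) k T) \<bullet>
                 (A \<omega> *v (axis j 1 + rich (\<lambda>S. Gr (axis j 1) S \<omega>) k T)) \<partial>M)"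

end

theory Submission
  imports Defs
begin

text \<open>
  Write \<open>U\<^sub>x f = f \<circ> \<theta>\<^sub>x\<close> on \<open>L\<^sup>2(\<Omega>)\<close>. Pairing the pathwise equations with functions of \<open>L\<^sup>2(\<Omega>)\<close> and using
  the strong continuity of \<open>U\<close>, one may test them in expectation with every stationary field \<open>X\<close> that has a
  stationary gradient \<open>DX\<close>. Subtracting the two equations and testing with \<open>\<phi>\<^sub>T - X\<close> gives
  \<open>E|\<nabla>\<phi>\<^sub>T - \<nabla>\<phi>|\<^sup>2 \<le> E[X\<^sup>2] / (2 \<alpha> T) + (\<beta> / \<alpha>)\<^sup>2 E|\<nabla>\<phi> - DX|\<^sup>2\<close>. It remains to approximate \<open>\<nabla>\<phi>\<close> by such
  gradients. All increments \<open>U\<^sub>z \<nabla>\<phi> - \<nabla>\<phi>\<close> are stationary gradients, so a mean ergodic argument and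
  \<open>E[\<nabla>\<phi>] = 0\<close> place \<open>\<nabla>\<phi>\<close> in their closure. That \<open>\<phi>\<^sub>T\<close> and \<open>\<nabla>\<phi>\<^sub>T\<close> are square integrable over \<open>\<Omega>\<close> follows from
  ergodicity, since the supremum of their local energies is an invariant finite random variable. Richardson
  extrapolations are affine combinations, hence converge as well.
\<close>

subsection \<open>Smooth bump functions\<close>

text \<open>The corrector \<open>\<phi>\<close> is not stationary, so it is no admissible test field
  on \<Omega>; only its increments \<open>\<phi>(x + z) - \<phi>(x)\<close> are stationary. Hence
  the comparison field X, and hence the order of the limits: X is fixed by the accuracy wanted
  before T grows, however large E[X^2] may be. A second obstacle is that the equations hold path by
  path, outside a null set and against compactly supported functions of x, while the energy estimate
  lives in expectation at the single point x = 0. The bridge is \<open>corr f g\<close>, a matrix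
  coefficient of the translation group. Integrating a pathwise identity against g turns it into an
  identity for integrals of bumps against such functions; the fact that the adjoint of U_x is U_{-x}
  replaces integration by parts on \<Omega>; continuity at 0 and bumps of arbitrarily small support
  recover the value at x = 0. Finally, ergodicity is assumed for strictly invariant events, whereas
  an L^2 limit is invariant only almost surely for each fixed z. Fubini closes this gap.\<close>

definition bump_term :: "real poly \<Rightarrow> nat \<Rightarrow> real \<Rightarrow> real" where
  "bump_term p n t = (if \<bar>t\<bar> < 1 then poly p t / (1 - t\<^sup>2) ^ n * exp (- 1 / (1 - t\<^sup>2)) else 0)"

text \<open>The derivative of \<^term>\<open>bump_term p n\<close> is again of this form, so smoothness reduces to one step.\<close>

definition bump_step :: "real poly \<times> nat \<Rightarrow> real poly \<times> nat" where
  "bump_step = (\<lambda>(p, n).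
     (pderiv p * [:1, 0, -1:]\<^sup>2 + smult (2 * real n) ([:0, 1:] * p * [:1, 0, -1:]) - smult 2 ([:0, 1:] * p), n + 2))"

text \<open>The series of \<open>exp (1 / s)\<close> has nonnegative terms and so dominates its N-th
  one; reciprocals give a decay that beats any pole at s = 0.\<close>

lemma exp_neg_inverse_le:
  fixes s :: real
  assumes "0 < s"
  shows "exp (- 1 / s) \<le> fact N * s ^ N"
proof -
  have "(1 / s) ^ N / fact N \<le> exp (1 / s)"
  proof -
    have "(\<Sum>k\<in>{N}. (1 / s) ^ k / fact k) \<le> exp (1 / s)"
      unfolding exp_def
      using summable_exp_generic[of "1/s"] assms
      by (intro sum_le_suminf[of "\<lambda>k. (1 / s) ^ k / fact k", THEN order_trans])
         (auto simp: scaleR_conv_of_real field_simps)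
    then show ?thesis by simp
  qed
  then have "inverse (exp (1 / s)) \<le> inverse ((1 / s) ^ N / fact N)"
    using assms by (intro le_imp_inverse_le) auto
  then show ?thesis
    using assms by (simp add: exp_minus[symmetric] power_one_over mult.commute)
qed

text \<open>Two orders of vanishing at the endpoints serve \<open>bump_term_deriv\<close>: one is
  consumed by the difference quotient, the other makes it tend to 0.\<close>

lemma bump_term_bound: "\<exists>C. \<forall>t. \<bar>bump_term p n t\<bar> \<le> C * (1 - t\<^sup>2)\<^sup>2"
proof -
  have "bounded (poly p ` {-1..1})"
    by (intro compact_imp_bounded compact_continuous_image continuous_intros compact_Icc)
  then obtain B where B: "\<And>t. t \<in> {-1..1} \<Longrightarrow> \<bar>poly p t\<bar> \<le> B"
    unfolding bounded_iff by fastforce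
  have B0: "0 \<le> B" using B[of 0] by auto
  have "\<bar>bump_term p n t\<bar> \<le> (B * fact (n + 2)) * (1 - t\<^sup>2)\<^sup>2" for t
  proof (cases "\<bar>t\<bar> < 1")
    case True
    let ?s = "1 - t\<^sup>2"
    have s: "?s > 0" using True by (simp add: abs_square_less_1)
    have "\<bar>bump_term p n t\<bar> = \<bar>poly p t\<bar> / ?s ^ n * exp (- 1 / ?s)"
      using True s by (simp add: bump_term_def abs_mult)
    \<comment> \<open>The exponent n + 2 cancels the pole of order n and leaves the square.\<close>
    also have "\<dots> \<le> B / ?s ^ n * (fact (n + 2) * ?s ^ (n + 2))"
      using s B[of t] True B0
      by (intro mult_mono divide_right_mono exp_neg_inverse_le) (auto simp: abs_less_iff)
    also have "\<dots> = (B * fact (n + 2)) * ?s\<^sup>2"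
      using s by (simp add: power_add power2_eq_square)
    finally show ?thesis .
  qed (use B0 in \<open>auto simp: bump_term_def\<close>)
  then show ?thesis by blast
qed

text \<open>Inside the interval this is the product rule. Elsewhere, endpoints included, the value
  and the claimed derivative are 0, and \<open>bump_term_bound\<close> squeezes the difference
  quotient.\<close>

lemma bump_term_deriv:
  "(bump_term p n has_real_derivative case_prod bump_term (bump_step (p, n)) t) (at t)"
proof (cases "\<bar>t\<bar> < 1")
  case True
  let ?s = "1 - t\<^sup>2"
  have s: "?s > 0" using True by (simp add: abs_square_less_1)
  have "((\<lambda>t. poly p t / (1 - t\<^sup>2) ^ n * exp (- 1 / (1 - t\<^sup>2))) has_real_derivative
     case_prod bump_term (bump_step (p, n)) t) (at t)"
  proof -
    have e: "(1 - t\<^sup>2) ^ n * (1 - t\<^sup>2) ^ n \<noteq> 0" using s by auto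
    have D1: "((\<lambda>t. (1 - t\<^sup>2) ^ n) has_real_derivative (real n * (1 - t\<^sup>2) ^ (n - 1) * (- 2 * t))) (at t)"
      by (auto intro!: derivative_eq_intros)
    have D2: "((\<lambda>t. exp (- 1 / (1 - t\<^sup>2))) has_real_derivative (exp (- 1 / ?s) * (- 2 * t / ?s\<^sup>2))) (at t)"
      using s by (auto intro!: derivative_eq_intros simp: power2_eq_square)
    have D3: "(poly p has_real_derivative poly (pderiv p) t) (at t)"
      by (rule poly_DERIV)
    have "((\<lambda>t. poly p t / (1 - t\<^sup>2) ^ n * exp (- 1 / (1 - t\<^sup>2))) has_real_derivative
       ((poly (pderiv p) t * ?s ^ n - poly p t * (real n * ?s ^ (n - 1) * (- 2 * t))) / (?s ^ n * ?s ^ n)) * exp (- 1 / ?s)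
        + exp (- 1 / ?s) * (- 2 * t / ?s\<^sup>2) * (poly p t / ?s ^ n)) (at t)"
      by (rule DERIV_mult[OF DERIV_divide[OF D3 D1] D2]) (use s in auto)
    moreover have "((poly (pderiv p) t * ?s ^ n - poly p t * (real n * ?s ^ (n - 1) * (- 2 * t))) / (?s ^ n * ?s ^ n)) * exp (- 1 / ?s)
        + exp (- 1 / ?s) * (- 2 * t / ?s\<^sup>2) * (poly p t / ?s ^ n)
       = case_prod bump_term (bump_step (p, n)) t"
    proof -
      have q: "real n * ?s ^ (n - 1) * ?s = real n * ?s ^ n" by (cases n) auto
      have pl: "poly [:1, 0, -1:] t = ?s" by (simp add: power2_eq_square)
      have "case_prod bump_term (bump_step (p, n)) t =
        (poly (pderiv p) t * ?s\<^sup>2 + 2 * real n * (t * poly p t * ?s) - 2 * (t * poly p t)) / ?s ^ (n + 2) * exp (- 1 / ?s)"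
        unfolding bump_step_def bump_term_def using True
        by (simp only: prod.case if_True poly_add poly_diff poly_mult poly_smult poly_power pl) (simp add: mult.assoc)
      moreover have "real n * ?s ^ (n - 1) = real n * ?s ^ n / ?s"
        using s q by (metis nonzero_mult_div_cancel_right less_irrefl)
      moreover have "((P' * S - P * (m * S / a * (- 2 * u))) / (S * S)) * e + e * (- 2 * u / a\<^sup>2) * (P / S)
        = (P' * a\<^sup>2 + 2 * m * (u * P * a) - 2 * (u * P)) / (S * a\<^sup>2) * e"
        if "a > 0" "S > 0" for a S P P' m u e :: real
        using that by (simp add: field_simps power2_eq_square)
      ultimately show ?thesis
        using s by (simp only: power_add zero_less_power)
    qed
    ultimately show ?thesis by simp
  qed
  then show ?thesis
  proof (rule has_field_derivative_transform_within_open[where S="{-1<..<1}"])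
    show "t \<in> {-1<..<1}" using True by auto
  qed (auto simp: bump_term_def)
next
  case False
  obtain C where C: "\<And>u. \<bar>bump_term p n u\<bar> \<le> C * (1 - u\<^sup>2)\<^sup>2"
    using bump_term_bound by blast
  have C0: "C \<ge> 0" using C[of 0] abs_ge_zero[of "bump_term p n 0"] by simp
  have z: "bump_term p n t = 0" "case_prod bump_term (bump_step (p, n)) t = 0"
    using False by (auto simp: bump_term_def split: prod.split)
  have "((\<lambda>u. bump_term p n u / (u - t)) \<longlongrightarrow> 0) (at t)"
  proof (rule Lim_null_comparison)
    show "\<forall>\<^sub>F u in at t. norm (bump_term p n u / (u - t)) \<le> C * (\<bar>u - t\<bar> * (\<bar>t\<bar> + 1)\<^sup>2)"
    proof (rule always_eventually, rule allI)
      fix u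
      show "norm (bump_term p n u / (u - t)) \<le> C * (\<bar>u - t\<bar> * (\<bar>t\<bar> + 1)\<^sup>2)"
      proof (cases "\<bar>u\<bar> < 1")
        case u: True
        have ut: "u \<noteq> t" using u False by auto
        \<comment> \<open>Since |u| < 1 \<le> |t|, the factor 1 - |u| is at most |u - t|, and 1 +
          |u| is at most |t| + 1.\<close>
        have "1 - u\<^sup>2 = (1 - \<bar>u\<bar>) * (1 + \<bar>u\<bar>)" by (simp add: algebra_simps power2_eq_square)
        also have "\<dots> \<le> \<bar>u - t\<bar> * (\<bar>t\<bar> + 1)"
          using u False by (intro mult_mono) auto
        finally have 1: "1 - u\<^sup>2 \<le> \<bar>u - t\<bar> * (\<bar>t\<bar> + 1)" .
        have 0: "0 \<le> 1 - u\<^sup>2" using u by (simp add: abs_square_le_1)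
        have "\<bar>bump_term p n u\<bar> \<le> C * (\<bar>u - t\<bar> * (\<bar>t\<bar> + 1))\<^sup>2"
          using C[of u] mult_left_mono[OF power_mono[OF 1 0, of 2] C0] by linarith
        then have "\<bar>bump_term p n u\<bar> / \<bar>u - t\<bar> \<le> C * (\<bar>u - t\<bar> * (\<bar>t\<bar> + 1))\<^sup>2 / \<bar>u - t\<bar>"
          by (intro divide_right_mono) auto
        also have "\<dots> = C * (\<bar>u - t\<bar> * (\<bar>t\<bar> + 1)\<^sup>2)"
          using ut by (simp add: power2_eq_square)
        finally show ?thesis by simp
      next
        case False
        then show ?thesis using C0 by (simp add: bump_term_def)
      qed
    qed
    show "((\<lambda>u. C * (\<bar>u - t\<bar> * (\<bar>t\<bar> + 1)\<^sup>2)) \<longlongrightarrow> 0) (at t)"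
      by (auto intro!: tendsto_eq_intros)
  qed
  then show ?thesis
    unfolding has_field_derivative_iff using z by simp
qed

lemma smooth_bump_real:
  fixes \<epsilon> :: real
  assumes "\<epsilon> > 0"
  obtains E :: "nat \<Rightarrow> real \<Rightarrow> real" where
    "\<And>n t. (E n has_real_derivative E (Suc n) t) (at t)"
    "\<And>n t. \<bar>t\<bar> \<ge> \<epsilon> \<Longrightarrow> E n t = 0"
    "\<And>t. E 0 t \<ge> 0" "E 0 0 > 0" "\<And>t. E 0 (- t) = E 0 t"
proof -
  \<comment> \<open>The pair (1, 0) encodes the standard mollifier exp (-1 / (1 - t^2)); iterating
    \<open>bump_step\<close> lists all its derivatives, which the products below need in every
    coordinate.\<close>
  define D where "D k = case_prod bump_term ((bump_step ^^ k) (1, 0))" for k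
  have D: "(D k has_real_derivative D (Suc k) t) (at t)" for k t
    using bump_term_deriv[of "fst ((bump_step ^^ k) (1, 0))" "snd ((bump_step ^^ k) (1, 0))" t]
    by (simp add: D_def split_beta)
  define E where "E n t = D n (t / \<epsilon>) / \<epsilon> ^ n" for n t
  show ?thesis
  proof
    show "(E n has_real_derivative E (Suc n) t) (at t)" for n t
    proof -
      have "((\<lambda>t. D n (t / \<epsilon>)) has_real_derivative D (Suc n) (t / \<epsilon>) * (1 / \<epsilon>)) (at t)"
        by (rule DERIV_chain2[OF D]) (use assms in \<open>auto intro!: derivative_eq_intros\<close>)
      then have "((\<lambda>t. D n (t / \<epsilon>) / \<epsilon> ^ n) has_real_derivative D (Suc n) (t / \<epsilon>) * (1 / \<epsilon>) / \<epsilon> ^ n) (at t)"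
        by (rule DERIV_cdivide)
      moreover have "D (Suc n) (t / \<epsilon>) * (1 / \<epsilon>) / \<epsilon> ^ n = E (Suc n) t" by (simp add: E_def)
      ultimately show ?thesis unfolding E_def[abs_def] by simp
    qed
    show "E n t = 0" if "\<bar>t\<bar> \<ge> \<epsilon>" for n t
      using that assms by (simp add: E_def D_def bump_term_def split_beta abs_divide)
    show "E 0 t \<ge> 0" for t by (simp add: E_def D_def bump_term_def)
    show "E 0 0 > 0" by (simp add: E_def D_def bump_term_def)
    show "E 0 (- t) = E 0 t" for t by (simp add: E_def D_def bump_term_def)
  qed
qed

section \<open>Product bumps in several variables\<close>

definition tensor :: "(nat \<Rightarrow> real \<Rightarrow> real) \<Rightarrow> ('d::finite \<Rightarrow> nat) \<Rightarrow> real^'d \<Rightarrow> real" where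
  "tensor E n x = (\<Prod>i\<in>UNIV. E (n i) (x $ i))"

lemma tensor_deriv:
  assumes "\<And>n t. (E n has_real_derivative E (Suc n) t) (at t)"
  shows "((\<lambda>t. tensor E n (x + t *\<^sub>R axis i 1)) has_real_derivative tensor E (n(i := Suc (n i))) x) (at 0)"
proof -
  have eq: "tensor E m (x + t *\<^sub>R axis i 1) = E (m i) (x $ i + t) * (\<Prod>j\<in>UNIV - {i}. E (m j) (x $ j))" for m t
    unfolding tensor_def
    by (subst prod.remove[of _ i]) (auto simp: axis_def intro!: prod.cong)
  have "((\<lambda>t. E (n i) (x $ i + t)) has_real_derivative E (Suc (n i)) (x $ i + 0)) (at 0)"
    using assms[of "n i" "x $ i + 0"] by (simp only: DERIV_shift[symmetric] add.commute)
  from DERIV_cmult_right[OF this] show ?thesis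
    using eq[of "n(i := Suc (n i))" 0] by (simp add: eq)
qed

lemma partial_tensor:
  assumes "\<And>n t. (E n has_real_derivative E (Suc n) t) (at t)"
  shows "partial i (tensor E n) = tensor E (n(i := Suc (n i)))"
  by (rule ext) (auto simp: partial_def intro!: DERIV_imp_deriv tensor_deriv[of E, OF assms])

text \<open>\<open>tensor E n\<close> is the derivative with multi-index n of a product bump. This
  family is closed under \<open>partial\<close>, so every iterated partial derivative is again a
  member of it.\<close>

lemma smooth_fun_tensor:
  assumes "\<And>n t. (E n has_real_derivative E (Suc n) t) (at t)"
  shows "smooth_fun (tensor E (n :: 'd::finite \<Rightarrow> nat))"
proof -
  have ex: "\<exists>m. foldr partial is (tensor E n) = tensor E m" for "is" :: "'d list"
    by (induction "is") (auto simp: partial_tensor[of E, OF assms] intro: exI[of _ n])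
  have cont: "continuous_on UNIV (tensor E m)" for m :: "'d \<Rightarrow> nat"
    unfolding tensor_def[abs_def]
    by (intro continuous_on_prod continuous_on_compose2[OF DERIV_continuous_on[OF has_field_derivative_at_within[OF assms], of UNIV]] continuous_intros) auto
  show ?thesis
    unfolding smooth_fun_def
  proof (intro allI)
    fix "is" :: "'d list"
    obtain m where "foldr partial is (tensor E n) = tensor E m" using ex by blast
    then show "continuous_on UNIV (foldr partial is (tensor E n)) \<and>
        (\<forall>i x. (\<lambda>t. foldr partial is (tensor E n) (x + t *\<^sub>R axis i 1)) differentiable (at 0))"
      using cont tensor_deriv[of E m, OF assms] unfolding real_differentiable_def by metis
  qed
qed

text \<open>Commuting partial derivatives are required explicitly, which spares a proof of Schwarz's theorem;
  products of one-dimensional bumps are enough.\<close>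

definition commuting_test_fun :: "(real^'d::finite \<Rightarrow> real) \<Rightarrow> bool" where
  "commuting_test_fun \<psi> \<longleftrightarrow> test_fun \<psi> \<and> (\<forall>i j. partial i (partial j \<psi>) = partial j (partial i \<psi>))"

text \<open>Evenness makes first partial derivatives odd, which later compensates the reflection x
  -> -x caused by taking adjoints of translations. Small supports serve to localize at the
  origin.\<close>

lemma even_bump:
  fixes \<epsilon> :: real
  assumes "\<epsilon> > 0"
  obtains \<psi> :: "real^'d::finite \<Rightarrow> real" where
    "commuting_test_fun \<psi>" "\<And>x. \<psi> x \<ge> 0" "\<psi> 0 > 0" "\<And>x. \<psi> (- x) = \<psi> x" "\<And>x. norm x \<ge> \<epsilon> \<Longrightarrow> \<psi> x = 0"
proof -
  \<comment> \<open>The box |x_i| \<le> \<delta> has l1-radius d \<delta>; the extra 1 keeps this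
    strictly below \<epsilon>.\<close>
  define \<delta> where "\<delta> = \<epsilon> / (CARD('d) + 1)"
  have \<delta>: "\<delta> > 0" using assms by (simp add: \<delta>_def)
  obtain E :: "nat \<Rightarrow> real \<Rightarrow> real" where E:
    "\<And>n t. (E n has_real_derivative E (Suc n) t) (at t)"
    "\<And>n t. \<bar>t\<bar> \<ge> \<delta> \<Longrightarrow> E n t = 0"
    "\<And>t. E 0 t \<ge> 0" "E 0 0 > 0" "\<And>t. E 0 (- t) = E 0 t"
    using smooth_bump_real[OF \<delta>] by metis
  let ?\<psi> = "tensor E (\<lambda>_::'d. 0)"
  have supp: "?\<psi> x = 0" if "norm x \<ge> \<epsilon>" for x
  proof (rule ccontr)
    assume "?\<psi> x \<noteq> 0"
    then have "\<bar>x $ i\<bar> \<le> \<delta>" for i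
      using E(2)[of "x $ i" 0] by (force simp: tensor_def)
    then have "(\<Sum>i\<in>UNIV. \<bar>x $ i\<bar>) \<le> of_nat (card (UNIV :: 'd set)) * \<delta>"
      by (intro sum_bounded_above)
    also have "\<dots> < \<epsilon>" using assms by (simp add: \<delta>_def field_simps)
    finally show False using norm_le_l1_cart[of x] that by linarith
  qed
  have "closure {x. ?\<psi> x \<noteq> 0} \<subseteq> cball 0 \<epsilon>"
  proof (rule closure_minimal)
    show "{x. ?\<psi> x \<noteq> 0} \<subseteq> cball 0 \<epsilon>" using supp by (metis (mono_tags, lifting) linorder_le_cases mem_Collect_eq mem_cball_0 subsetI)
  qed simp
  then have "compact (closure {x. ?\<psi> x \<noteq> 0})"
    using bounded_subset[OF bounded_cball] by (auto simp: compact_eq_bounded_closed)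
  then have "test_fun ?\<psi>" using smooth_fun_tensor[of E, OF E(1)] by (simp add: test_fun_def)
  moreover have "partial i (partial j ?\<psi>) = partial j (partial i ?\<psi>)" for i j
    by (cases "i = j") (simp_all add: partial_tensor[of E, OF E(1)] fun_upd_twist)
  ultimately have "commuting_test_fun ?\<psi>" by (simp add: commuting_test_fun_def)
  moreover have "?\<psi> x \<ge> 0" for x unfolding tensor_def by (intro prod_nonneg) (use E in auto)
  moreover have "?\<psi> 0 > 0" unfolding tensor_def by (intro prod_pos) (use E in auto)
  moreover have "?\<psi> (- x) = ?\<psi> x" for x by (simp add: tensor_def E(5))
  ultimately show ?thesis using that supp by blast
qed

section \<open>Calculus of test functions\<close>

lemma test_fun_has_derivative:
  assumes "test_fun \<psi>"
  shows "((\<lambda>t. \<psi> (x + t *\<^sub>R axis i 1)) has_real_derivative partial i \<psi> (x + s *\<^sub>R axis i 1)) (at s)"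
proof -
  have "(\<lambda>t. \<psi> ((x + s *\<^sub>R axis i 1) + t *\<^sub>R axis i 1)) differentiable (at 0)"
    using assms unfolding test_fun_def smooth_fun_def by (metis foldr.simps(1) id_apply)
  then have "((\<lambda>t. \<psi> ((x + s *\<^sub>R axis i 1) + t *\<^sub>R axis i 1)) has_real_derivative partial i \<psi> (x + s *\<^sub>R axis i 1)) (at 0)"
    unfolding partial_def using DERIV_deriv_iff_real_differentiable by blast
  then have "((\<lambda>t. \<psi> (x + (t + s) *\<^sub>R axis i 1)) has_real_derivative partial i \<psi> (x + s *\<^sub>R axis i 1)) (at 0)"
    by (simp add: algebra_simps)
  then show ?thesis using DERIV_shift[of "\<lambda>t. \<psi> (x + t *\<^sub>R axis i 1)" _ 0 s] by simp
qed

lemma test_fun_continuous: "test_fun \<psi> \<Longrightarrow> continuous_on UNIV \<psi>"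
  unfolding test_fun_def smooth_fun_def by (metis foldr.simps(1) id_apply)

lemma test_fun_partial:
  assumes "test_fun \<psi>"
  shows "test_fun (partial i \<psi>)"
proof -
  have "smooth_fun (partial i \<psi>)"
    unfolding smooth_fun_def
  proof (intro allI)
    fix "is" :: "'a list"
    \<comment> \<open>The last list entry is the innermost derivative, so appending i means
      differentiating by i before the rest.\<close>
    have "foldr partial (is @ [i]) \<psi> = foldr partial is (partial i \<psi>)" by simp
    then show "continuous_on UNIV (foldr partial is (partial i \<psi>)) \<and>
        (\<forall>ia x. (\<lambda>t. foldr partial is (partial i \<psi>) (x + t *\<^sub>R axis ia 1)) differentiable (at 0))"
      using assms unfolding test_fun_def smooth_fun_def by metis
  qed
  moreover have "{x. partial i \<psi> x \<noteq> 0} \<subseteq> closure {x. \<psi> x \<noteq> 0}"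
  proof (rule ccontr)
    assume "\<not> ?thesis"
    then obtain x where x: "partial i \<psi> x \<noteq> 0" "x \<in> - closure {x. \<psi> x \<noteq> 0}" by blast
    define S where "S = (\<lambda>t. x + t *\<^sub>R axis i 1) -` (- closure {x. \<psi> x \<noteq> 0})"
    have S: "open S" unfolding S_def
      by (intro open_vimage) (auto intro!: continuous_intros)
    have "((\<lambda>t. \<psi> (x + t *\<^sub>R axis i 1)) has_real_derivative 0) (at 0)"
      by (rule has_field_derivative_transform_within_open[OF DERIV_const S, of 0 0])
         (use x closure_subset[of "{x. \<psi> x \<noteq> 0}"] in \<open>auto simp: S_def\<close>)
    with x(1) show False
      using DERIV_unique[OF test_fun_has_derivative[OF assms, of x i 0]] by simp
  qed
  then have "closure {x. partial i \<psi> x \<noteq> 0} \<subseteq> closure {x. \<psi> x \<noteq> 0}"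
    by (rule closure_minimal) simp
  ultimately show ?thesis
    using assms bounded_subset unfolding test_fun_def compact_eq_bounded_closed by blast
qed

lemma commuting_test_funD: "commuting_test_fun \<psi> \<Longrightarrow> test_fun \<psi>"
  by (simp add: commuting_test_fun_def)

lemma partial_odd:
  assumes "test_fun \<psi>" "\<And>x. \<psi> (- x) = \<psi> x"
  shows "partial i \<psi> (- x) = - partial i \<psi> x"
proof -
  have "((\<lambda>t. \<psi> (x + t *\<^sub>R axis i 1)) has_real_derivative partial i \<psi> x) (at (- 0))"
    using test_fun_has_derivative[OF assms(1), of x i 0] by simp
  then have "((\<lambda>t. \<psi> (x + (- t) *\<^sub>R axis i 1)) has_real_derivative - partial i \<psi> x) (at 0)"
    by (subst (asm) DERIV_mirror)
  moreover have "\<psi> (x + (- t) *\<^sub>R axis i 1) = \<psi> (- x + t *\<^sub>R axis i 1)" for t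
    using assms(2)[of "- x + t *\<^sub>R axis i 1"] by (simp add: algebra_simps)
  ultimately show ?thesis
    using DERIV_unique[OF test_fun_has_derivative[OF assms(1), of "-x" i 0]] by simp
qed

lemma test_fun_integrable:
  assumes "test_fun \<psi>"
  shows "integrable lborel \<psi>"
proof -
  have "integrable lborel (\<lambda>x. indicator (closure {x. \<psi> x \<noteq> 0}) x *\<^sub>R \<psi> x)"
    using assms continuous_on_subset[OF test_fun_continuous[OF assms]]
    by (intro borel_integrable_compact) (auto simp: test_fun_def)
  moreover have "(\<lambda>x. indicator (closure {x. \<psi> x \<noteq> 0}) x *\<^sub>R \<psi> x) = \<psi>"
    using closure_subset[of "{x. \<psi> x \<noteq> 0}"] by (intro ext) (auto simp: indicator_def)
  ultimately show ?thesis by metis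
qed

subsection \<open>Square-integrable stationary fields and their correlations\<close>

text \<open>Functions rather than classes, over an arbitrary measure: besides the probability space
  it is also applied to Lebesgue measure on the line.\<close>

definition L2 :: "'w measure \<Rightarrow> ('w \<Rightarrow> 'b::euclidean_space) \<Rightarrow> bool" where
  "L2 M f \<longleftrightarrow> f \<in> borel_measurable M \<and> integrable M (\<lambda>\<omega>. (norm (f \<omega>))\<^sup>2)"

lemma L2_measurable[measurable_dest]: "L2 M f \<Longrightarrow> f \<in> borel_measurable M"
  by (simp add: L2_def)

lemma L2_norm_integrable: "L2 M f \<Longrightarrow> integrable M (\<lambda>\<omega>. (norm (f \<omega>))\<^sup>2)"
  by (simp add: L2_def)

lemma L2_bound:
  assumes "L2 M f" "g \<in> borel_measurable M" "AE \<omega> in M. norm (g \<omega>) \<le> C * norm (f \<omega>)"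
  shows "L2 M g"
proof -
  have "integrable M (\<lambda>\<omega>. C\<^sup>2 * (norm (f \<omega>))\<^sup>2)"
    using assms by (simp add: L2_def)
  then have "integrable M (\<lambda>\<omega>. (norm (g \<omega>))\<^sup>2)"
  proof (rule Bochner_Integration.integrable_bound)
    show "AE x in M. norm ((norm (g x))\<^sup>2) \<le> norm (C\<^sup>2 * (norm (f x))\<^sup>2)"
      using assms(3)
    proof eventually_elim
      case (elim x)
      then have "(norm (g x))\<^sup>2 \<le> (C * norm (f x))\<^sup>2" by (intro power_mono) auto
      then show ?case by (simp add: power_mult_distrib)
    qed
  qed (use assms(2) in measurable)
  with assms(2) show ?thesis by (simp add: L2_def)
qed

lemma norm_sq_diff_le:
  fixes x y :: "'b::real_inner"
  shows "(norm (x - y))\<^sup>2 \<le> 2 * (norm x)\<^sup>2 + 2 * (norm y)\<^sup>2"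
  using zero_le_power2[of "norm (x + y)"] by (simp add: power2_norm_eq_inner algebra_simps inner_commute)

lemma norm_sq_add_le:
  fixes x y :: "'b::real_inner"
  shows "(norm (x + y))\<^sup>2 \<le> 2 * (norm x)\<^sup>2 + 2 * (norm y)\<^sup>2"
  using norm_sq_diff_le[of x "- y"] by simp

lemma L2_add:
  assumes "L2 M f" "L2 M g"
  shows "L2 M (\<lambda>\<omega>. f \<omega> + g \<omega>)"
proof -
  have "integrable M (\<lambda>\<omega>. 2 * (norm (f \<omega>))\<^sup>2 + 2 * (norm (g \<omega>))\<^sup>2)"
    using assms by (simp add: L2_def)
  then have "integrable M (\<lambda>\<omega>. (norm (f \<omega> + g \<omega>))\<^sup>2)"
    by (rule Bochner_Integration.integrable_bound) (use assms norm_sq_add_le in \<open>auto simp: L2_def\<close>)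
  then show ?thesis using assms by (auto simp: L2_def)
qed

lemma L2_scaleR: "L2 M f \<Longrightarrow> L2 M (\<lambda>\<omega>. c *\<^sub>R f \<omega>)"
  by (rule L2_bound[where f=f and C="\<bar>c\<bar>"]) (auto simp: L2_def)

lemma L2_diff: "L2 M f \<Longrightarrow> L2 M g \<Longrightarrow> L2 M (\<lambda>\<omega>. f \<omega> - g \<omega>)"
  using L2_add[of M f "\<lambda>\<omega>. (-1) *\<^sub>R g \<omega>"] L2_scaleR[of M g "-1"] by simp

lemma L2_const: "finite_measure M \<Longrightarrow> L2 M (\<lambda>\<omega>. c)"
  by (simp add: L2_def finite_measure.integrable_const)

lemma borel_measurable_vec_nth: "(\<lambda>x. x $ i) \<in> borel_measurable borel"
  by (intro borel_measurable_continuous_onI continuous_intros)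

lemma L2_component: "L2 M f \<Longrightarrow> L2 M (\<lambda>\<omega>. f \<omega> $ i)"
  by (rule L2_bound[where f=f and C=1]) (auto simp: L2_def Finite_Cartesian_Product.norm_nth_le intro: measurable_compose[OF _ borel_measurable_vec_nth])

lemma L2_inner_integrable:
  assumes "L2 M f" "L2 M g"
  shows "integrable M (\<lambda>\<omega>. f \<omega> \<bullet> g \<omega>)"
proof -
  have "integrable M (\<lambda>\<omega>. (norm (f \<omega>))\<^sup>2 + (norm (g \<omega>))\<^sup>2)"
    using assms by (simp add: L2_def)
  then show ?thesis
  proof (rule Bochner_Integration.integrable_bound)
    have "\<bar>a \<bullet> b\<bar> \<le> (norm a)\<^sup>2 + (norm b)\<^sup>2" for a b :: 'b
      using Cauchy_Schwarz_ineq2[of a b] sum_squares_bound[of "norm a" "norm b"] 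
        mult_nonneg_nonneg[OF norm_ge_zero[of a] norm_ge_zero[of b]] by linarith
    then show "AE x in M. norm (f x \<bullet> g x) \<le> norm ((norm (f x))\<^sup>2 + (norm (g x))\<^sup>2)"
      by simp
  qed (use assms in \<open>auto simp: L2_def\<close>)
qed

lemma L2_mult_integrable:
  fixes f g :: "'w \<Rightarrow> real"
  shows "L2 M f \<Longrightarrow> L2 M g \<Longrightarrow> integrable M (\<lambda>\<omega>. f \<omega> * g \<omega>)"
  using L2_inner_integrable[of M f g] by simp

lemma L2_integrable:
  assumes "finite_measure M" "L2 M f"
  shows "integrable M f"
proof -
  have "integrable M (\<lambda>\<omega>. 1 + (norm (f \<omega>))\<^sup>2)"
    using assms by (simp add: L2_def finite_measure.integrable_const)
  moreover have "norm x \<le> 1 + (norm x)\<^sup>2" for x :: 'b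
    using sum_squares_bound[of 1 "norm x"] norm_ge_zero[of x] by (simp del: norm_ge_zero)
  ultimately show ?thesis
    by (intro Bochner_Integration.integrable_bound[of M _ f]) (use assms in \<open>auto simp: L2_def\<close>)
qed

lemma L2_norm_sq_expand:
  assumes "L2 M f" "L2 M g"
  shows "(\<integral>\<omega>. (norm (f \<omega> + t *\<^sub>R g \<omega>))\<^sup>2 \<partial>M) =
    (\<integral>\<omega>. (norm (f \<omega>))\<^sup>2 \<partial>M) + 2 * t * (\<integral>\<omega>. f \<omega> \<bullet> g \<omega> \<partial>M) + t\<^sup>2 * (\<integral>\<omega>. (norm (g \<omega>))\<^sup>2 \<partial>M)"
proof -
  have "(norm (f \<omega> + t *\<^sub>R g \<omega>))\<^sup>2 = (norm (f \<omega>))\<^sup>2 + 2 * t * (f \<omega> \<bullet> g \<omega>) + t\<^sup>2 * (norm (g \<omega>))\<^sup>2" for \<omega>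
    by (simp only: power2_norm_eq_inner) (simp add: algebra_simps inner_commute power2_eq_square)
  then show ?thesis
    using L2_norm_integrable[OF assms(1)] L2_norm_integrable[OF assms(2)] L2_inner_integrable[OF assms]
    by simp
qed

lemma L2_Cauchy_Schwarz:
  assumes "L2 M f" "L2 M g"
  shows "\<bar>\<integral>\<omega>. f \<omega> \<bullet> g \<omega> \<partial>M\<bar> \<le> sqrt (\<integral>\<omega>. (norm (f \<omega>))\<^sup>2 \<partial>M) * sqrt (\<integral>\<omega>. (norm (g \<omega>))\<^sup>2 \<partial>M)"
proof -
  let ?a = "\<integral>\<omega>. (norm (f \<omega>))\<^sup>2 \<partial>M" and ?b = "\<integral>\<omega>. f \<omega> \<bullet> g \<omega> \<partial>M" and ?c = "\<integral>\<omega>. (norm (g \<omega>))\<^sup>2 \<partial>M"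
  have q: "0 \<le> ?a + 2 * t * ?b + t\<^sup>2 * ?c" for t
    using L2_norm_sq_expand[OF assms, of t] integral_nonneg_AE[of "\<lambda>\<omega>. (norm (f \<omega> + t *\<^sub>R g \<omega>))\<^sup>2" M] by simp
  have c0: "?c \<ge> 0" by simp
  have "?b\<^sup>2 \<le> ?a * ?c"
  proof (cases "?c = 0")
    case True
    have "?b = 0"
    proof (rule ccontr)
      assume b: "?b \<noteq> 0"
      \<comment> \<open>For c = 0 the quadratic in t is affine, and this t gives it the value
        -1.\<close>
      show False using q[of "- (?a + 1) / (2 * ?b)"] b True by (simp add: field_simps)
    qed
    then show ?thesis using True by simp
  next
    case False
    then have "?c > 0" using c0 by linarith
    then show ?thesis using q[of "- ?b / ?c"] by (simp add: field_simps power2_eq_square)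
  qed
  then have "sqrt (?b\<^sup>2) \<le> sqrt (?a * ?c)" by (rule real_sqrt_le_mono)
  then show ?thesis by (simp add: real_sqrt_mult)
qed

section \<open>The flow and its correlation functions\<close>

locale ergodic_flow = prob_space M for M :: "'w measure" +
  fixes \<theta> :: "real^'d::finite \<Rightarrow> 'w \<Rightarrow> 'w"
  assumes ergodic: "ergodic_action M \<theta>"
begin

lemma flow_measurable[measurable]: "\<theta> x \<in> M \<rightarrow>\<^sub>M M"
  using ergodic by (simp add: ergodic_action_def)

lemma flow_space: "\<omega> \<in> space M \<Longrightarrow> \<theta> x \<omega> \<in> space M"
  using measurable_space[OF flow_measurable] .

lemma flow_joint: "(\<lambda>(x, \<omega>). \<theta> x \<omega>) \<in> lborel \<Otimes>\<^sub>M M \<rightarrow>\<^sub>M M"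
proof -
  have "(\<lambda>(\<omega>, x). \<theta> x \<omega>) \<in> M \<Otimes>\<^sub>M lborel \<rightarrow>\<^sub>M M"
    using ergodic by (simp add: ergodic_action_def)
  from measurable_pair_swap[OF this] show ?thesis by (simp add: split_beta')
qed

lemma flow_joint_comp:
  assumes "f \<in> borel_measurable M"
  shows "(\<lambda>(x, \<omega>). f (\<theta> x \<omega>)) \<in> borel_measurable (lborel \<Otimes>\<^sub>M M)"
  using measurable_compose[OF flow_joint assms] by (simp add: split_beta')

lemma flow_joint_comp2:
  assumes "f \<in> borel_measurable M" "p \<in> N \<rightarrow>\<^sub>M borel"
  shows "(\<lambda>(t, \<omega>). f (\<theta> (p t) \<omega>)) \<in> borel_measurable (N \<Otimes>\<^sub>M M)"
proof -
  have "(\<lambda>(t, \<omega>). (p t, \<omega>)) \<in> (N \<Otimes>\<^sub>M M) \<rightarrow>\<^sub>M (lborel \<Otimes>\<^sub>M M)" using assms(2) by measurable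
  from measurable_compose[OF this flow_joint_comp[OF assms(1)]]
  show ?thesis by (simp add: split_beta')
qed

lemma flow_path_measurable:
  assumes "f \<in> borel_measurable M" "\<omega> \<in> space M"
  shows "(\<lambda>x. f (\<theta> x \<omega>)) \<in> borel_measurable lborel"
  using measurable_compose[OF measurable_Pair2'[OF assms(2), of lborel] flow_joint_comp[OF assms(1)]]
  by simp

lemma flow_zero: "\<omega> \<in> space M \<Longrightarrow> \<theta> 0 \<omega> = \<omega>"
  using ergodic by (simp add: ergodic_action_def)

lemma flow_add: "\<omega> \<in> space M \<Longrightarrow> \<theta> x (\<theta> y \<omega>) = \<theta> (x + y) \<omega>"
  using ergodic by (simp add: ergodic_action_def)

lemma invariant_prob:
  assumes "E \<in> sets M" "\<And>x. \<theta> x -` E \<inter> space M = E"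
  shows "prob E = 0 \<or> prob E = 1"
proof -
  have "\<forall>E\<in>sets M. (\<forall>x. \<theta> x -` E \<inter> space M = E) \<longrightarrow> prob E = 0 \<or> prob E = 1"
    using ergodic by (simp add: ergodic_action_def)
  with assms show ?thesis by simp
qed

lemma flow_distr: "distr M M (\<theta> x) = M"
  using ergodic by (simp add: ergodic_action_def)

lemma integral_flow:
  fixes f :: "'w \<Rightarrow> 'b::{banach, second_countable_topology}"
  assumes "f \<in> borel_measurable M"
  shows "(\<integral>\<omega>. f (\<theta> x \<omega>) \<partial>M) = (\<integral>\<omega>. f \<omega> \<partial>M)"
  using integral_distr[OF flow_measurable assms, of x] by (simp add: flow_distr)

lemma integrable_flow:
  fixes f :: "'w \<Rightarrow> 'b::{banach, second_countable_topology}"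
  assumes "integrable M f"
  shows "integrable M (\<lambda>\<omega>. f (\<theta> x \<omega>))"
  using integrable_distr[OF flow_measurable[of x], of f] assms by (simp add: flow_distr)

lemma L2_flow:
  assumes "L2 M f"
  shows "L2 M (\<lambda>\<omega>. f (\<theta> x \<omega>))"
  using assms integrable_flow[of "\<lambda>\<omega>. (norm (f \<omega>))\<^sup>2"] by (auto simp: L2_def)

lemma L2_norm_flow:
  assumes "L2 M f"
  shows "(\<integral>\<omega>. (norm (f (\<theta> x \<omega>)))\<^sup>2 \<partial>M) = (\<integral>\<omega>. (norm (f \<omega>))\<^sup>2 \<partial>M)"
  by (rule integral_flow) (use assms in \<open>auto simp: L2_def\<close>)

text \<open>The matrix coefficient <U_x f, g> of the translation group. It is a deterministic
  function of x, so identities between such functions carry no exceptional set of \<omega>.\<close>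

definition corr :: "('w \<Rightarrow> real) \<Rightarrow> ('w \<Rightarrow> real) \<Rightarrow> real^'d \<Rightarrow> real" where
  "corr f g x = (\<integral>\<omega>. f (\<theta> x \<omega>) * g \<omega> \<partial>M)"

lemma corr_zero: "corr f g 0 = (\<integral>\<omega>. f \<omega> * g \<omega> \<partial>M)"
  unfolding corr_def by (rule Bochner_Integration.integral_cong) (auto simp: flow_zero)

lemma corr_flow_left: "corr (\<lambda>\<omega>. f (\<theta> z \<omega>)) g x = corr f g (x + z)"
  unfolding corr_def by (rule Bochner_Integration.integral_cong) (auto simp: flow_add flow_space add.commute)

text \<open>By measure preservation the adjoint of U_z is U_{-z}.\<close>

lemma corr_flow_right:
  assumes "L2 M f" "L2 M g"
  shows "corr f (\<lambda>\<omega>. g (\<theta> z \<omega>)) x = corr f g (x - z)"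
proof -
  have [measurable]: "f \<in> borel_measurable M" "g \<in> borel_measurable M" using assms by (auto simp: L2_def)
  have "corr f g (x - z) = (\<integral>\<omega>. f (\<theta> (x - z) (\<theta> z \<omega>)) * g (\<theta> z \<omega>) \<partial>M)"
    unfolding corr_def by (rule integral_flow[symmetric]) measurable
  also have "\<dots> = corr f (\<lambda>\<omega>. g (\<theta> z \<omega>)) x"
    unfolding corr_def by (rule Bochner_Integration.integral_cong) (auto simp: flow_add)
  finally show ?thesis ..
qed

lemma corr_swap:
  assumes "L2 M f" "L2 M g"
  shows "corr f g x = corr g f (- x)"
proof -
  have [measurable]: "f \<in> borel_measurable M" "g \<in> borel_measurable M" using assms by (auto simp: L2_def)
  have "corr f g x = (\<integral>\<omega>. f (\<theta> x (\<theta> (- x) \<omega>)) * g (\<theta> (- x) \<omega>) \<partial>M)"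
    unfolding corr_def by (rule integral_flow[symmetric]) measurable
  also have "\<dots> = corr g f (- x)"
    unfolding corr_def by (rule Bochner_Integration.integral_cong) (auto simp: flow_add flow_zero)
  finally show ?thesis .
qed

lemma corr_diff_left:
  assumes "L2 M f" "L2 M f'" "L2 M g"
  shows "corr (\<lambda>\<omega>. f \<omega> - f' \<omega>) g x = corr f g x - corr f' g x"
  unfolding corr_def
  using L2_mult_integrable[OF L2_flow[OF assms(1)] assms(3)] L2_mult_integrable[OF L2_flow[OF assms(2)] assms(3)]
  by (simp add: left_diff_distrib)

lemma corr_scale_left: "corr (\<lambda>\<omega>. c * f \<omega>) g x = c * corr f g x"
  unfolding corr_def by (simp add: mult.assoc)

lemma corr_bound:
  assumes "L2 M f" "L2 M g"
  shows "\<bar>corr f g x\<bar> \<le> sqrt (\<integral>\<omega>. (f \<omega>)\<^sup>2 \<partial>M) * sqrt (\<integral>\<omega>. (g \<omega>)\<^sup>2 \<partial>M)"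
  using L2_Cauchy_Schwarz[OF L2_flow[OF assms(1)] assms(2), of x] L2_norm_flow[OF assms(1), of x]
  by (simp add: corr_def)

lemma corr_measurable:
  assumes "L2 M f" "L2 M g"
  shows "corr f g \<in> borel_measurable borel"
proof -
  have [measurable]: "(\<lambda>(x, \<omega>). f (\<theta> x \<omega>)) \<in> borel_measurable (lborel \<Otimes>\<^sub>M M)" "g \<in> borel_measurable M"
    using assms flow_joint_comp by (auto simp: L2_def)
  have "(\<lambda>x. \<integral>\<omega>. f (\<theta> x \<omega>) * g \<omega> \<partial>M) \<in> borel_measurable lborel"
    by measurable
  then show ?thesis by (simp add: corr_def[abs_def])
qed

lemma integrable_corr_comp:
  assumes "L2 M f" "L2 M g" "integrable N k" "p \<in> N \<rightarrow>\<^sub>M borel"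
  shows "integrable N (\<lambda>t. k t * corr f g (p t))"
proof -
  let ?C = "sqrt (\<integral>\<omega>. (f \<omega>)\<^sup>2 \<partial>M) * sqrt (\<integral>\<omega>. (g \<omega>)\<^sup>2 \<partial>M)"
  have "integrable N (\<lambda>x. ?C * k x)" using assms(3) by (rule integrable_mult_right)
  then show ?thesis
  proof (rule Bochner_Integration.integrable_bound)
    have "\<bar>k x * corr f g (p x)\<bar> \<le> \<bar>?C * k x\<bar>" for x
      using mult_left_mono[OF corr_bound[OF assms(1,2), of "p x"], of "\<bar>k x\<bar>"]
      by (simp add: abs_mult mult.commute)
    then show "AE x in N. norm (k x * corr f g (p x)) \<le> norm (?C * k x)" by simp
  qed (use corr_measurable[OF assms(1,2)] assms(3,4) in measurable)
qed

text \<open>N and p are general because the result serves both kernels on the whole space (p the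
  identity) and segments along an axis. Absolute integrability reduces to the correlation of |f| and
  |g|, bounded uniformly in x.\<close>

lemma integrable_kernel_corr:
  fixes f g :: "'w \<Rightarrow> real"
  assumes "sigma_finite_measure N" "p \<in> N \<rightarrow>\<^sub>M borel" "L2 M f" "L2 M g" "integrable N k"
  shows "integrable (N \<Otimes>\<^sub>M M) (\<lambda>(t, \<omega>). k t * (f (\<theta> (p t) \<omega>) * g \<omega>))"
proof -
  interpret N: sigma_finite_measure N by fact
  interpret NM: pair_sigma_finite N M ..
  have [measurable]: "(\<lambda>(t, \<omega>). f (\<theta> (p t) \<omega>)) \<in> borel_measurable (N \<Otimes>\<^sub>M M)" "g \<in> borel_measurable M"
    "f \<in> borel_measurable M" "k \<in> borel_measurable N"
    using assms flow_joint_comp2 by (auto simp: L2_def)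
  have abs: "L2 M (\<lambda>\<omega>. \<bar>f \<omega>\<bar>)" "L2 M (\<lambda>\<omega>. \<bar>g \<omega>\<bar>)"
    using assms by (auto simp: L2_def)
  have int: "integrable M (\<lambda>\<omega>. f (\<theta> x \<omega>) * g \<omega>)" for x
    by (rule L2_mult_integrable[OF L2_flow[OF assms(3)] assms(4)])
  have "integrable N (\<lambda>t. \<bar>k t\<bar> * corr (\<lambda>\<omega>. \<bar>f \<omega>\<bar>) (\<lambda>\<omega>. \<bar>g \<omega>\<bar>) (p t))"
    by (rule integrable_corr_comp[OF abs _ assms(2)]) (use assms(5) in simp)
  then show ?thesis
    by (intro NM.Fubini_integrable) (auto simp: corr_def abs_mult int)
qed

lemma integral_kernel_corr:
  fixes f g :: "'w \<Rightarrow> real"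
  assumes "sigma_finite_measure N" "p \<in> N \<rightarrow>\<^sub>M borel" "L2 M f" "L2 M g" "integrable N k"
  shows "integrable M (\<lambda>\<omega>. (\<integral>t. k t * f (\<theta> (p t) \<omega>) \<partial>N) * g \<omega>)"
    and "(\<integral>\<omega>. (\<integral>t. k t * f (\<theta> (p t) \<omega>) \<partial>N) * g \<omega> \<partial>M) = (\<integral>t. k t * corr f g (p t) \<partial>N)"
proof -
  interpret N: sigma_finite_measure N by fact
  interpret NM: pair_sigma_finite N M ..
  have eq: "(\<integral>t. k t * (f (\<theta> (p t) \<omega>) * g \<omega>) \<partial>N) = (\<integral>t. k t * f (\<theta> (p t) \<omega>) \<partial>N) * g \<omega>" for \<omega>
    by (simp add: mult.assoc[symmetric])
  show "integrable M (\<lambda>\<omega>. (\<integral>t. k t * f (\<theta> (p t) \<omega>) \<partial>N) * g \<omega>)"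
    using NM.integrable_snd[OF integrable_kernel_corr[OF assms]] by (simp add: eq)
  show "(\<integral>\<omega>. (\<integral>t. k t * f (\<theta> (p t) \<omega>) \<partial>N) * g \<omega> \<partial>M) = (\<integral>t. k t * corr f g (p t) \<partial>N)"
    using NM.Fubini_integral[OF integrable_kernel_corr[OF assms]] by (simp add: eq corr_def)
qed

lemma AE_integrable_kernel:
  fixes f :: "'w \<Rightarrow> real"
  assumes "L2 M f" "integrable lborel k"
  shows "AE \<omega> in M. integrable lborel (\<lambda>x. k x * f (\<theta> x \<omega>))"
proof -
  interpret lborel_M: pair_sigma_finite lborel M ..
  show ?thesis
    \<comment> \<open>Pairing with the constant 1 leaves the kernel integrand itself.\<close>
    using lborel_M.AE_integrable_snd[OF integrable_kernel_corr[OF lborel.sigma_finite_measure_axioms _ assms(1) L2_const assms(2), of "\<lambda>x. x" 1]]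
    by (simp add: finite_measure_axioms)
qed

end

subsection \<open>Continuity of translations\<close>

lemma lborel_integral_translation:
  fixes f :: "'a::euclidean_space \<Rightarrow> real"
  assumes [measurable]: "f \<in> borel_measurable borel"
  shows "(\<integral>x. f (x + c) \<partial>lborel) = (\<integral>x. f x \<partial>lborel)"
proof -
  have "(\<integral>x. f x \<partial>distr lborel borel ((+) c)) = (\<integral>x. f (c + x) \<partial>lborel)"
    by (rule integral_distr) auto
  then show ?thesis by (simp add: lborel_distr_plus add.commute)
qed

lemma lborel_integral_reflect:
  fixes f :: "'a::euclidean_space \<Rightarrow> real"
  assumes [measurable]: "f \<in> borel_measurable borel"
  shows "(\<integral>x. f (- x) \<partial>lborel) = (\<integral>x. f x \<partial>lborel)"
proof -
  have "lborel = distr lborel borel (\<lambda>x::'a. - x)"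
    using lborel_affine[of "-1" "0::'a"] by (simp add: density_1)
  then have "(\<integral>x. f x \<partial>lborel) = (\<integral>x. f x \<partial>distr lborel borel (\<lambda>x::'a. - x))" by simp
  also have "\<dots> = (\<integral>x. f (- x) \<partial>lborel)" by (rule integral_distr) auto
  finally show ?thesis ..
qed

lemma integrable_lborel_translation:
  fixes f :: "'a::euclidean_space \<Rightarrow> real"
  assumes "integrable lborel f"
  shows "integrable lborel (\<lambda>x. f (x + c))"
proof -
  have "integrable (distr lborel borel ((+) c)) f" using assms by (simp add: lborel_distr_plus)
  then have "integrable lborel (\<lambda>x. f (c + x))" by (rule integrable_distr[rotated]) auto
  then show ?thesis by (simp add: add.commute)
qed

lemma cball_borel[measurable]: "cball (a::'a::euclidean_space) r \<in> sets borel"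
  by (intro borel_closed closed_cball)

lemma integrable_bounded_on_cball:
  fixes f :: "'a::euclidean_space \<Rightarrow> real"
  assumes "f \<in> borel_measurable borel" "\<And>x. \<bar>f x\<bar> \<le> B"
  shows "integrable lborel (\<lambda>x. indicator (cball 0 r) x * f x)"
proof (rule Bochner_Integration.integrable_bound)
  show "integrable lborel (\<lambda>x. B * indicator (cball (0::'a) r) x)"
    using emeasure_compact_finite[OF compact_cball[of "0::'a" r]] by (intro integrable_mult_right) (simp add: integrable_indicator_iff)
  have "0 \<le> B" using assms(2)[of 0] by linarith
  then show "AE x in lborel. norm (indicator (cball 0 r) x * f x) \<le> norm (B * indicator (cball 0 r) x)"
    using assms(2) by (auto simp: indicator_def)
qed (use assms(1) in measurable)

text \<open>A measurable function is an almost everywhere limit of continuous ones; truncating these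
  at level B permits dominated convergence on the ball.\<close>

lemma continuous_approximation:
  fixes h :: "'a::euclidean_space \<Rightarrow> real"
  assumes [measurable]: "h \<in> borel_measurable borel" and B: "\<And>x. \<bar>h x\<bar> \<le> B" and "0 < e"
  obtains g where "continuous_on UNIV g" "\<And>x. \<bar>g x\<bar> \<le> B"
    "(\<integral>x. indicator (cball 0 r) x * \<bar>g x - h x\<bar> \<partial>lborel) < e"
proof -
  have B0: "0 \<le> B" using B[of 0] by linarith
  have "h \<in> borel_measurable lebesgue"
    using assms(1) by (simp add: measurable_completion)
  then have "h measurable_on UNIV"
    by (simp add: measurable_on_iff_borel_measurable)
  then obtain N g where N: "negligible N" and g: "\<And>n. continuous_on UNIV (g n)"
    and lim: "\<And>x. x \<notin> N \<Longrightarrow> (\<lambda>n. g n x) \<longlonglongrightarrow> h x"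
    by (auto simp: measurable_on_def)
  have AEN: "AE x in lborel. x \<notin> N"
    using N AE_completion_iff[of "\<lambda>x. x \<notin> N" "lborel :: 'a measure"] by (auto simp: negligible_iff_null_sets intro: AE_not_in)
  define g' where "g' n x = max (- B) (min B (g n x))" for n x
  have cont: "continuous_on UNIV (g' n)" for n unfolding g'_def by (intro continuous_intros g)
  have [measurable]: "g' n \<in> borel_measurable borel" for n
    using cont by (rule borel_measurable_continuous_onI)
  have bd: "\<bar>g' n x\<bar> \<le> B" for n x using B0 by (auto simp: g'_def)
  have lim': "(\<lambda>n. g' n x) \<longlonglongrightarrow> h x" if "x \<notin> N" for x
  proof -
    have "(\<lambda>n. g' n x) \<longlonglongrightarrow> max (- B) (min B (h x))"
      unfolding g'_def by (intro tendsto_intros lim that)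
    moreover have "max (- B) (min B (h x)) = h x" using B[of x] by auto
    ultimately show ?thesis by simp
  qed
  have "(\<lambda>n. \<integral>x. indicator (cball 0 r) x * \<bar>g' n x - h x\<bar> \<partial>lborel) \<longlonglongrightarrow> (\<integral>x. (0::real) \<partial>(lborel :: 'a measure))"
  proof (rule integral_dominated_convergence[where w="\<lambda>x. indicator (cball 0 r) x * (2 * B)"])
    show "integrable lborel (\<lambda>x. indicator (cball (0::'a) r) x * (2 * B))"
      by (rule integrable_bounded_on_cball[of "\<lambda>_. 2 * B" "2 * B"]) (use B0 in auto)
    show "AE x in lborel. (\<lambda>n. indicator (cball 0 r) x * \<bar>g' n x - h x\<bar>) \<longlonglongrightarrow> 0"
      using AEN
    proof eventually_elim
      case (elim x)
      have "(\<lambda>n. indicator (cball 0 r) x * \<bar>g' n x - h x\<bar>) \<longlonglongrightarrow> indicator (cball 0 r) x * \<bar>h x - h x\<bar>"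
        by (intro tendsto_intros lim' elim)
      then show ?case by simp
    qed
    show "AE x in lborel. norm (indicator (cball 0 r) x * \<bar>g' n x - h x\<bar>) \<le> indicator (cball 0 r) x * (2 * B)" for n
    proof (rule AE_I2)
      fix x
      have "\<bar>g' n x - h x\<bar> \<le> 2 * B" using bd[of n x] B[of x] by linarith
      then show "norm (indicator (cball 0 r) x * \<bar>g' n x - h x\<bar>) \<le> indicator (cball 0 r) x * (2 * B)"
        by (auto simp: indicator_def)
    qed
  qed auto
  then have "(\<lambda>n. \<integral>x. indicator (cball 0 r) x * \<bar>g' n x - h x\<bar> \<partial>lborel) \<longlonglongrightarrow> 0" by simp
  from order_tendstoD(2)[OF this \<open>0 < e\<close>]
  obtain n where "(\<integral>x. indicator (cball 0 r) x * \<bar>g' n x - h x\<bar> \<partial>lborel) < e"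
    by (auto simp: eventually_sequentially)
  then show ?thesis using that[of "g' n"] cont bd by blast
qed

lemma translation_continuous_L1:
  fixes h :: "'a::euclidean_space \<Rightarrow> real"
  assumes [measurable]: "h \<in> borel_measurable borel" and B: "\<And>x. \<bar>h x\<bar> \<le> B" and y: "y \<longlonglongrightarrow> 0"
  shows "(\<lambda>n. \<integral>x. indicator (cball 0 1) x * \<bar>h (x + y n) - h x\<bar> \<partial>lborel) \<longlonglongrightarrow> 0"
proof (rule LIMSEQ_I)
  fix e :: real assume "0 < e"
  then have "0 < e / 3" by simp
  \<comment> \<open>Radius 2 leaves room: for |y n| < 1 the shifted unit ball stays inside, so g - h
    is controlled before and after the shift.\<close>
  obtain g where g: "continuous_on UNIV g" "\<And>x. \<bar>g x\<bar> \<le> B"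
    and gh: "(\<integral>x. indicator (cball 0 2) x * \<bar>g x - h x\<bar> \<partial>lborel) < e / 3"
    using continuous_approximation[OF assms(1) B \<open>0 < e / 3\<close>, of 2] by metis
  have [measurable]: "g \<in> borel_measurable borel"
    using g(1) by (rule borel_measurable_continuous_onI)
  let ?K = "\<lambda>r x. indicator (cball (0::'a) r) x :: real"
  have B0: "0 \<le> B" using B[of 0] by linarith
  have bdd: "\<bar>\<bar>u - v\<bar>\<bar> \<le> 2 * B" if "\<bar>u\<bar> \<le> B" "\<bar>v\<bar> \<le> B" for u v :: real using that by auto
  have "(\<lambda>n. \<integral>x. ?K 1 x * \<bar>g (x + y n) - g x\<bar> \<partial>lborel) \<longlonglongrightarrow> (\<integral>x. (0::real) \<partial>(lborel :: 'a measure))"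
  proof (rule integral_dominated_convergence[where w="\<lambda>x. ?K 1 x * (2 * B)"])
    show "integrable lborel (\<lambda>x. ?K 1 x * (2 * B))"
      by (rule integrable_bounded_on_cball[of "\<lambda>_. 2 * B" "2 * B"]) (use B0 in auto)
    show "AE x in lborel. (\<lambda>n. ?K 1 x * \<bar>g (x + y n) - g x\<bar>) \<longlonglongrightarrow> 0"
    proof (rule AE_I2)
      fix x
      have "isCont g (x + 0)" using g(1) by (simp add: continuous_on_eq_continuous_at)
      then have "(\<lambda>n. g (x + y n)) \<longlonglongrightarrow> g (x + 0)"
        by (rule isCont_tendsto_compose) (intro tendsto_intros y)
      then have "(\<lambda>n. ?K 1 x * \<bar>g (x + y n) - g x\<bar>) \<longlonglongrightarrow> ?K 1 x * \<bar>g (x + 0) - g x\<bar>"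
        by (intro tendsto_intros)
      then show "(\<lambda>n. ?K 1 x * \<bar>g (x + y n) - g x\<bar>) \<longlonglongrightarrow> 0" by simp
    qed
    show "AE x in lborel. norm (?K 1 x * \<bar>g (x + y n) - g x\<bar>) \<le> ?K 1 x * (2 * B)" for n
      using bdd g(2) by (auto simp: indicator_def)
  qed auto
  then have 2: "(\<lambda>n. \<integral>x. ?K 1 x * \<bar>g (x + y n) - g x\<bar> \<partial>lborel) \<longlonglongrightarrow> 0" by simp
  have "\<forall>\<^sub>F n in sequentially. (\<integral>x. ?K 1 x * \<bar>g (x + y n) - g x\<bar> \<partial>lborel) < e / 3"
    using order_tendstoD(2)[OF 2 \<open>0 < e / 3\<close>] .
  moreover have "\<forall>\<^sub>F n in sequentially. norm (y n) < 1"
    using order_tendstoD(2)[OF tendsto_norm_zero[OF y], of 1] by simp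
  ultimately have "\<forall>\<^sub>F n in sequentially. norm ((\<integral>x. ?K 1 x * \<bar>h (x + y n) - h x\<bar> \<partial>lborel) - 0) < e"
  proof eventually_elim
    case (elim n)
    have [simp]: "integrable lborel (\<lambda>x. ?K r x * \<bar>g x - h x\<bar>)" for r
      by (rule integrable_bounded_on_cball[of _ "2 * B"]) (use bdd B g(2) in auto)
    have i1: "integrable lborel (\<lambda>x. ?K 2 (x + y n) * \<bar>g (x + y n) - h (x + y n)\<bar>)"
      by (rule integrable_lborel_translation[of "\<lambda>x. ?K 2 x * \<bar>g x - h x\<bar>"]) simp
    have i2: "integrable lborel (\<lambda>x. ?K 1 x * \<bar>g (x + y n) - g x\<bar>)"
      by (rule integrable_bounded_on_cball[of _ "2 * B"]) (use bdd g(2) in auto)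
    have i3: "integrable lborel (\<lambda>x. ?K 1 x * \<bar>h (x + y n) - h x\<bar>)"
      by (rule integrable_bounded_on_cball[of _ "2 * B"]) (use bdd B in auto)
    have "(\<integral>x. ?K 1 x * \<bar>h (x + y n) - h x\<bar> \<partial>lborel) \<le>
      (\<integral>x. (?K 2 (x + y n) * \<bar>g (x + y n) - h (x + y n)\<bar> + ?K 1 x * \<bar>g (x + y n) - g x\<bar>) + ?K 2 x * \<bar>g x - h x\<bar> \<partial>lborel)"
    proof (rule integral_mono)
      fix x
      show "?K 1 x * \<bar>h (x + y n) - h x\<bar> \<le> (?K 2 (x + y n) * \<bar>g (x + y n) - h (x + y n)\<bar> + ?K 1 x * \<bar>g (x + y n) - g x\<bar>) + ?K 2 x * \<bar>g x - h x\<bar>"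
      proof (cases "x \<in> cball 0 1")
        case True
        then have "x \<in> cball 0 2" "x + y n \<in> cball 0 2"
          using elim(2) norm_triangle_ineq[of x "y n"] by auto
        with True show ?thesis by simp
      qed auto
    qed (use i1 i2 i3 in auto)
    also have "\<dots> = (\<integral>x. ?K 2 (x + y n) * \<bar>g (x + y n) - h (x + y n)\<bar> \<partial>lborel) +
        (\<integral>x. ?K 1 x * \<bar>g (x + y n) - g x\<bar> \<partial>lborel) + (\<integral>x. ?K 2 x * \<bar>g x - h x\<bar> \<partial>lborel)"
      using i1 i2 by simp
    also have "(\<integral>x. ?K 2 (x + y n) * \<bar>g (x + y n) - h (x + y n)\<bar> \<partial>lborel) = (\<integral>x. ?K 2 x * \<bar>g x - h x\<bar> \<partial>lborel)"
      by (rule lborel_integral_translation[of "\<lambda>x. ?K 2 x * \<bar>g x - h x\<bar>"]) measurable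
    finally have "(\<integral>x. ?K 1 x * \<bar>h (x + y n) - h x\<bar> \<partial>lborel) < e" using gh elim(1) by linarith
    moreover have "0 \<le> (\<integral>x. ?K 1 x * \<bar>h (x + y n) - h x\<bar> \<partial>lborel)" by simp
    ultimately show ?case by simp
  qed
  then show "\<exists>no. \<forall>n\<ge>no. norm ((\<integral>x. ?K 1 x * \<bar>h (x + y n) - h x\<bar> \<partial>lborel) - 0) < e"
    by (simp add: eventually_sequentially)
qed

section \<open>Strong continuity of the flow\<close>

context ergodic_flow
begin

text \<open>By stationarity the expectation does not change when the base point moves to x, so it
  equals its average over x in the unit ball. After exchanging the integrals the inner one concerns
  translations of a single path, where measurability in x already yields continuity in the
  mean.\<close>

lemma flow_continuous_bounded:
  fixes f :: "'w \<Rightarrow> real"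
  assumes [measurable]: "f \<in> borel_measurable M" and B: "\<And>\<omega>. \<bar>f \<omega>\<bar> \<le> B" and y: "y \<longlonglongrightarrow> 0"
  shows "(\<lambda>n. \<integral>\<omega>. \<bar>f (\<theta> (y n) \<omega>) - f \<omega>\<bar> \<partial>M) \<longlonglongrightarrow> 0"
proof -
  interpret lborel_M: pair_sigma_finite lborel M ..
  let ?K = "\<lambda>x. indicator (cball (0::real^'d) 1) x :: real"
  let ?c = "\<integral>x. ?K x \<partial>lborel"
  have B0: "0 \<le> B" using B[of undefined] by linarith
  have bdd: "\<bar>f a - f b\<bar> \<le> 2 * B" for a b using B[of a] B[of b] by linarith
  have c: "?c > 0"
    using content_cball_pos[of 1 "0::real^'d"] by simp
  note [measurable] = flow_joint_comp[OF assms(1)]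
  define I where "I n \<omega> = (\<integral>x. ?K x * \<bar>f (\<theta> (x + y n) \<omega>) - f (\<theta> x \<omega>)\<bar> \<partial>lborel)" for n \<omega>
  have m: "(\<lambda>(x, \<omega>). ?K x * \<bar>f (\<theta> (x + y n) \<omega>) - f (\<theta> x \<omega>)\<bar>) \<in> borel_measurable (lborel \<Otimes>\<^sub>M M)" for n
  proof -
    have "(\<lambda>(x, \<omega>). (x + y n, \<omega>)) \<in> (lborel \<Otimes>\<^sub>M M) \<rightarrow>\<^sub>M (lborel \<Otimes>\<^sub>M M)" by measurable
    from measurable_compose[OF this flow_joint_comp[OF assms(1)]]
    have [measurable]: "(\<lambda>(x, \<omega>). f (\<theta> (x + y n) \<omega>)) \<in> borel_measurable (lborel \<Otimes>\<^sub>M M)"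
      by (simp add: split_beta')
    show ?thesis by measurable
  qed
  have Ksimp: "integrable lborel (\<lambda>x. ?K x * b)" for b
    by (rule integrable_bounded_on_cball[of "\<lambda>_. b" "\<bar>b\<bar>"]) auto
  have int: "integrable (lborel \<Otimes>\<^sub>M M) (\<lambda>(x, \<omega>). ?K x * \<bar>f (\<theta> (x + y n) \<omega>) - f (\<theta> x \<omega>)\<bar>)" for n
  proof (rule Bochner_Integration.integrable_bound[OF _ m])
    show "integrable (lborel \<Otimes>\<^sub>M M) (\<lambda>(x, \<omega>). ?K x * (2 * B))"
      by (rule lborel_M.Fubini_integrable) (use Ksimp[of "\<bar>2 * B\<bar>"] in \<open>auto simp: prob_space abs_mult\<close>)
    show "AE x in lborel \<Otimes>\<^sub>M M. norm (case x of (x, \<omega>) \<Rightarrow> ?K x * \<bar>f (\<theta> (x + y n) \<omega>) - f (\<theta> x \<omega>)\<bar>)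
        \<le> norm (case x of (x, \<omega>) \<Rightarrow> ?K x * (2 * B))"
      using bdd B0 by (auto simp: indicator_def)
  qed
  have eq: "(\<integral>\<omega>. \<bar>f (\<theta> (y n) \<omega>) - f \<omega>\<bar> \<partial>M) = (\<integral>\<omega>. I n \<omega> \<partial>M) / ?c" for n
  proof -
    have "(\<integral>\<omega>. I n \<omega> \<partial>M) = (\<integral>x. (\<integral>\<omega>. ?K x * \<bar>f (\<theta> (x + y n) \<omega>) - f (\<theta> x \<omega>)\<bar> \<partial>M) \<partial>lborel)"
      unfolding I_def using lborel_M.Fubini_integral[OF int] by simp
    also have "\<dots> = (\<integral>x. ?K x * (\<integral>\<omega>. \<bar>f (\<theta> (y n) \<omega>) - f \<omega>\<bar> \<partial>M) \<partial>lborel)"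
    proof (intro Bochner_Integration.integral_cong refl)
      fix x
      have "(\<integral>\<omega>. \<bar>f (\<theta> (x + y n) \<omega>) - f (\<theta> x \<omega>)\<bar> \<partial>M) = (\<integral>\<omega>. \<bar>f (\<theta> (y n) (\<theta> x \<omega>)) - f (\<theta> x \<omega>)\<bar> \<partial>M)"
        by (intro Bochner_Integration.integral_cong refl) (auto simp: flow_add add.commute)
      also have "\<dots> = (\<integral>\<omega>. \<bar>f (\<theta> (y n) \<omega>) - f \<omega>\<bar> \<partial>M)"
        by (rule integral_flow) measurable
      finally show "(\<integral>\<omega>. ?K x * \<bar>f (\<theta> (x + y n) \<omega>) - f (\<theta> x \<omega>)\<bar> \<partial>M) = ?K x * (\<integral>\<omega>. \<bar>f (\<theta> (y n) \<omega>) - f \<omega>\<bar> \<partial>M)"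
        by simp
    qed
    also have "\<dots> = ?c * (\<integral>\<omega>. \<bar>f (\<theta> (y n) \<omega>) - f \<omega>\<bar> \<partial>M)" by (rule integral_mult_left_zero)
    finally show ?thesis using c by simp
  qed
  have "(\<lambda>n. \<integral>\<omega>. I n \<omega> \<partial>M) \<longlonglongrightarrow> (\<integral>\<omega>. 0 \<partial>M)"
  proof (rule integral_dominated_convergence[where w="\<lambda>_. \<integral>x. ?K x * (2 * B) \<partial>lborel"])
    show "I n \<in> borel_measurable M" for n
      unfolding I_def using lborel_M.integrable_snd[OF int] by (auto dest: borel_measurable_integrable)
    show "AE \<omega> in M. (\<lambda>n. I n \<omega>) \<longlonglongrightarrow> 0"
    proof (rule AE_I2)
      fix \<omega> assume \<omega>: "\<omega> \<in> space M"
      show "(\<lambda>n. I n \<omega>) \<longlonglongrightarrow> 0"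
        unfolding I_def
        by (rule translation_continuous_L1[of "\<lambda>x. f (\<theta> x \<omega>)", OF _ B y])
           (use flow_path_measurable[OF assms(1) \<omega>] in simp)
    qed
    show "AE \<omega> in M. norm (I n \<omega>) \<le> (\<integral>x. ?K x * (2 * B) \<partial>lborel)" for n
    proof (rule AE_I2)
      fix \<omega>
      have "norm (I n \<omega>) \<le> (\<integral>x. norm (?K x * \<bar>f (\<theta> (x + y n) \<omega>) - f (\<theta> x \<omega>)\<bar>) \<partial>lborel)"
        unfolding I_def by (rule integral_norm_bound)
      also have "\<dots> \<le> (\<integral>x. ?K x * (2 * B) \<partial>lborel)"
        by (rule integral_mono') (use Ksimp bdd B0 in \<open>auto simp: indicator_def\<close>)
      finally show "norm (I n \<omega>) \<le> (\<integral>x. ?K x * (2 * B) \<partial>lborel)" .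
    qed
  qed auto
  then have "(\<lambda>n. (\<integral>\<omega>. I n \<omega> \<partial>M) / ?c) \<longlonglongrightarrow> 0 / ?c"
    using c by (intro tendsto_divide) auto
  then show ?thesis by (simp add: eq)
qed

text \<open>Truncate f at level m. The truncation error has the same norm after translation, and for
  the truncated part (q - p)^2 \<le> 2 m |q - p| reduces the claim to the bounded case.\<close>

lemma flow_continuous_L2:
  fixes f :: "'w \<Rightarrow> real"
  assumes f: "L2 M f" and y: "y \<longlonglongrightarrow> 0"
  shows "(\<lambda>n. \<integral>\<omega>. (f (\<theta> (y n) \<omega>) - f \<omega>)\<^sup>2 \<partial>M) \<longlonglongrightarrow> 0"
proof (rule LIMSEQ_I)
  fix e :: real assume e: "0 < e"
  note [measurable] = L2_measurable[OF f]
  define F where "F m \<omega> = max (- real m) (min (real m) (f \<omega>))" for m \<omega>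
  have Fm[measurable]: "F m \<in> borel_measurable M" for m unfolding F_def by measurable
  have FB: "\<bar>F m \<omega>\<bar> \<le> real m" for m \<omega> by (auto simp: F_def)
  have FL2: "L2 M (F m)" for m
    by (rule L2_bound[OF L2_const[OF finite_measure_axioms, of "1::real"], where C="real m"]) (use FB in auto)
  have "(\<lambda>m. \<integral>\<omega>. (F m \<omega> - f \<omega>)\<^sup>2 \<partial>M) \<longlonglongrightarrow> (\<integral>\<omega>. 0 \<partial>M)"
  proof (rule integral_dominated_convergence[where w="\<lambda>\<omega>. (f \<omega>)\<^sup>2"])
    show "integrable M (\<lambda>\<omega>. (f \<omega>)\<^sup>2)" using L2_norm_integrable[OF f] by simp
    show "AE \<omega> in M. (\<lambda>m. (F m \<omega> - f \<omega>)\<^sup>2) \<longlonglongrightarrow> 0"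
    proof (rule AE_I2)
      fix \<omega>
      obtain m0 where m0: "\<bar>f \<omega>\<bar> \<le> real m0" using real_arch_simple by blast
      show "(\<lambda>m. (F m \<omega> - f \<omega>)\<^sup>2) \<longlonglongrightarrow> 0"
        by (rule tendsto_eventually, rule eventually_sequentiallyI[of m0]) (use m0 in \<open>auto simp: F_def\<close>)
    qed
    show "AE \<omega> in M. norm ((F m \<omega> - f \<omega>)\<^sup>2) \<le> (f \<omega>)\<^sup>2" for m
    proof (rule AE_I2)
      fix \<omega>
      have "\<bar>F m \<omega> - f \<omega>\<bar> \<le> \<bar>f \<omega>\<bar>" by (auto simp: F_def)
      then show "norm ((F m \<omega> - f \<omega>)\<^sup>2) \<le> (f \<omega>)\<^sup>2" by (simp add: abs_le_square_iff)
    qed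
  qed auto
  then have "(\<lambda>m. \<integral>\<omega>. (F m \<omega> - f \<omega>)\<^sup>2 \<partial>M) \<longlonglongrightarrow> 0" by simp
  \<comment> \<open>The truncation error will enter with the factors 4 and 2, hence contributes less
    than e / 2.\<close>
  from order_tendstoD(2)[OF this, of "e / 12"] e
  obtain m where m: "(\<integral>\<omega>. (F m \<omega> - f \<omega>)\<^sup>2 \<partial>M) < e / 12" by (auto simp: eventually_sequentially)
  have "(\<lambda>n. (8 * real m) * (\<integral>\<omega>. \<bar>F m (\<theta> (y n) \<omega>) - F m \<omega>\<bar> \<partial>M)) \<longlonglongrightarrow> (8 * real m) * 0"
    by (intro tendsto_mult tendsto_const flow_continuous_bounded[OF Fm FB y])
  then have "(\<lambda>n. (8 * real m) * (\<integral>\<omega>. \<bar>F m (\<theta> (y n) \<omega>) - F m \<omega>\<bar> \<partial>M)) \<longlonglongrightarrow> 0" by simp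
  then have "\<forall>\<^sub>F n in sequentially. (8 * real m) * (\<integral>\<omega>. \<bar>F m (\<theta> (y n) \<omega>) - F m \<omega>\<bar> \<partial>M) < e / 2"
    by (rule order_tendstoD(2)) (use e in simp)
  then have "\<forall>\<^sub>F n in sequentially. norm ((\<integral>\<omega>. (f (\<theta> (y n) \<omega>) - f \<omega>)\<^sup>2 \<partial>M) - 0) < e"
  proof eventually_elim
    case (elim n)
    let ?U = "\<lambda>g \<omega>. g (\<theta> (y n) \<omega>)"
    have L: "L2 M (\<lambda>\<omega>. F m \<omega> - f \<omega>)" by (rule L2_diff[OF FL2 f])
    have i1: "integrable M (\<lambda>\<omega>. (F m \<omega> - f \<omega>)\<^sup>2)" using L2_norm_integrable[OF L] by simp
    have i2: "integrable M (\<lambda>\<omega>. (F m (\<theta> (y n) \<omega>) - f (\<theta> (y n) \<omega>))\<^sup>2)"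
      using L2_norm_integrable[OF L2_flow[OF L]] by simp
    have i3: "integrable M (\<lambda>\<omega>. \<bar>F m (\<theta> (y n) \<omega>) - F m \<omega>\<bar>)"
      using L2_integrable[OF finite_measure_axioms L2_diff[OF L2_flow[OF FL2] FL2]] by simp
    have i4: "integrable M (\<lambda>\<omega>. (f (\<theta> (y n) \<omega>) - f \<omega>)\<^sup>2)"
      using L2_norm_integrable[OF L2_diff[OF L2_flow[OF f] f]] by simp
    \<comment> \<open>Here a and b are f before and after the shift, p and q the truncations of
      these values.\<close>
    have pt: "(b - a)\<^sup>2 \<le> 4 * (p - a)\<^sup>2 + 2 * (q - b)\<^sup>2 + (8 * real m) * \<bar>q - p\<bar>"
      if "\<bar>p\<bar> \<le> real m" "\<bar>q\<bar> \<le> real m" for a b p q :: real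
    proof -
      have "(b - a)\<^sup>2 \<le> 2 * (q - b)\<^sup>2 + 2 * (q - a)\<^sup>2"
        using norm_sq_diff_le[of "q - a" "q - b"] by simp
      moreover have "(q - a)\<^sup>2 \<le> 2 * (q - p)\<^sup>2 + 2 * (p - a)\<^sup>2"
        using norm_sq_add_le[of "q - p" "p - a"] by simp
      moreover have "(q - p)\<^sup>2 \<le> (2 * real m) * \<bar>q - p\<bar>"
        using mult_right_mono[of "\<bar>q - p\<bar>" "2 * real m" "\<bar>q - p\<bar>"] that by (simp add: power2_eq_square abs_mult_self_eq)
      ultimately show ?thesis by linarith
    qed
    have "(\<integral>\<omega>. (f (\<theta> (y n) \<omega>) - f \<omega>)\<^sup>2 \<partial>M) \<le>
        (\<integral>\<omega>. 4 * (F m \<omega> - f \<omega>)\<^sup>2 + 2 * (F m (\<theta> (y n) \<omega>) - f (\<theta> (y n) \<omega>))\<^sup>2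
          + (8 * real m) * \<bar>F m (\<theta> (y n) \<omega>) - F m \<omega>\<bar> \<partial>M)"
      by (rule integral_mono) (use i1 i2 i3 i4 pt FB in auto)
    also have "\<dots> = 4 * (\<integral>\<omega>. (F m \<omega> - f \<omega>)\<^sup>2 \<partial>M) + 2 * (\<integral>\<omega>. (F m (\<theta> (y n) \<omega>) - f (\<theta> (y n) \<omega>))\<^sup>2 \<partial>M)
          + (8 * real m) * (\<integral>\<omega>. \<bar>F m (\<theta> (y n) \<omega>) - F m \<omega>\<bar> \<partial>M)"
      using i1 i2 i3 by simp
    also have "(\<integral>\<omega>. (F m (\<theta> (y n) \<omega>) - f (\<theta> (y n) \<omega>))\<^sup>2 \<partial>M) = (\<integral>\<omega>. (F m \<omega> - f \<omega>)\<^sup>2 \<partial>M)"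
      using L2_norm_flow[OF L] by simp
    finally have "(\<integral>\<omega>. (f (\<theta> (y n) \<omega>) - f \<omega>)\<^sup>2 \<partial>M) < e" using m elim by linarith
    then show ?case by simp
  qed
  then show "\<exists>no. \<forall>n\<ge>no. norm ((\<integral>\<omega>. (f (\<theta> (y n) \<omega>) - f \<omega>)\<^sup>2 \<partial>M) - 0) < e"
    by (simp add: eventually_sequentially)
qed

lemma corr_isCont_zero:
  assumes "L2 M f" "L2 M g"
  shows "isCont (corr f g) 0"
  unfolding continuous_at_sequentially
proof (intro allI impI)
  fix y :: "nat \<Rightarrow> real^'d" assume y: "y \<longlonglongrightarrow> 0"
  have "(\<lambda>n. corr f g (y n) - corr f g 0) \<longlonglongrightarrow> 0"
  proof (rule Lim_null_comparison)
    show "\<forall>\<^sub>F n in sequentially. norm (corr f g (y n) - corr f g 0) \<le>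
        sqrt (\<integral>\<omega>. (f (\<theta> (y n) \<omega>) - f \<omega>)\<^sup>2 \<partial>M) * sqrt (\<integral>\<omega>. (g \<omega>)\<^sup>2 \<partial>M)"
    proof (rule always_eventually, rule allI)
      fix n
      have "corr f g (y n) - corr f g 0 = (\<integral>\<omega>. (f (\<theta> (y n) \<omega>) - f \<omega>) * g \<omega> \<partial>M)"
        unfolding corr_zero unfolding corr_def
        using L2_mult_integrable[OF L2_flow[OF assms(1)] assms(2)] L2_mult_integrable[OF assms]
        by (simp add: left_diff_distrib)
      then show "norm (corr f g (y n) - corr f g 0) \<le>
        sqrt (\<integral>\<omega>. (f (\<theta> (y n) \<omega>) - f \<omega>)\<^sup>2 \<partial>M) * sqrt (\<integral>\<omega>. (g \<omega>)\<^sup>2 \<partial>M)"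
        using L2_Cauchy_Schwarz[OF L2_diff[OF L2_flow[OF assms(1)] assms(1)] assms(2), of "y n"] by simp
    qed
    have "(\<lambda>n. sqrt (\<integral>\<omega>. (f (\<theta> (y n) \<omega>) - f \<omega>)\<^sup>2 \<partial>M) * sqrt (\<integral>\<omega>. (g \<omega>)\<^sup>2 \<partial>M)) \<longlonglongrightarrow> sqrt 0 * sqrt (\<integral>\<omega>. (g \<omega>)\<^sup>2 \<partial>M)"
      by (intro tendsto_intros flow_continuous_L2 assms y)
    then show "(\<lambda>n. sqrt (\<integral>\<omega>. (f (\<theta> (y n) \<omega>) - f \<omega>)\<^sup>2 \<partial>M) * sqrt (\<integral>\<omega>. (g \<omega>)\<^sup>2 \<partial>M)) \<longlonglongrightarrow> 0" by simp
  qed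
  then show "(corr f g \<circ> y) \<longlonglongrightarrow> corr f g 0"
    by (simp add: o_def LIM_zero_iff)
qed

end

subsection \<open>Stationary gradients\<close>

lemma bump_integral_pos:
  assumes "test_fun \<psi>" "\<And>x. \<psi> x \<ge> 0" "\<psi> 0 > 0"
  shows "(\<integral>x. \<psi> x \<partial>lborel) > 0"
proof (rule ccontr)
  assume "\<not> ?thesis"
  moreover have "0 \<le> (\<integral>x. \<psi> x \<partial>lborel)"
    by (rule integral_nonneg_AE) (use assms(2) in simp)
  ultimately have "(\<integral>x. \<psi> x \<partial>lborel) = 0" by linarith
  then have "AE x in lborel. \<psi> x = 0"
    using integral_nonneg_eq_0_iff_AE[OF test_fun_integrable[OF assms(1)]] assms(2) by auto
  then have "AE x in lborel. x \<notin> {x. 0 < \<psi> x}" by eventually_elim auto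
  moreover have op: "open {x. 0 < \<psi> x}"
    using test_fun_continuous[OF assms(1)] by (intro open_Collect_less continuous_intros)
  ultimately have "{x. 0 < \<psi> x} \<in> null_sets lborel"
    by (subst AE_iff_null_sets) auto
  then have "negligible {x. 0 < \<psi> x}"
    by (simp add: negligible_iff_null_sets null_sets_completionI)
  with op assms(3) show False
    using open_not_negligible[of "{x. 0 < \<psi> x}"] by blast
qed

text \<open>If c 0 were nonzero, c would keep its sign and at least half of that size on a ball, and
  an even bump supported there would have a nonzero integral against c.\<close>

lemma eq_zero_of_bump_integrals:
  fixes c :: "real^'d::finite \<Rightarrow> real"
  assumes cont: "isCont c 0"
    and int: "\<And>\<psi>. commuting_test_fun \<psi> \<Longrightarrow> integrable lborel (\<lambda>x. \<psi> x * c x)"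
    and zero: "\<And>\<psi>. commuting_test_fun \<psi> \<Longrightarrow> (\<And>x. \<psi> (- x) = \<psi> x) \<Longrightarrow> (\<integral>x. \<psi> x * c x \<partial>lborel) = 0"
  shows "c 0 = 0"
proof (rule ccontr)
  assume c0: "c 0 \<noteq> 0"
  then obtain \<delta> where \<delta>: "\<delta> > 0" "\<And>x. norm x < \<delta> \<Longrightarrow> \<bar>c x - c 0\<bar> < \<bar>c 0\<bar> / 2"
    using cont unfolding continuous_at_eps_delta by (metis half_gt_zero zero_less_abs_iff diff_zero dist_norm real_norm_def)
  obtain \<psi> :: "real^'d \<Rightarrow> real" where \<psi>: "commuting_test_fun \<psi>" "\<And>x. \<psi> x \<ge> 0" "\<psi> 0 > 0" "\<And>x. \<psi> (- x) = \<psi> x"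
    "\<And>x. norm x \<ge> \<delta> \<Longrightarrow> \<psi> x = 0"
    using even_bump[OF \<delta>(1)] by metis
  have le: "\<psi> x * (\<bar>c 0\<bar> / 2) \<le> sgn (c 0) * (\<psi> x * c x)" for x
  proof (cases "norm x < \<delta>")
    case True
    then have "\<bar>c 0\<bar> / 2 \<le> sgn (c 0) * c x"
      using \<delta>(2)[OF True] by (auto simp: sgn_real_def abs_real_def split: if_splits)
    from mult_left_mono[OF this \<psi>(2)[of x]] show ?thesis by (simp add: mult.left_commute)
  qed (use \<psi>(5) in auto)
  have "(\<integral>x. \<psi> x * (\<bar>c 0\<bar> / 2) \<partial>lborel) \<le> (\<integral>x. sgn (c 0) * (\<psi> x * c x) \<partial>lborel)"
    by (rule integral_mono) (use le int[OF \<psi>(1)] test_fun_integrable[OF commuting_test_funD[OF \<psi>(1)]] in auto)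
  also have "\<dots> = 0" using zero[OF \<psi>(1,4)] by simp
  finally have "(\<integral>x. \<psi> x \<partial>lborel) * \<bar>c 0\<bar> \<le> 0" by simp
  then show False
    using bump_integral_pos[OF commuting_test_funD[OF \<psi>(1)] \<psi>(2,3)] c0
    by (simp add: mult_le_0_iff)
qed

context ergodic_flow
begin

text \<open>\<^term>\<open>DX\<close> is the stationary weak gradient of \<^term>\<open>X\<close>, in a form without exceptional sets:
  the pathwise identity is paired with an arbitrary \<^term>\<open>g\<close> in \<open>L\<^sup>2(\<Omega>)\<close>, which turns it into
  an identity between deterministic correlation functions.\<close>

definition H1 :: "('w \<Rightarrow> real) \<Rightarrow> ('w \<Rightarrow> real^'d) \<Rightarrow> bool" where
  "H1 X DX \<longleftrightarrow> L2 M X \<and> L2 M DX \<and>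
     (\<forall>g \<psi> i. L2 M g \<longrightarrow> commuting_test_fun \<psi> \<longrightarrow>
        (\<integral>x. partial i \<psi> x * corr X g x \<partial>lborel) = - (\<integral>x. \<psi> x * corr (\<lambda>\<omega>. DX \<omega> $ i) g x \<partial>lborel))"

lemmas corr_tested = integral_kernel_corr[OF lborel.sigma_finite_measure_axioms, where p="\<lambda>x. x", simplified]

lemma integrable_mult_corr:
  assumes "L2 M f" "L2 M g" "test_fun \<psi>"
  shows "integrable lborel (\<lambda>x. \<psi> x * corr f g x)"
  using integrable_corr_comp[OF assms(1,2) test_fun_integrable[OF assms(3)], of "\<lambda>x. x"] by simp

text \<open>Multiplying by g, taking expectations and exchanging integrals absorbs the null set. The
  factor c carries the sign: -1 for weak gradients, 1 for the curl relation.\<close>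

lemma corr_eq_of_AE:
  assumes "L2 M f" "L2 M f'" "L2 M g" "integrable lborel k" "integrable lborel k'"
    and "AE \<omega> in M. (\<integral>x. k x * f (\<theta> x \<omega>) \<partial>lborel) = c * (\<integral>x. k' x * f' (\<theta> x \<omega>) \<partial>lborel)"
  shows "(\<integral>x. k x * corr f g x \<partial>lborel) = c * (\<integral>x. k' x * corr f' g x \<partial>lborel)"
proof -
  note 1 = corr_tested[OF assms(1,3,4)] and 2 = corr_tested[OF assms(2,3,5)]
  have "(\<integral>\<omega>. (\<integral>x. k x * f (\<theta> x \<omega>) \<partial>lborel) * g \<omega> \<partial>M) = (\<integral>\<omega>. c * ((\<integral>x. k' x * f' (\<theta> x \<omega>) \<partial>lborel) * g \<omega>) \<partial>M)"
    by (rule integral_cong_AE)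
       (use 1(1) 2(1) assms(6) in \<open>auto intro: borel_measurable_integrable\<close>)
  then show ?thesis using 1(2) 2(2) by simp
qed

lemma H1_of_weak_grad:
  assumes "L2 M \<Phi>" "L2 M G" "AE \<omega> in M. weak_grad (\<lambda>x. \<Phi> (\<theta> x \<omega>)) (\<lambda>x. G (\<theta> x \<omega>))"
  shows "H1 \<Phi> G"
  unfolding H1_def
proof (intro conjI allI impI)
  fix g :: "'w \<Rightarrow> real" and \<psi> :: "real^'d \<Rightarrow> real" and i
  assume g: "L2 M g" and \<psi>: "commuting_test_fun \<psi>"
  note t = commuting_test_funD[OF \<psi>]
  have "(\<integral>x. partial i \<psi> x * corr \<Phi> g x \<partial>lborel) = (-1) * (\<integral>x. \<psi> x * corr (\<lambda>\<omega>. G \<omega> $ i) g x \<partial>lborel)"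
  proof (rule corr_eq_of_AE[OF assms(1) L2_component[OF assms(2)] g test_fun_integrable[OF test_fun_partial[OF t]] test_fun_integrable[OF t]])
    show "AE \<omega> in M. (\<integral>x. partial i \<psi> x * \<Phi> (\<theta> x \<omega>) \<partial>lborel) = (-1) * (\<integral>x. \<psi> x * G (\<theta> x \<omega>) $ i \<partial>lborel)"
      using assms(3) by eventually_elim (use t in \<open>auto simp: weak_grad_def mult.commute\<close>)
  qed
  then show "(\<integral>x. partial i \<psi> x * corr \<Phi> g x \<partial>lborel) = - (\<integral>x. \<psi> x * corr (\<lambda>\<omega>. G \<omega> $ i) g x \<partial>lborel)"
    by simp
qed (use assms in auto)

text \<open>Test the weak gradient along i with \<open>partial j \<psi>\<close> and along j with
  \<open>partial i \<psi>\<close>: the second derivatives agree. The non-stationary \<phi> thereby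
  drops out before any expectation is taken.\<close>

lemma curl_free_of_weak_grad:
  assumes "L2 M G" "AE \<omega> in M. weak_grad (\<lambda>x. \<phi> x \<omega>) (\<lambda>x. G (\<theta> x \<omega>))"
    "L2 M g" "commuting_test_fun \<psi>"
  shows "(\<integral>x. partial j \<psi> x * corr (\<lambda>\<omega>. G \<omega> $ i) g x \<partial>lborel) = (\<integral>x. partial i \<psi> x * corr (\<lambda>\<omega>. G \<omega> $ j) g x \<partial>lborel)"
proof -
  note t = commuting_test_funD[OF assms(4)]
  have "(\<integral>x. partial j \<psi> x * corr (\<lambda>\<omega>. G \<omega> $ i) g x \<partial>lborel) = 1 * (\<integral>x. partial i \<psi> x * corr (\<lambda>\<omega>. G \<omega> $ j) g x \<partial>lborel)"
  proof (rule corr_eq_of_AE[OF L2_component[OF assms(1)] L2_component[OF assms(1)] assms(3)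
        test_fun_integrable[OF test_fun_partial[OF t]] test_fun_integrable[OF test_fun_partial[OF t]]])
    show "AE \<omega> in M. (\<integral>x. partial j \<psi> x * G (\<theta> x \<omega>) $ i \<partial>lborel) = 1 * (\<integral>x. partial i \<psi> x * G (\<theta> x \<omega>) $ j \<partial>lborel)"
      using assms(2)
    proof eventually_elim
      case (elim \<omega>)
      then have "(\<integral>x. \<phi> x \<omega> * partial i (partial j \<psi>) x \<partial>lborel) = - (\<integral>x. G (\<theta> x \<omega>) $ i * partial j \<psi> x \<partial>lborel)"
        "(\<integral>x. \<phi> x \<omega> * partial j (partial i \<psi>) x \<partial>lborel) = - (\<integral>x. G (\<theta> x \<omega>) $ j * partial i \<psi> x \<partial>lborel)"
        using test_fun_partial[OF t] by (auto simp: weak_grad_def)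
      moreover have "partial i (partial j \<psi>) = partial j (partial i \<psi>)"
        using assms(4) by (simp add: commuting_test_fun_def)
      ultimately show ?case by (simp add: mult.commute)
    qed
  qed
  then show ?thesis by simp
qed

text \<open>The weak equation on \<Omega> with X as test field. It is obtained for correlation
  functions averaged by even bumps and then localized at x = 0.\<close>

lemma weak_equation_pairing:
  assumes \<Phi>: "L2 M \<Phi>" and F: "L2 M F" and X: "H1 X DX"
    and eq: "AE \<omega> in M. \<forall>\<psi>. test_fun \<psi> \<longrightarrow> (\<integral>x. a * \<Phi> (\<theta> x \<omega>) * \<psi> x + grad \<psi> x \<bullet> F (\<theta> x \<omega>) \<partial>lborel) = 0"
  shows "a * (\<integral>\<omega>. \<Phi> \<omega> * X \<omega> \<partial>M) + (\<integral>\<omega>. DX \<omega> \<bullet> F \<omega> \<partial>M) = 0"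
proof -
  have LX: "L2 M X" and LDX: "L2 M DX" using X by (auto simp: H1_def)
  let ?D = "\<lambda>i \<omega>. DX \<omega> $ i" and ?F = "\<lambda>i \<omega>. F \<omega> $ i"
  have LD: "L2 M (?D i)" and LF: "L2 M (?F i)" for i
    using L2_component LDX F by auto
  \<comment> \<open>The value at 0 is the left side of the claim. The flux term translates DX and
    not F, which is the form that \<open>H1\<close> delivers.\<close>
  define c where "c x = a * corr \<Phi> X x + (\<Sum>i\<in>UNIV. corr (?D i) (?F i) x)" for x
  have "c 0 = 0"
  proof (rule eq_zero_of_bump_integrals)
    show "isCont c 0" unfolding c_def
      by (intro continuous_intros corr_isCont_zero \<Phi> LX LD LF)
    fix \<psi> :: "real^'d \<Rightarrow> real" assume \<psi>: "commuting_test_fun \<psi>"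
    note t = commuting_test_funD[OF \<psi>]
    have i1: "integrable lborel (\<lambda>x. \<psi> x * corr \<Phi> X x)" and i2: "integrable lborel (\<lambda>x. \<psi> x * corr (?D i) (?F i) x)" for i
      using integrable_mult_corr \<Phi> LX LD LF t by auto
    have ceq: "\<psi> x * c x = a * (\<psi> x * corr \<Phi> X x) + (\<Sum>i\<in>UNIV. \<psi> x * corr (?D i) (?F i) x)" for x
      by (simp add: c_def distrib_left sum_distrib_left mult.left_commute)
    show "integrable lborel (\<lambda>x. \<psi> x * c x)"
      unfolding ceq using i1 i2 by auto
    assume even: "\<And>x. \<psi> (- x) = \<psi> x"
    \<comment> \<open>Integration by parts on \<Omega>: \<open>corr_swap\<close> reflects x, the odd
      factor \<open>partial i \<psi>\<close> contributes one minus sign, and \<open>H1\<close> with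
      F_i as partner contributes the other.\<close>
    have flux: "(\<integral>x. partial i \<psi> x * corr (?F i) X x \<partial>lborel) = (\<integral>x. \<psi> x * corr (?D i) (?F i) x \<partial>lborel)" for i
    proof -
      have [measurable]: "corr X (?F i) \<in> borel_measurable borel" "partial i \<psi> \<in> borel_measurable borel"
        using corr_measurable[OF LX LF] test_fun_integrable[OF test_fun_partial[OF t, of i]] by auto
      have "(\<integral>x. partial i \<psi> x * corr (?F i) X x \<partial>lborel) = (\<integral>x. - (partial i \<psi> (- x) * corr X (?F i) (- x)) \<partial>lborel)"
        by (simp add: partial_odd[OF t even] corr_swap[OF LF LX])
      also have "\<dots> = - (\<integral>x. partial i \<psi> x * corr X (?F i) x \<partial>lborel)"
        using lborel_integral_reflect[of "\<lambda>x. partial i \<psi> x * corr X (?F i) x"] by simp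
      also have "\<dots> = (\<integral>x. \<psi> x * corr (?D i) (?F i) x \<partial>lborel)"
        using X LF \<psi> unfolding H1_def by simp
      finally show ?thesis .
    qed
    have "AE \<omega> in M. \<forall>i\<in>UNIV. integrable lborel (\<lambda>x. partial i \<psi> x * ?F i (\<theta> x \<omega>))"
      by (rule AE_finite_allI) (use AE_integrable_kernel[OF LF test_fun_integrable[OF test_fun_partial[OF t]]] in auto)
    moreover have "AE \<omega> in M. integrable lborel (\<lambda>x. \<psi> x * \<Phi> (\<theta> x \<omega>))"
      by (rule AE_integrable_kernel[OF \<Phi> test_fun_integrable[OF t]])
    ultimately have "AE \<omega> in M. a * ((\<integral>x. \<psi> x * \<Phi> (\<theta> x \<omega>) \<partial>lborel) * X \<omega>) + (\<Sum>i\<in>UNIV. (\<integral>x. partial i \<psi> x * ?F i (\<theta> x \<omega>) \<partial>lborel) * X \<omega>) = 0"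
      using eq
    proof eventually_elim
      case (elim \<omega>)
      have "0 = (\<integral>x. a * \<Phi> (\<theta> x \<omega>) * \<psi> x + grad \<psi> x \<bullet> F (\<theta> x \<omega>) \<partial>lborel)" using elim(3) t by simp
      also have "\<dots> = (\<integral>x. a * (\<psi> x * \<Phi> (\<theta> x \<omega>)) + (\<Sum>i\<in>UNIV. partial i \<psi> x * ?F i (\<theta> x \<omega>)) \<partial>lborel)"
        by (intro Bochner_Integration.integral_cong refl) (simp add: grad_def inner_vec_def)
      also have "\<dots> = a * (\<integral>x. \<psi> x * \<Phi> (\<theta> x \<omega>) \<partial>lborel) + (\<Sum>i\<in>UNIV. \<integral>x. partial i \<psi> x * ?F i (\<theta> x \<omega>) \<partial>lborel)"
        using elim(1,2) by simp
      finally have "(a * (\<integral>x. \<psi> x * \<Phi> (\<theta> x \<omega>) \<partial>lborel) + (\<Sum>i\<in>UNIV. \<integral>x. partial i \<psi> x * ?F i (\<theta> x \<omega>) \<partial>lborel)) * X \<omega> = 0" by simp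
      then show ?case by (simp only: distrib_right sum_distrib_right mult.assoc)
    qed
    then have "(\<integral>\<omega>. a * ((\<integral>x. \<psi> x * \<Phi> (\<theta> x \<omega>) \<partial>lborel) * X \<omega>) + (\<Sum>i\<in>UNIV. (\<integral>x. partial i \<psi> x * ?F i (\<theta> x \<omega>) \<partial>lborel) * X \<omega>) \<partial>M) = 0"
      by (rule integral_eq_zero_AE)
    moreover have "(\<integral>\<omega>. a * ((\<integral>x. \<psi> x * \<Phi> (\<theta> x \<omega>) \<partial>lborel) * X \<omega>) + (\<Sum>i\<in>UNIV. (\<integral>x. partial i \<psi> x * ?F i (\<theta> x \<omega>) \<partial>lborel) * X \<omega>) \<partial>M)
      = a * (\<integral>x. \<psi> x * corr \<Phi> X x \<partial>lborel) + (\<Sum>i\<in>UNIV. \<integral>x. partial i \<psi> x * corr (?F i) X x \<partial>lborel)"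
      using corr_tested[OF \<Phi> LX test_fun_integrable[OF t]]
        corr_tested[OF LF LX test_fun_integrable[OF test_fun_partial[OF t]]]
      by simp
    ultimately have "a * (\<integral>x. \<psi> x * corr \<Phi> X x \<partial>lborel) + (\<Sum>i\<in>UNIV. \<integral>x. \<psi> x * corr (?D i) (?F i) x \<partial>lborel) = 0"
      by (simp add: flux)
    then show "(\<integral>x. \<psi> x * c x \<partial>lborel) = 0"
      unfolding ceq using i1 i2 by simp
  qed
  moreover have "(\<integral>\<omega>. DX \<omega> \<bullet> F \<omega> \<partial>M) = (\<Sum>i\<in>UNIV. \<integral>\<omega>. ?D i \<omega> * ?F i \<omega> \<partial>M)"
    unfolding inner_vec_def using L2_mult_integrable[OF LD LF] by simp
  ultimately show ?thesis by (simp add: c_def corr_zero)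
qed

end

section \<open>Line integrals and increments of curl-free fields\<close>

lemma integrable_indicator_Icc: "integrable lborel (indicator {0..h::real} :: real \<Rightarrow> real)"
  using emeasure_compact_finite[OF compact_Icc[of 0 h]] by (simp add: integrable_indicator_iff)

lemma integral_test_fun_segment:
  fixes \<psi> :: "real^'d::finite \<Rightarrow> real"
  assumes "test_fun \<psi>" "h \<ge> 0"
  shows "(\<integral>s. indicator {0..h} s * partial i \<psi> (x - s *\<^sub>R axis i 1) \<partial>lborel) = \<psi> x - \<psi> (x - h *\<^sub>R axis i 1)"
proof -
  have "(\<integral>s. indicator {0..h} s *\<^sub>R partial i \<psi> (x - s *\<^sub>R axis i 1) \<partial>lborel)
      = - \<psi> (x - h *\<^sub>R axis i 1) - (- \<psi> (x - 0 *\<^sub>R axis i 1))"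
  proof (rule integral_FTC_atLeastAtMost[OF assms(2)])
    fix s
    have "((\<lambda>t. \<psi> (x + t *\<^sub>R axis i 1)) has_real_derivative partial i \<psi> (x + (- s) *\<^sub>R axis i 1)) (at (- s))"
      by (rule test_fun_has_derivative[OF assms(1)])
    then have "((\<lambda>t. \<psi> (x + (- t) *\<^sub>R axis i 1)) has_real_derivative - partial i \<psi> (x + (- s) *\<^sub>R axis i 1)) (at s)"
      by (subst (asm) DERIV_mirror)
    from DERIV_minus[OF this]
    have "((\<lambda>t. - \<psi> (x - t *\<^sub>R axis i 1)) has_real_derivative partial i \<psi> (x - s *\<^sub>R axis i 1)) (at s)"
      by simp
    then show "((\<lambda>t. - \<psi> (x - t *\<^sub>R axis i 1)) has_vector_derivative partial i \<psi> (x - s *\<^sub>R axis i 1)) (at s within {0..h})"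
      by (simp add: has_real_derivative_iff_has_vector_derivative has_vector_derivative_at_within)
  next
    show "continuous_on {0..h} (\<lambda>s. partial i \<psi> (x - s *\<^sub>R axis i 1))"
      by (intro continuous_on_compose2[OF test_fun_continuous[OF test_fun_partial[OF assms(1)]]] continuous_intros) auto
  qed
  then show ?thesis by simp
qed

text \<open>The two forms of the integrand for which \<open>H1_increment\<close> exchanges the line
  integral with the integral over space: the shift sits either on the kernel or on the
  correlation.\<close>

lemma integrable_pair_shifted:
  fixes k :: "real^'d::finite \<Rightarrow> real"
  assumes k: "integrable lborel k" and c[measurable]: "c \<in> borel_measurable borel" and C: "\<And>x. \<bar>c x\<bar> \<le> C"
  shows "integrable (lborel \<Otimes>\<^sub>M lborel) (\<lambda>(s, x). indicator {0..h::real} s * (k (x - s *\<^sub>R e) * c x))"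
    and "integrable (lborel \<Otimes>\<^sub>M lborel) (\<lambda>(s, x). indicator {0..h::real} s * (k x * c (x + s *\<^sub>R e)))"
proof -
  have C0: "0 \<le> C" using C[of 0] by linarith
  have [measurable]: "k \<in> borel_measurable borel" using k by auto
  let ?K = "\<lambda>s. indicator {0..h::real} s :: real"
  have sh: "integrable lborel (\<lambda>x. k (x - y))" for y
    using integrable_lborel_translation[OF k, of "- y"] by simp
  have shi: "(\<integral>x. \<bar>k (x - y)\<bar> \<partial>lborel) = (\<integral>x. \<bar>k x\<bar> \<partial>lborel)" for y
    using lborel_integral_translation[of "\<lambda>x. \<bar>k x\<bar>" "- y"] by simp
  have 1: "integrable (lborel \<Otimes>\<^sub>M lborel) (\<lambda>(s, x). ?K s * (C * k (x - s *\<^sub>R e)))"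
  proof (rule lborel_pair.Fubini_integrable)
    show "integrable lborel (\<lambda>s. \<integral>x. norm (case (s, x) of (s, x) \<Rightarrow> ?K s * (C * k (x - s *\<^sub>R e))) \<partial>lborel)"
      using integrable_indicator_Icc[of h] by (simp add: abs_mult shi)
  qed (use sh in auto)
  have 2: "integrable (lborel \<Otimes>\<^sub>M lborel) (\<lambda>(s, x). ?K s * (C * k x))"
  proof (rule lborel_pair.Fubini_integrable)
    show "integrable lborel (\<lambda>s. \<integral>x. norm (case (s, x) of (s, x) \<Rightarrow> ?K s * (C * k x)) \<partial>lborel)"
      using integrable_indicator_Icc[of h] by (simp add: abs_mult)
  qed (use k in auto)
  have le: "\<bar>a * (b * c y)\<bar> \<le> \<bar>a * (C * b)\<bar>" for a b y
  proof -
    have "\<bar>a\<bar> * \<bar>b\<bar> * \<bar>c y\<bar> \<le> \<bar>a\<bar> * \<bar>b\<bar> * C" using C[of y] by (intro mult_left_mono) auto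
    then show ?thesis using C0 by (simp add: abs_mult mult_ac)
  qed
  show "integrable (lborel \<Otimes>\<^sub>M lborel) (\<lambda>(s, x). ?K s * (k (x - s *\<^sub>R e) * c x))"
    by (rule Bochner_Integration.integrable_bound[OF 1]) (use le in \<open>auto simp: split_beta\<close>)
  show "integrable (lborel \<Otimes>\<^sub>M lborel) (\<lambda>(s, x). ?K s * (k x * c (x + s *\<^sub>R e)))"
    by (rule Bochner_Integration.integrable_bound[OF 2]) (use le in \<open>auto simp: split_beta\<close>)
qed

context ergodic_flow
begin

lemma H1_L2: "H1 X DX \<Longrightarrow> L2 M X" "H1 X DX \<Longrightarrow> L2 M DX"
  by (auto simp: H1_def)

lemma H1D:
  "H1 X DX \<Longrightarrow> L2 M g \<Longrightarrow> commuting_test_fun \<psi> \<Longrightarrow>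
    (\<integral>x. partial i \<psi> x * corr X g x \<partial>lborel) = - (\<integral>x. \<psi> x * corr (\<lambda>\<omega>. DX \<omega> $ i) g x \<partial>lborel)"
  by (auto simp: H1_def)

lemma H1_diff:
  assumes X: "H1 X DX" and Y: "H1 Y DY"
  shows "H1 (\<lambda>\<omega>. X \<omega> - Y \<omega>) (\<lambda>\<omega>. DX \<omega> - DY \<omega>)"
  unfolding H1_def
proof (intro conjI allI impI)
  note L = H1_L2[OF X] H1_L2[OF Y]
  show "L2 M (\<lambda>\<omega>. X \<omega> - Y \<omega>)" "L2 M (\<lambda>\<omega>. DX \<omega> - DY \<omega>)" using L L2_diff by auto
  fix g :: "'w \<Rightarrow> real" and \<psi> :: "real^'d \<Rightarrow> real" and i
  assume g: "L2 M g" and \<psi>: "commuting_test_fun \<psi>"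
  note t = commuting_test_funD[OF \<psi>]
  show "(\<integral>x. partial i \<psi> x * corr (\<lambda>\<omega>. X \<omega> - Y \<omega>) g x \<partial>lborel) =
      - (\<integral>x. \<psi> x * corr (\<lambda>\<omega>. (DX \<omega> - DY \<omega>) $ i) g x \<partial>lborel)"
    using H1D[OF X g \<psi>, of i] H1D[OF Y g \<psi>, of i]
      integrable_mult_corr[OF L(1) g test_fun_partial[OF t]] integrable_mult_corr[OF L(3) g test_fun_partial[OF t]]
      integrable_mult_corr[OF L2_component[OF L(2)] g t] integrable_mult_corr[OF L2_component[OF L(4)] g t]
    by (simp add: corr_diff_left[OF L(1,3) g] corr_diff_left[OF L2_component[OF L(2)] L2_component[OF L(4)] g] right_diff_distrib)
qed

lemma H1_scaleR:
  assumes X: "H1 X DX"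
  shows "H1 (\<lambda>\<omega>. c * X \<omega>) (\<lambda>\<omega>. c *\<^sub>R DX \<omega>)"
  unfolding H1_def
proof (intro conjI allI impI)
  note L = H1_L2[OF X]
  show "L2 M (\<lambda>\<omega>. c * X \<omega>)" "L2 M (\<lambda>\<omega>. c *\<^sub>R DX \<omega>)" using L2_scaleR[OF L(1), of c] L2_scaleR[OF L(2)] by auto
  fix g :: "'w \<Rightarrow> real" and \<psi> :: "real^'d \<Rightarrow> real" and i
  assume g: "L2 M g" and \<psi>: "commuting_test_fun \<psi>"
  show "(\<integral>x. partial i \<psi> x * corr (\<lambda>\<omega>. c * X \<omega>) g x \<partial>lborel) =
      - (\<integral>x. \<psi> x * corr (\<lambda>\<omega>. (c *\<^sub>R DX \<omega>) $ i) g x \<partial>lborel)"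
    using H1D[OF X g \<psi>, of i] by (simp add: corr_scale_left mult.left_commute[of _ c])
qed

text \<open>The translation moves to the other argument, <U_x U_z f, g> = <U_x f, U_{-z} g>, and the
  identity in \<open>H1\<close> holds for every g.\<close>

lemma H1_flow:
  assumes X: "H1 X DX"
  shows "H1 (\<lambda>\<omega>. X (\<theta> z \<omega>)) (\<lambda>\<omega>. DX (\<theta> z \<omega>))"
  unfolding H1_def
proof (intro conjI allI impI)
  note L = H1_L2[OF X]
  show "L2 M (\<lambda>\<omega>. X (\<theta> z \<omega>))" "L2 M (\<lambda>\<omega>. DX (\<theta> z \<omega>))" using L L2_flow by auto
  fix g :: "'w \<Rightarrow> real" and \<psi> :: "real^'d \<Rightarrow> real" and i
  assume g: "L2 M g" and \<psi>: "commuting_test_fun \<psi>"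
  have *: "corr (\<lambda>\<omega>. f (\<theta> z \<omega>)) g x = corr f (\<lambda>\<omega>. g (\<theta> (- z) \<omega>)) x" if "L2 M f" for f x
    by (simp add: corr_flow_left corr_flow_right[OF that g])
  show "(\<integral>x. partial i \<psi> x * corr (\<lambda>\<omega>. X (\<theta> z \<omega>)) g x \<partial>lborel) =
      - (\<integral>x. \<psi> x * corr (\<lambda>\<omega>. DX (\<theta> z \<omega>) $ i) g x \<partial>lborel)"
    using H1D[OF X L2_flow[OF g] \<psi>, of i "- z"]
    by (simp add: *[OF L(1)] *[OF L2_component[OF L(2)]])
qed

lemma H1_cong:
  assumes X: "H1 X DX" and eq: "\<And>\<omega>. \<omega> \<in> space M \<Longrightarrow> DX \<omega> = DX' \<omega>"
  shows "H1 X DX'"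
proof -
  have "L2 M DX'"
    using H1_L2(2)[OF X] eq unfolding L2_def
    by (auto cong: measurable_cong Bochner_Integration.integrable_cong)
  moreover have "corr (\<lambda>\<omega>. DX' \<omega> $ i) g = corr (\<lambda>\<omega>. DX \<omega> $ i) g" for i g
    unfolding corr_def using eq flow_space by (intro ext Bochner_Integration.integral_cong) auto
  ultimately show ?thesis using X by (simp add: H1_def)
qed

text \<open>For f = G_i and h \<ge> 0 this is the increment of the potential over h e_i, written
  without the potential. For negative h the interval is empty and the value is 0.\<close>

definition segment_integral :: "'d \<Rightarrow> real \<Rightarrow> ('w \<Rightarrow> real) \<Rightarrow> 'w \<Rightarrow> real" where
  "segment_integral i h f \<omega> = (\<integral>s. indicator {0..h} s * f (\<theta> (s *\<^sub>R axis i 1) \<omega>) \<partial>lborel)"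

lemma corr_segment_integral:
  assumes "L2 M f" "L2 M g"
  shows "corr (segment_integral i h f) g x = (\<integral>s. indicator {0..h} s * corr f g (x + s *\<^sub>R axis i 1) \<partial>lborel)"
proof -
  have "corr (segment_integral i h f) g x = (\<integral>\<omega>. (\<integral>s. indicator {0..h} s * f (\<theta> (x + s *\<^sub>R axis i 1) \<omega>) \<partial>lborel) * g \<omega> \<partial>M)"
    unfolding corr_def segment_integral_def
    by (intro Bochner_Integration.integral_cong refl arg_cong2[where f="(*)"]) (auto simp: flow_add add.commute)
  also have "\<dots> = (\<integral>s. indicator {0..h} s * corr f g (x + s *\<^sub>R axis i 1) \<partial>lborel)"
    by (rule integral_kernel_corr[OF lborel.sigma_finite_measure_axioms _ assms integrable_indicator_Icc]) measurable
  finally show ?thesis .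
qed

lemma L2_segment_integral:
  assumes f: "L2 M f"
  shows "L2 M (segment_integral i h f)"
proof -
  interpret P: pair_sigma_finite "lborel :: real measure" M ..
  let ?K = "\<lambda>s. indicator {0..h} s :: real"
  let ?p = "\<lambda>s. s *\<^sub>R axis i (1::real)"
  note [measurable] = L2_measurable[OF f]
  have [measurable]: "(\<lambda>(t, \<omega>). f (\<theta> (?p t) \<omega>)) \<in> borel_measurable (lborel \<Otimes>\<^sub>M M)"
    by (rule flow_joint_comp2) measurable
  have sq: "integrable M (\<lambda>\<omega>. (f (\<theta> z \<omega>))\<^sup>2)" for z
    using L2_norm_integrable[OF L2_flow[OF f]] by simp
  have sqi: "(\<integral>\<omega>. (f (\<theta> z \<omega>))\<^sup>2 \<partial>M) = (\<integral>\<omega>. (f \<omega>)\<^sup>2 \<partial>M)" for z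
    using L2_norm_flow[OF f] by simp
  have int: "integrable (lborel \<Otimes>\<^sub>M M) (\<lambda>(s, \<omega>). ?K s * (f (\<theta> (?p s) \<omega>))\<^sup>2)"
  proof (rule P.Fubini_integrable)
    show "integrable lborel (\<lambda>s. \<integral>\<omega>. norm (case (s, \<omega>) of (s, \<omega>) \<Rightarrow> ?K s * (f (\<theta> (?p s) \<omega>))\<^sup>2) \<partial>M)"
      using integrable_indicator_Icc[of h] by (simp add: abs_mult sqi)
  qed (use sq in auto)
  have m: "segment_integral i h f \<in> borel_measurable M"
  proof -
    have "integrable M (\<lambda>\<omega>. (\<integral>t. ?K t * f (\<theta> (?p t) \<omega>) \<partial>lborel) * 1)"
      by (rule integral_kernel_corr(1)[OF lborel.sigma_finite_measure_axioms _ f L2_const integrable_indicator_Icc])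
         (auto simp: finite_measure_axioms)
    then show ?thesis unfolding segment_integral_def[abs_def] by auto
  qed
  have bd: "AE \<omega> in M. norm ((segment_integral i h f \<omega>)\<^sup>2) \<le> norm ((\<integral>s. ?K s \<partial>lborel) * (\<integral>s. ?K s * (f (\<theta> (?p s) \<omega>))\<^sup>2 \<partial>lborel))"
    using P.AE_integrable_snd[OF int] AE_space
  proof eventually_elim
    case (elim \<omega>)
    have [measurable]: "(\<lambda>s. f (\<theta> (?p s) \<omega>)) \<in> borel_measurable borel"
      using measurable_compose[of ?p lborel, OF _ flow_path_measurable[OF L2_measurable[OF f] elim(2)]] by simp
    \<comment> \<open>Since the indicator is idempotent, the integrand splits into two factors, and
      Cauchy-Schwarz on the line bounds the squared segment integral by the length times the segment
      integral of f^2.\<close>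
    have K2: "(?K s)\<^sup>2 = ?K s" for s by (simp add: indicator_def)
    have "L2 lborel ?K"
      using integrable_indicator_Icc[of h] by (simp add: L2_def K2)
    moreover have "L2 lborel (\<lambda>s. ?K s * f (\<theta> (?p s) \<omega>))"
      using elim(1) by (simp add: L2_def power_mult_distrib K2)
    ultimately have "\<bar>\<integral>s. ?K s * (?K s * f (\<theta> (?p s) \<omega>)) \<partial>lborel\<bar> \<le>
        sqrt (\<integral>s. ?K s \<partial>lborel) * sqrt (\<integral>s. ?K s * (f (\<theta> (?p s) \<omega>))\<^sup>2 \<partial>lborel)"
      using L2_Cauchy_Schwarz[of lborel ?K "\<lambda>s. ?K s * f (\<theta> (?p s) \<omega>)"] by (simp add: power_mult_distrib K2)
    moreover have "?K s * (?K s * f (\<theta> (?p s) \<omega>)) = ?K s * f (\<theta> (?p s) \<omega>)" for s by (simp add: indicator_def)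
    ultimately have "\<bar>segment_integral i h f \<omega>\<bar> \<le> sqrt (\<integral>s. ?K s \<partial>lborel) * sqrt (\<integral>s. ?K s * (f (\<theta> (?p s) \<omega>))\<^sup>2 \<partial>lborel)"
      by (simp add: segment_integral_def)
    then have "\<bar>segment_integral i h f \<omega>\<bar>\<^sup>2 \<le> (sqrt (\<integral>s. ?K s \<partial>lborel) * sqrt (\<integral>s. ?K s * (f (\<theta> (?p s) \<omega>))\<^sup>2 \<partial>lborel))\<^sup>2"
      by (rule power_mono) simp
    moreover have "0 \<le> (\<integral>s. ?K s \<partial>lborel)" "0 \<le> (\<integral>s. ?K s * (f (\<theta> (?p s) \<omega>))\<^sup>2 \<partial>lborel)"
      by (auto intro!: integral_nonneg_AE)
    ultimately show ?case by (simp add: power_mult_distrib)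
  qed
  have "integrable M (\<lambda>\<omega>. (\<integral>s. ?K s \<partial>lborel) * (\<integral>s. ?K s * (f (\<theta> (?p s) \<omega>))\<^sup>2 \<partial>lborel))"
    using P.integrable_snd[OF int] by (intro integrable_mult_right) simp
  then have "integrable M (\<lambda>\<omega>. (segment_integral i h f \<omega>)\<^sup>2)"
    by (rule Bochner_Integration.integrable_bound) (use m bd in auto)
  then show ?thesis using m by (simp add: L2_def)
qed

text \<open>A curl-free field need not be a stationary gradient, but its increments are: they are the gradients
  of its line integrals.\<close>

lemma H1_increment:
  assumes G: "L2 M G" and h: "h \<ge> 0"
    and curl: "\<And>g \<psi> j. L2 M g \<Longrightarrow> commuting_test_fun \<psi> \<Longrightarrow>
      (\<integral>x. partial j \<psi> x * corr (\<lambda>\<omega>. G \<omega> $ i) g x \<partial>lborel) = (\<integral>x. partial i \<psi> x * corr (\<lambda>\<omega>. G \<omega> $ j) g x \<partial>lborel)"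
  shows "H1 (segment_integral i h (\<lambda>\<omega>. G \<omega> $ i)) (\<lambda>\<omega>. G (\<theta> (h *\<^sub>R axis i 1) \<omega>) - G \<omega>)"
  unfolding H1_def
proof (intro conjI allI impI)
  show "L2 M (segment_integral i h (\<lambda>\<omega>. G \<omega> $ i))" by (intro L2_segment_integral L2_component G)
  show "L2 M (\<lambda>\<omega>. G (\<theta> (h *\<^sub>R axis i 1) \<omega>) - G \<omega>)" by (intro L2_diff L2_flow G)
  fix g :: "'w \<Rightarrow> real" and \<psi> :: "real^'d \<Rightarrow> real" and j
  assume g: "L2 M g" and \<psi>: "commuting_test_fun \<psi>"
  note t = commuting_test_funD[OF \<psi>]
  note ti = test_fun_integrable[OF test_fun_partial[OF t, of i]] and tj = test_fun_integrable[OF test_fun_partial[OF t, of j]]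
  let ?e = "axis i (1::real) :: real^'d" and ?K = "\<lambda>s. indicator {0..h} s :: real"
  define c where "c = corr (\<lambda>\<omega>. G \<omega> $ i) g"
  define c' where "c' = corr (\<lambda>\<omega>. G \<omega> $ j) g"
  note LG = L2_component[OF G]
  have m[measurable]: "c \<in> borel_measurable borel" "c' \<in> borel_measurable borel"
    "\<psi> \<in> borel_measurable borel" "partial i \<psi> \<in> borel_measurable borel" "partial j \<psi> \<in> borel_measurable borel"
    using corr_measurable[OF LG g] test_fun_integrable[OF t] ti tj by (auto simp: c_def c'_def)
  note cb = corr_bound[OF LG[of i] g, folded c_def] and cb' = corr_bound[OF LG[of j] g, folded c'_def]
  have shift: "corr (\<lambda>\<omega>. G \<omega> $ l) g (x + y) = corr (\<lambda>\<omega>. G \<omega> $ l) (\<lambda>\<omega>. g (\<theta> (- y) \<omega>)) x" for l x y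
    using corr_flow_right[OF LG g, of l "- y" x] by simp
  \<comment> \<open>The shift by s e_i is absorbed into g, for which the curl relation holds as
    well, and is then carried over to the test function by a change of variables.\<close>
  have step: "(\<integral>x. partial j \<psi> x * c (x + s *\<^sub>R ?e) \<partial>lborel) = (\<integral>x. partial i \<psi> (x - s *\<^sub>R ?e) * c' x \<partial>lborel)" for s
  proof -
    have "(\<integral>x. partial j \<psi> x * c (x + s *\<^sub>R ?e) \<partial>lborel) = (\<integral>x. partial i \<psi> x * c' (x + s *\<^sub>R ?e) \<partial>lborel)"
      unfolding c_def c'_def shift by (rule curl[OF L2_flow[OF g] \<psi>])
    also have "\<dots> = (\<integral>x. partial i \<psi> (x - s *\<^sub>R ?e) * c' x \<partial>lborel)"
      using lborel_integral_translation[of "\<lambda>x. partial i \<psi> (x - s *\<^sub>R ?e) * c' x" "s *\<^sub>R ?e"] by simp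
    finally show ?thesis .
  qed
  have "(\<integral>x. partial j \<psi> x * corr (segment_integral i h (\<lambda>\<omega>. G \<omega> $ i)) g x \<partial>lborel)
     = (\<integral>x. (\<integral>s. ?K s * (partial j \<psi> x * c (x + s *\<^sub>R ?e)) \<partial>lborel) \<partial>lborel)"
    by (simp add: corr_segment_integral[OF LG g] c_def mult.left_commute)
  also have "\<dots> = (\<integral>s. (\<integral>x. ?K s * (partial j \<psi> x * c (x + s *\<^sub>R ?e)) \<partial>lborel) \<partial>lborel)"
    using lborel_pair.Fubini_integral[OF integrable_pair_shifted(2)[OF tj m(1) cb, where h=h and e="?e"]] by simp
  also have "\<dots> = (\<integral>s. (\<integral>x. ?K s * (partial i \<psi> (x - s *\<^sub>R ?e) * c' x) \<partial>lborel) \<partial>lborel)"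
    by (simp add: step)
  also have "\<dots> = (\<integral>x. (\<integral>s. ?K s * (partial i \<psi> (x - s *\<^sub>R ?e) * c' x) \<partial>lborel) \<partial>lborel)"
    using lborel_pair.Fubini_integral[OF integrable_pair_shifted(1)[OF ti m(2) cb', where h=h and e="?e"]] by simp
  also have "\<dots> = (\<integral>x. (\<integral>s. ?K s * partial i \<psi> (x - s *\<^sub>R ?e) \<partial>lborel) * c' x \<partial>lborel)"
    by (simp add: mult.assoc[symmetric])
  \<comment> \<open>Along the segment the directional derivative integrates to a difference of two
    translates of \<psi>; moving the translation back makes it an increment of c'.\<close>
  also have "\<dots> = (\<integral>x. \<psi> x * c' x - \<psi> (x - h *\<^sub>R ?e) * c' x \<partial>lborel)"
    by (simp add: integral_test_fun_segment[OF t h] left_diff_distrib)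
  also have "\<dots> = (\<integral>x. \<psi> x * c' x \<partial>lborel) - (\<integral>x. \<psi> (x - h *\<^sub>R ?e) * c' x \<partial>lborel)"
  proof (rule Bochner_Integration.integral_diff)
    show "integrable lborel (\<lambda>x. \<psi> x * c' x)" unfolding c'_def by (rule integrable_mult_corr[OF LG g t])
    show "integrable lborel (\<lambda>x. \<psi> (x - h *\<^sub>R ?e) * c' x)"
      using integrable_corr_comp[OF LG g integrable_lborel_translation[OF test_fun_integrable[OF t], of "- h *\<^sub>R ?e"], of "\<lambda>x. x"]
      by (simp add: c'_def)
  qed
  also have "(\<integral>x. \<psi> (x - h *\<^sub>R ?e) * c' x \<partial>lborel) = (\<integral>x. \<psi> x * c' (x + h *\<^sub>R ?e) \<partial>lborel)"
    using lborel_integral_translation[of "\<lambda>x. \<psi> (x - h *\<^sub>R ?e) * c' x" "h *\<^sub>R ?e"] by simp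
  also have "(\<integral>x. \<psi> x * c' x \<partial>lborel) - \<dots> = - (\<integral>x. \<psi> x * corr (\<lambda>\<omega>. (G (\<theta> (h *\<^sub>R ?e) \<omega>) - G \<omega>) $ j) g x \<partial>lborel)"
  proof -
    have "corr (\<lambda>\<omega>. (G (\<theta> (h *\<^sub>R ?e) \<omega>) - G \<omega>) $ j) g x = c' (x + h *\<^sub>R ?e) - c' x" for x
      by (simp add: corr_diff_left[OF L2_flow[OF LG] LG g] corr_flow_left[of "\<lambda>\<omega>. G \<omega> $ j"] c'_def)
    moreover have "integrable lborel (\<lambda>x. \<psi> x * c' x)" "integrable lborel (\<lambda>x. \<psi> x * c' (x + h *\<^sub>R ?e))"
      unfolding c'_def using integrable_mult_corr[OF LG g t] integrable_corr_comp[OF LG g test_fun_integrable[OF t], of "\<lambda>x. x + h *\<^sub>R ?e"] by auto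
    ultimately show ?thesis by (simp add: right_diff_distrib)
  qed
  finally show "(\<integral>x. partial j \<psi> x * corr (segment_integral i h (\<lambda>\<omega>. G \<omega> $ i)) g x \<partial>lborel)
     = - (\<integral>x. \<psi> x * corr (\<lambda>\<omega>. (G (\<theta> (h *\<^sub>R ?e) \<omega>) - G \<omega>) $ j) g x \<partial>lborel)" .
qed

lemma gradient_increment:
  assumes G: "L2 M G"
    and curl: "\<And>g \<psi> i j. L2 M g \<Longrightarrow> commuting_test_fun \<psi> \<Longrightarrow>
      (\<integral>x. partial j \<psi> x * corr (\<lambda>\<omega>. G \<omega> $ i) g x \<partial>lborel) = (\<integral>x. partial i \<psi> x * corr (\<lambda>\<omega>. G \<omega> $ j) g x \<partial>lborel)"
  shows "\<exists>X. H1 X (\<lambda>\<omega>. G (\<theta> z \<omega>) - G \<omega>)"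
proof -
  have one: "\<exists>X. H1 X (\<lambda>\<omega>. G (\<theta> (h *\<^sub>R axis i 1) \<omega>) - G \<omega>)" for h i
  proof (cases "h \<ge> 0")
    case True
    then show ?thesis using H1_increment[OF G True curl] by blast
  next
    case False
    then obtain X where "H1 X (\<lambda>\<omega>. G (\<theta> ((- h) *\<^sub>R axis i 1) \<omega>) - G \<omega>)"
      using H1_increment[OF G _ curl, of "- h" i] by auto
    \<comment> \<open>The increment for h is the negative of the increment for -h translated by h
      e_i.\<close>
    from H1_scaleR[OF H1_flow[OF this, of "h *\<^sub>R axis i 1"], of "-1"] show ?thesis
      by (intro exI) (erule H1_cong, simp add: flow_add flow_zero)
  qed
  have "\<exists>X. H1 X (\<lambda>\<omega>. G (\<theta> (\<Sum>i\<in>S. z $ i *\<^sub>R axis i 1) \<omega>) - G \<omega>)" if "finite S" for S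
    using that
  proof induction
    case empty
    obtain X where "H1 X (\<lambda>\<omega>. G (\<theta> (0 *\<^sub>R axis undefined 1) \<omega>) - G \<omega>)" using one by blast
    then show ?case by auto
  next
    case (insert i S)
    let ?a = "z $ i *\<^sub>R axis i 1" and ?b = "\<Sum>i\<in>S. z $ i *\<^sub>R axis i 1"
    obtain X where X: "H1 X (\<lambda>\<omega>. G (\<theta> ?b \<omega>) - G \<omega>)" using insert by blast
    obtain Y where Y: "H1 Y (\<lambda>\<omega>. G (\<theta> ?a \<omega>) - G \<omega>)" using one by blast
    \<comment> \<open>Cocycle identity: the increment over a + b is the increment over b plus the
      increment over a translated by b. Each use adds one coordinate of z.\<close>
    from H1_diff[OF X H1_scaleR[OF H1_flow[OF Y, of ?b], of "-1"]] insert(1,2)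
    show ?case by (intro exI) (erule H1_cong, simp add: flow_add)
  qed
  from this[of UNIV] show ?thesis by (simp add: basis_expansion[of z, simplified scalar_mult_eq_scaleR])
qed

end

subsection \<open>Density of stationary gradients\<close>

lemma (in prob_space) L1_le_L2:
  assumes "L2 M f"
  shows "(\<integral>\<omega>. norm (f \<omega>) \<partial>M) \<le> sqrt (\<integral>\<omega>. (norm (f \<omega>))\<^sup>2 \<partial>M)"
proof -
  have "L2 M (\<lambda>\<omega>. norm (f \<omega>))" using assms by (auto simp: L2_def)
  from L2_Cauchy_Schwarz[OF this L2_const[OF finite_measure_axioms, of "1::real"]] show ?thesis
    by (simp add: prob_space)
qed

text \<open>Riesz-Fischer with a prescribed rate: consecutive L^1 distances are at most 2^-n, hence
  summable, so the whole sequence converges almost surely; Fatou passes the bounds on to the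
  limit.\<close>

lemma (in prob_space) L2_complete:
  fixes f :: "nat \<Rightarrow> 'a \<Rightarrow> 'b::euclidean_space"
  assumes f: "\<And>n. L2 M (f n)"
    and Cauchy: "\<And>m n. n \<le> m \<Longrightarrow> (\<integral>\<omega>. (norm (f m \<omega> - f n \<omega>))\<^sup>2 \<partial>M) \<le> (1/4) ^ n"
  obtains F where "L2 M F" "\<And>n. (\<integral>\<omega>. (norm (F \<omega> - f n \<omega>))\<^sup>2 \<partial>M) \<le> (1/4) ^ n"
proof -
  note [measurable] = L2_measurable[OF f]
  have Ld: "L2 M (\<lambda>\<omega>. f m \<omega> - f n \<omega>)" for m n by (rule L2_diff[OF f f])
  have D: "(\<integral>\<^sup>+\<omega>. ennreal (norm (f (Suc n) \<omega> - f n \<omega>)) \<partial>M) \<le> ennreal ((1/2) ^ n)" for n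
  proof -
    have "(\<integral>\<omega>. norm (f (Suc n) \<omega> - f n \<omega>) \<partial>M) \<le> sqrt ((1/4) ^ n)"
      using L1_le_L2[OF Ld[of "Suc n" n]] real_sqrt_le_mono[OF Cauchy[of n "Suc n"]] by linarith
    also have "sqrt ((1/4) ^ n) = (1/2::real) ^ n"
      by (rule real_sqrt_unique) (auto simp: power_mult_distrib[symmetric] power2_eq_square)
    finally have "(\<integral>\<omega>. norm (f (Suc n) \<omega> - f n \<omega>) \<partial>M) \<le> (1/2) ^ n" .
    moreover have "(\<integral>\<^sup>+\<omega>. ennreal (norm (f (Suc n) \<omega> - f n \<omega>)) \<partial>M) = ennreal (\<integral>\<omega>. norm (f (Suc n) \<omega> - f n \<omega>) \<partial>M)"
      using L2_integrable[OF finite_measure_axioms Ld] by (intro nn_integral_eq_integral) auto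
    ultimately show ?thesis by (simp add: ennreal_leI)
  qed
  have "(\<integral>\<^sup>+\<omega>. (\<Sum>n. ennreal (norm (f (Suc n) \<omega> - f n \<omega>))) \<partial>M) = (\<Sum>n. \<integral>\<^sup>+\<omega>. ennreal (norm (f (Suc n) \<omega> - f n \<omega>)) \<partial>M)"
    by (rule nn_integral_suminf) measurable
  also have "\<dots> \<le> (\<Sum>n. ennreal ((1/2) ^ n))" by (intro suminf_le D) auto
  also have "\<dots> = ennreal (\<Sum>n. (1/2) ^ n)" by (intro suminf_ennreal2) auto
  finally have "(\<integral>\<^sup>+\<omega>. (\<Sum>n. ennreal (norm (f (Suc n) \<omega> - f n \<omega>))) \<partial>M) \<noteq> \<infinity>"
    by (auto simp: top_unique)
  then have "AE \<omega> in M. (\<Sum>n. ennreal (norm (f (Suc n) \<omega> - f n \<omega>))) \<noteq> \<infinity>"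
    by (intro nn_integral_PInf_AE) auto
  then have conv: "AE \<omega> in M. (\<lambda>n. f n \<omega>) \<longlonglongrightarrow> lim (\<lambda>n. f n \<omega>)"
  proof eventually_elim
    case (elim \<omega>)
    then have "summable (\<lambda>n. norm (f (Suc n) \<omega> - f n \<omega>))"
      by (intro summable_suminf_not_top) auto
    then have "summable (\<lambda>n. f (Suc n) \<omega> - f n \<omega>)" by (rule summable_norm_cancel)
    then have "convergent (\<lambda>n. \<Sum>i<n. f (Suc i) \<omega> - f i \<omega>)" by (simp add: summable_iff_convergent)
    then have "convergent (\<lambda>n. f n \<omega> - f 0 \<omega>)" by (simp only: sum_lessThan_telescope[of "\<lambda>i. f i \<omega>"])
    then obtain l where "(\<lambda>n. f n \<omega> - f 0 \<omega>) \<longlonglongrightarrow> l" by (auto simp: convergent_def)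
    then have "(\<lambda>n. (f n \<omega> - f 0 \<omega>) + f 0 \<omega>) \<longlonglongrightarrow> l + f 0 \<omega>" by (intro tendsto_intros)
    then show ?case by (simp add: convergent_LIMSEQ_iff[symmetric] convergentI)
  qed
  define F where "F \<omega> = lim (\<lambda>n. f n \<omega>)" for \<omega>
  have [measurable]: "F \<in> borel_measurable M" unfolding F_def by measurable
  have nn: "(\<integral>\<^sup>+\<omega>. ennreal ((norm (F \<omega> - f n \<omega>))\<^sup>2) \<partial>M) \<le> ennreal ((1/4) ^ n)" for n
  proof -
    have "(\<integral>\<^sup>+\<omega>. ennreal ((norm (F \<omega> - f n \<omega>))\<^sup>2) \<partial>M) = (\<integral>\<^sup>+\<omega>. liminf (\<lambda>m. ennreal ((norm (f m \<omega> - f n \<omega>))\<^sup>2)) \<partial>M)"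
    proof (rule nn_integral_cong_AE)
      show "AE \<omega> in M. ennreal ((norm (F \<omega> - f n \<omega>))\<^sup>2) = liminf (\<lambda>m. ennreal ((norm (f m \<omega> - f n \<omega>))\<^sup>2))"
        using conv
      proof eventually_elim
        case (elim \<omega>)
        then have "(\<lambda>m. ennreal ((norm (f m \<omega> - f n \<omega>))\<^sup>2)) \<longlonglongrightarrow> ennreal ((norm (F \<omega> - f n \<omega>))\<^sup>2)"
          unfolding F_def by (intro tendsto_intros)
        from lim_imp_Liminf[OF sequentially_bot this] show ?case by simp
      qed
    qed
    also have "\<dots> \<le> liminf (\<lambda>m. \<integral>\<^sup>+\<omega>. ennreal ((norm (f m \<omega> - f n \<omega>))\<^sup>2) \<partial>M)"
      by (rule nn_integral_liminf) measurable
    also have "\<dots> \<le> liminf (\<lambda>m. ennreal ((1/4) ^ n))"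
    proof (rule Liminf_mono, rule eventually_sequentiallyI)
      fix m assume "n \<le> m"
      have "(\<integral>\<^sup>+\<omega>. ennreal ((norm (f m \<omega> - f n \<omega>))\<^sup>2) \<partial>M) = ennreal (\<integral>\<omega>. (norm (f m \<omega> - f n \<omega>))\<^sup>2 \<partial>M)"
        using L2_norm_integrable[OF Ld] by (intro nn_integral_eq_integral) auto
      also have "\<dots> \<le> ennreal ((1/4) ^ n)" using Cauchy[OF \<open>n \<le> m\<close>] by (rule ennreal_leI)
      finally show "(\<integral>\<^sup>+\<omega>. ennreal ((norm (f m \<omega> - f n \<omega>))\<^sup>2) \<partial>M) \<le> ennreal ((1/4) ^ n)" .
    qed
    also have "\<dots> = ennreal ((1/4) ^ n)" by (simp add: Liminf_const)
    finally show ?thesis .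
  qed
  have int: "integrable M (\<lambda>\<omega>. (norm (F \<omega> - f n \<omega>))\<^sup>2)" for n
    by (rule integrableI_bounded) (use nn[of n] in \<open>auto intro: le_less_trans\<close>)
  have "L2 M (\<lambda>\<omega>. F \<omega> - f 0 \<omega>)" using int by (simp add: L2_def)
  from L2_add[OF this f[of 0]] have "L2 M F" by simp
  moreover have "(\<integral>\<omega>. (norm (F \<omega> - f n \<omega>))\<^sup>2 \<partial>M) \<le> (1/4) ^ n" for n
    using nn[of n] nn_integral_eq_integral[OF int[of n]] by (simp add: ennreal_le_iff)
  ultimately show ?thesis using that by blast
qed

section \<open>Ergodicity and the closure of the gradients\<close>

context ergodic_flow
begin

lemma invariant_zero_one:
  fixes f :: "'w \<Rightarrow> real"
  assumes [measurable]: "f \<in> borel_measurable M" and inv: "\<And>z. AE \<omega> in M. f (\<theta> z \<omega>) = f \<omega>"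
  shows "(AE \<omega> in M. f \<omega> \<le> 0) \<or> (AE \<omega> in M. f \<omega> > 0)"
proof -
  interpret P: pair_sigma_finite lborel M ..
  note [measurable] = flow_joint_comp[OF assms(1)]
  \<comment> \<open>Ergodicity is assumed for strictly invariant events only; \<^term>\<open>J\<close> replaces the almost surely invariant event.\<close>
  define J where "J \<omega> = (\<integral>\<^sup>+x. indicator {0<..} (f (\<theta> x \<omega>)) \<partial>lborel)" for \<omega>
  have Jm[measurable]: "J \<in> borel_measurable M"
  proof -
    have [measurable]: "(\<lambda>(\<omega>, x). f (\<theta> x \<omega>)) \<in> borel_measurable (M \<Otimes>\<^sub>M lborel)"
      using measurable_pair_swap[OF flow_joint_comp[OF assms(1)]] by (simp add: split_beta')
    show ?thesis unfolding J_def by measurable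
  qed
  have Jinv: "J (\<theta> y \<omega>) = J \<omega>" if \<omega>: "\<omega> \<in> space M" for y \<omega>
  proof -
    have [measurable]: "(\<lambda>x. f (\<theta> x \<omega>)) \<in> borel_measurable borel"
      using flow_path_measurable[OF assms(1) \<omega>] by simp
    have "J (\<theta> y \<omega>) = (\<integral>\<^sup>+x. indicator {0<..} (f (\<theta> (y + x) \<omega>)) \<partial>lborel)"
      unfolding J_def by (intro nn_integral_cong) (simp add: flow_add[OF \<omega>] add.commute)
    also have "\<dots> = (\<integral>\<^sup>+x. indicator {0<..} (f (\<theta> x \<omega>)) \<partial>distr lborel borel ((+) y))"
      by (rule nn_integral_distr[symmetric]) measurable
    also have "\<dots> = J \<omega>" by (simp add: lborel_distr_plus J_def)
    finally show ?thesis .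
  qed
  define E where "E = {\<omega> \<in> space M. J \<omega> = 0}"
  have E: "E \<in> sets M" unfolding E_def by measurable
  have "prob E = 0 \<or> prob E = 1"
    by (rule invariant_prob[OF E]) (use Jinv flow_space in \<open>auto simp: E_def\<close>)
  then have "(AE \<omega> in M. \<omega> \<notin> E) \<or> (AE \<omega> in M. \<omega> \<in> E)"
    using E prob_eq_0[OF E] prob_eq_1[OF E] by auto
  moreover have "{p \<in> space (lborel \<Otimes>\<^sub>M M). f (\<theta> (fst p) (snd p)) = f (snd p)} \<in> sets (lborel \<Otimes>\<^sub>M M)"
    by measurable
  \<comment> \<open>The null set in \<open>inv\<close> depends on z. Fubini trades it for a single
    null set of \<omega> and, for every other \<omega>, a null set of x that J does not see.\<close>
  then have "AE \<omega> in M. AE x in lborel. f (\<theta> x \<omega>) = f \<omega>"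
    using P.AE_commute[of "\<lambda>x \<omega>. f (\<theta> x \<omega>) = f \<omega>"] inv by simp
  then have "AE \<omega> in M. \<omega> \<in> E \<longleftrightarrow> f \<omega> \<le> 0"
    using AE_space
  proof eventually_elim
    case (elim \<omega>)
    \<comment> \<open>Along such a path the integrand is almost everywhere constant, so J is either
      0 or the infinite volume of the whole space.\<close>
    have "J \<omega> = (\<integral>\<^sup>+(x::real^'d). indicator {0<..} (f \<omega>) \<partial>lborel)"
      unfolding J_def by (rule nn_integral_cong_AE) (use elim(1) in eventually_elim, simp)
    also have "\<dots> = indicator {0<..} (f \<omega>) * \<infinity>" by (simp add: emeasure_lborel_UNIV)
    finally show ?case using elim(2) by (auto simp: E_def indicator_def)
  qed
  ultimately show ?thesis
  proof (elim disjE)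
    assume "AE \<omega> in M. \<omega> \<notin> E" "AE \<omega> in M. \<omega> \<in> E \<longleftrightarrow> f \<omega> \<le> 0"
    then have "AE \<omega> in M. f \<omega> > 0" by eventually_elim auto
    then show ?thesis ..
  next
    assume "AE \<omega> in M. \<omega> \<in> E" "AE \<omega> in M. \<omega> \<in> E \<longleftrightarrow> f \<omega> \<le> 0"
    then have "AE \<omega> in M. f \<omega> \<le> 0" by eventually_elim auto
    then show ?thesis ..
  qed
qed

text \<open>The zero-one law gives f a constant sign almost surely, and then a vanishing mean forces
  f to vanish.\<close>

lemma invariant_mean_zero:
  fixes f :: "'w \<Rightarrow> real"
  assumes int: "integrable M f" and mean: "(\<integral>\<omega>. f \<omega> \<partial>M) = 0" and inv: "\<And>z. AE \<omega> in M. f (\<theta> z \<omega>) = f \<omega>"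
  shows "AE \<omega> in M. f \<omega> = 0"
  using invariant_zero_one[OF borel_measurable_integrable[OF int] inv]
proof
  assume "AE \<omega> in M. f \<omega> \<le> 0"
  then have "AE \<omega> in M. 0 \<le> - f \<omega>" by eventually_elim simp
  moreover have "(\<integral>\<omega>. - f \<omega> \<partial>M) = 0" using mean by simp
  ultimately have "AE \<omega> in M. - f \<omega> = 0"
    using integral_nonneg_eq_0_iff_AE[of M "\<lambda>\<omega>. - f \<omega>"] int by simp
  then show ?thesis by simp
next
  assume "AE \<omega> in M. f \<omega> > 0"
  then have "AE \<omega> in M. 0 \<le> f \<omega>" by eventually_elim simp
  then show ?thesis using integral_nonneg_eq_0_iff_AE[OF int] mean by simp
qed

text \<open>Mean ergodic argument: the fields of mean zero that differ from \<^term>\<open>G\<close> by a gradient form an affine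
  set invariant under the flow, so by the parallelogram law its element of minimal norm is invariant, hence zero.\<close>

lemma gradient_approximation:
  assumes G: "L2 M G" and mean: "\<And>i. (\<integral>\<omega>. G \<omega> $ i \<partial>M) = 0"
    and incr: "\<And>z. \<exists>X. H1 X (\<lambda>\<omega>. G (\<theta> z \<omega>) - G \<omega>)" and "0 < \<epsilon>"
  obtains X DX where "H1 X DX" "(\<integral>\<omega>. (norm (G \<omega> - DX \<omega>))\<^sup>2 \<partial>M) < \<epsilon>"
proof -
  define W where "W f \<longleftrightarrow> L2 M f \<and> (\<forall>i. (\<integral>\<omega>. f \<omega> $ i \<partial>M) = 0) \<and> (\<exists>X. H1 X (\<lambda>\<omega>. G \<omega> - f \<omega>))" for f
  define N where "N f = (\<integral>\<omega>. (norm (f \<omega>))\<^sup>2 \<partial>M)" for f :: "'w \<Rightarrow> real^'d"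
  have WL: "L2 M f" if "W f" for f using that by (simp add: W_def)
  have comp_int: "integrable M (\<lambda>\<omega>. f \<omega> $ i)" if "L2 M f" for f :: "'w \<Rightarrow> real^'d" and i
    by (rule L2_integrable[OF finite_measure_axioms L2_component[OF that]])
  have WG: "W G"
  proof -
    obtain X where "H1 X (\<lambda>\<omega>. G (\<theta> 0 \<omega>) - G \<omega>)" using incr by blast
    then have "H1 X (\<lambda>\<omega>. G \<omega> - G \<omega>)" by (rule H1_cong) (simp add: flow_zero)
    then show ?thesis using G mean by (auto simp: W_def)
  qed
  have Wmid: "W (\<lambda>\<omega>. (1/2) *\<^sub>R (f \<omega> + g \<omega>))" if "W f" "W g" for f g
  proof -
    obtain X Y where "H1 X (\<lambda>\<omega>. G \<omega> - f \<omega>)" "H1 Y (\<lambda>\<omega>. G \<omega> - g \<omega>)" using \<open>W f\<close> \<open>W g\<close> by (auto simp: W_def)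
    from H1_diff[OF H1_scaleR[OF this(1), of "1/2"] H1_scaleR[OF this(2), of "-1/2"]]
    have "H1 (\<lambda>\<omega>. (1/2) * X \<omega> - (-1/2) * Y \<omega>) (\<lambda>\<omega>. G \<omega> - (1/2) *\<^sub>R (f \<omega> + g \<omega>))"
      by (rule H1_cong) (simp add: vec_eq_iff field_simps)
    moreover have "L2 M (\<lambda>\<omega>. (1/2) *\<^sub>R (f \<omega> + g \<omega>))"
      using L2_scaleR[OF L2_add[OF WL[OF \<open>W f\<close>] WL[OF \<open>W g\<close>]]] by simp
    moreover have "(\<integral>\<omega>. ((1/2) *\<^sub>R (f \<omega> + g \<omega>)) $ i \<partial>M) = 0" for i
      using that comp_int[of f i] comp_int[of g i] by (simp add: W_def)
    ultimately show ?thesis by (auto simp: W_def)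
  qed
  have Wflow: "W (\<lambda>\<omega>. f (\<theta> z \<omega>))" if "W f" for f z
  proof -
    obtain X Y where "H1 X (\<lambda>\<omega>. G \<omega> - f \<omega>)" "H1 Y (\<lambda>\<omega>. G (\<theta> z \<omega>) - G \<omega>)" using \<open>W f\<close> incr[of z] by (auto simp: W_def)
    from H1_diff[OF H1_flow[OF this(1), of z] this(2)]
    have "H1 (\<lambda>\<omega>. X (\<theta> z \<omega>) - Y \<omega>) (\<lambda>\<omega>. G \<omega> - f (\<theta> z \<omega>))"
      by (rule H1_cong) simp
    moreover have "(\<integral>\<omega>. f (\<theta> z \<omega>) $ i \<partial>M) = 0" for i
      using integral_flow[OF borel_measurable_integrable[OF comp_int[OF WL[OF that], of i]]] that by (simp add: W_def)
    ultimately show ?thesis using L2_flow[OF WL[OF that]] by (auto simp: W_def)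
  qed
  define \<delta> where "\<delta> = Inf (N ` Collect W)"
  have N0: "0 \<le> N f" for f by (simp add: N_def)
  have bdd: "bdd_below (N ` Collect W)" using N0 by (intro bdd_belowI[of _ 0]) auto
  have le: "\<delta> \<le> N f" if "W f" for f unfolding \<delta>_def using that bdd by (intro cInf_lower) auto
  \<comment> \<open>Parallelogram law: the midpoint lies in W, so its squared norm is at least
    \<delta>, and 2 (\<delta> + a) + 2 (\<delta> + a) - 4 \<delta> = 4 a.\<close>
  have near: "(\<integral>\<omega>. (norm (f \<omega> - g \<omega>))\<^sup>2 \<partial>M) \<le> 4 * a" if "W f" "W g" "N f < \<delta> + a" "N g < \<delta> + a" for f g a
  proof -
    note Lf = WL[OF that(1)] and Lg = WL[OF that(2)]
    have e: "(norm (f \<omega> - g \<omega>))\<^sup>2 = 2 * (norm (f \<omega>))\<^sup>2 + 2 * (norm (g \<omega>))\<^sup>2 - 4 * (norm ((1/2) *\<^sub>R (f \<omega> + g \<omega>)))\<^sup>2" for \<omega>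
      by (simp only: power2_norm_eq_inner) (simp add: algebra_simps inner_commute)
    have "(\<integral>\<omega>. (norm (f \<omega> - g \<omega>))\<^sup>2 \<partial>M) = 2 * N f + 2 * N g - 4 * N (\<lambda>\<omega>. (1/2) *\<^sub>R (f \<omega> + g \<omega>))"
      unfolding e N_def using L2_norm_integrable[OF Lf] L2_norm_integrable[OF Lg] L2_norm_integrable[OF WL[OF Wmid[OF that(1,2)]]]
      by (simp del: norm_scaleR)
    with le[OF Wmid[OF that(1,2)]] that(3,4) show ?thesis by linarith
  qed
  \<comment> \<open>By \<open>near\<close>, the tolerance 4^-(n+1) yields exactly the rate 4^-n
    required by \<open>L2_complete\<close>.\<close>
  have "\<exists>f. W f \<and> N f < \<delta> + (1/4) ^ Suc n" for n
  proof -
    have "Inf (N ` Collect W) < \<delta> + (1/4) ^ Suc n" by (simp add: \<delta>_def)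
    then show ?thesis using WG bdd by (subst (asm) cInf_less_iff) auto
  qed
  then obtain f where Wf: "\<And>n. W (f n)" and Nf: "\<And>n. N (f n) < \<delta> + (1/4) ^ Suc n" by metis
  have Cauchy: "(\<integral>\<omega>. (norm (f m \<omega> - f n \<omega>))\<^sup>2 \<partial>M) \<le> (1/4) ^ n" if "n \<le> m" for m n
  proof -
    have "(1/4::real) ^ Suc m \<le> (1/4) ^ Suc n" using that by (intro power_decreasing) auto
    then have "N (f m) < \<delta> + (1/4) ^ Suc n" using Nf[of m] by linarith
    from near[OF Wf Wf this Nf] show ?thesis by simp
  qed
  obtain F where F: "L2 M F" and FN: "\<And>n. (\<integral>\<omega>. (norm (F \<omega> - f n \<omega>))\<^sup>2 \<partial>M) \<le> (1/4) ^ n"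
    using L2_complete[OF WL[OF Wf] Cauchy] by metis
  have lim0: "(\<lambda>n. C * (1/4::real) ^ n) \<longlonglongrightarrow> 0" for C
    using tendsto_mult_left[OF LIMSEQ_power_zero[of "1/4::real"], of C] by simp
  \<comment> \<open>The translate of an almost minimizer is an almost minimizer too, so the two are
    close. The constant 10 = 2 + 4 + 4 sums the coefficients in \<open>pt\<close>.\<close>
  have inv: "AE \<omega> in M. F (\<theta> z \<omega>) = F \<omega>" for z
  proof -
    have L: "L2 M (\<lambda>\<omega>. F (\<theta> z \<omega>) - F \<omega>)" by (rule L2_diff[OF L2_flow[OF F] F])
    have "(\<integral>\<omega>. (norm (F (\<theta> z \<omega>) - F \<omega>))\<^sup>2 \<partial>M) \<le> 10 * (1/4) ^ n" for n
    proof -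
      have L1: "L2 M (\<lambda>\<omega>. F \<omega> - f n \<omega>)" by (rule L2_diff[OF F WL[OF Wf]])
      have L2': "L2 M (\<lambda>\<omega>. f n (\<theta> z \<omega>) - f n \<omega>)" by (rule L2_diff[OF L2_flow[OF WL[OF Wf]] WL[OF Wf]])
      have "N (\<lambda>\<omega>. f n (\<theta> z \<omega>)) < \<delta> + (1/4) ^ Suc n" using Nf[of n] L2_norm_flow[OF WL[OF Wf]] by (simp add: N_def)
      from near[OF Wflow[OF Wf] Wf this Nf]
      have b2: "(\<integral>\<omega>. (norm (f n (\<theta> z \<omega>) - f n \<omega>))\<^sup>2 \<partial>M) \<le> (1/4) ^ n" by simp
      have b3: "(\<integral>\<omega>. (norm (F (\<theta> z \<omega>) - f n (\<theta> z \<omega>)))\<^sup>2 \<partial>M) \<le> (1/4) ^ n"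
        using L2_norm_flow[OF L1, of z] FN[of n] by simp
      have pt: "(norm (a - b))\<^sup>2 \<le> 2 * (norm (a - c))\<^sup>2 + 4 * (norm (c - d))\<^sup>2 + 4 * (norm (b - d))\<^sup>2" for a b c d :: "real^'d"
        using norm_sq_add_le[of "a - c" "c - b"] norm_sq_diff_le[of "c - d" "b - d"] by simp
      have "(\<integral>\<omega>. (norm (F (\<theta> z \<omega>) - F \<omega>))\<^sup>2 \<partial>M) \<le>
        (\<integral>\<omega>. 2 * (norm (F (\<theta> z \<omega>) - f n (\<theta> z \<omega>)))\<^sup>2 + 4 * (norm (f n (\<theta> z \<omega>) - f n \<omega>))\<^sup>2 + 4 * (norm (F \<omega> - f n \<omega>))\<^sup>2 \<partial>M)"
        by (rule integral_mono)
           (use L2_norm_integrable[OF L] L2_norm_integrable[OF L1] L2_norm_integrable[OF L2'] L2_norm_integrable[OF L2_flow[OF L1]] pt in auto)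
      also have "\<dots> = 2 * (\<integral>\<omega>. (norm (F (\<theta> z \<omega>) - f n (\<theta> z \<omega>)))\<^sup>2 \<partial>M) + 4 * (\<integral>\<omega>. (norm (f n (\<theta> z \<omega>) - f n \<omega>))\<^sup>2 \<partial>M) + 4 * (\<integral>\<omega>. (norm (F \<omega> - f n \<omega>))\<^sup>2 \<partial>M)"
        using L2_norm_integrable[OF L1] L2_norm_integrable[OF L2'] L2_norm_integrable[OF L2_flow[OF L1]] by simp
      finally show ?thesis using b2 b3 FN[of n] by linarith
    qed
    then have "(\<integral>\<omega>. (norm (F (\<theta> z \<omega>) - F \<omega>))\<^sup>2 \<partial>M) \<le> 0"
      by (intro LIMSEQ_le_const[OF lim0[of 10]]) auto
    then have "(\<integral>\<omega>. (norm (F (\<theta> z \<omega>) - F \<omega>))\<^sup>2 \<partial>M) = 0" by (intro antisym) auto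
    then have "AE \<omega> in M. (norm (F (\<theta> z \<omega>) - F \<omega>))\<^sup>2 = 0"
      using integral_nonneg_eq_0_iff_AE[OF L2_norm_integrable[OF L]] by simp
    then show ?thesis by simp
  qed
  have "(\<integral>\<omega>. F \<omega> $ i \<partial>M) = 0" for i
  proof -
    have "\<bar>\<integral>\<omega>. F \<omega> $ i \<partial>M\<bar> \<le> (1/2) ^ n" for n
    proof -
      have L1: "L2 M (\<lambda>\<omega>. F \<omega> - f n \<omega>)" by (rule L2_diff[OF F WL[OF Wf]])
      have "(\<integral>\<omega>. F \<omega> $ i \<partial>M) = (\<integral>\<omega>. (F \<omega> - f n \<omega>) $ i \<partial>M)"
        using comp_int[OF F, of i] comp_int[OF WL[OF Wf], of n i] Wf[of n] by (simp add: W_def)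
      also have "\<bar>\<dots>\<bar> \<le> (\<integral>\<omega>. norm ((F \<omega> - f n \<omega>) $ i) \<partial>M)"
        using integral_norm_bound[of M "\<lambda>\<omega>. (F \<omega> - f n \<omega>) $ i"] by simp
      also have "\<dots> \<le> (\<integral>\<omega>. norm (F \<omega> - f n \<omega>) \<partial>M)"
        using comp_int[OF L1, of i] L2_integrable[OF finite_measure_axioms L1]
        by (intro integral_mono) (auto simp: component_le_norm_cart simp del: vector_minus_component)
      also have "\<dots> \<le> sqrt (\<integral>\<omega>. (norm (F \<omega> - f n \<omega>))\<^sup>2 \<partial>M)" by (rule L1_le_L2[OF L1])
      also have "\<dots> \<le> sqrt ((1/4) ^ n)" using FN by (rule real_sqrt_le_mono)
      also have "sqrt ((1/4) ^ n) = (1/2::real) ^ n"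
        by (rule real_sqrt_unique) (auto simp: power_mult_distrib[symmetric] power2_eq_square)
      finally show ?thesis .
    qed
    then have "\<bar>\<integral>\<omega>. F \<omega> $ i \<partial>M\<bar> \<le> 0"
      by (intro LIMSEQ_le_const[OF LIMSEQ_power_zero[of "1/2::real"]]) auto
    then show ?thesis by simp
  qed
  moreover have "AE \<omega> in M. F (\<theta> z \<omega>) $ i = F \<omega> $ i" for z i
    using inv[of z] by eventually_elim simp
  ultimately have "AE \<omega> in M. F \<omega> $ i = 0" for i
    by (intro invariant_mean_zero[OF comp_int[OF F]])
  then have "AE \<omega> in M. \<forall>i\<in>UNIV. F \<omega> $ i = 0" by (intro AE_finite_allI) auto
  then have F0: "AE \<omega> in M. F \<omega> = 0" by eventually_elim (simp add: vec_eq_iff)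
  \<comment> \<open>As F = 0, the fields f n themselves tend to 0, and f n is the error made by the
    gradient G - f n.\<close>
  obtain n where n: "(1/4::real) ^ n < \<epsilon>" using real_arch_pow_inv[OF \<open>0 < \<epsilon>\<close>, of "1/4"] by auto
  obtain X where X: "H1 X (\<lambda>\<omega>. G \<omega> - f n \<omega>)" using Wf[of n] by (auto simp: W_def)
  have "(\<integral>\<omega>. (norm (G \<omega> - (G \<omega> - f n \<omega>)))\<^sup>2 \<partial>M) = (\<integral>\<omega>. (norm (F \<omega> - f n \<omega>))\<^sup>2 \<partial>M)"
    by (rule integral_cong_AE)
       (use L2_measurable[OF WL[OF Wf[of n]]] L2_measurable[OF F] L2_measurable[OF G] F0 in auto)
  then show ?thesis using that[OF X] FN[of n] n by simp
qed

end

subsection \<open>Integrability of the regularized correctors\<close>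

context ergodic_flow
begin

text \<open>By ergodicity one deterministic n bounds the local integrals around all centres almost
  surely. Tonelli and stationarity turn this bound, for the ball at 0, into |B_1| E[q] \<le>
  n.\<close>

lemma integrable_of_uniform_local_bound:
  fixes q :: "'w \<Rightarrow> real"
  assumes q[measurable]: "q \<in> borel_measurable M" and q0: "\<And>\<omega>. 0 \<le> q \<omega>"
    and bdd: "AE \<omega> in M. \<exists>C. \<forall>x. (\<integral>\<^sup>+y. indicator (ball x 1) y * ennreal (q (\<theta> y \<omega>)) \<partial>lborel) \<le> ennreal C"
  shows "integrable M q"
proof -
  interpret P: pair_sigma_finite lborel M ..
  have qj[measurable]: "(\<lambda>(x, \<omega>). q (\<theta> x \<omega>)) \<in> borel_measurable (lborel \<Otimes>\<^sub>M M)" by (rule flow_joint_comp[OF q])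
  have [measurable]: "(\<lambda>(\<omega>, x). q (\<theta> x \<omega>)) \<in> borel_measurable (M \<Otimes>\<^sub>M lborel)"
    using measurable_pair_swap[OF flow_joint_comp[OF q]] by (simp add: split_beta')
  have [measurable]: "ball (x::real^'d) 1 \<in> sets borel" for x by (intro borel_open open_ball)
  define I where "I x \<omega> = (\<integral>\<^sup>+y. indicator (ball x 1) y * ennreal (q (\<theta> y \<omega>)) \<partial>lborel)" for x \<omega>
  have [measurable]: "I x \<in> borel_measurable M" for x unfolding I_def by measurable
  have path: "(\<lambda>x. q (\<theta> x \<omega>)) \<in> borel_measurable borel" if "\<omega> \<in> space M" for \<omega>
    using flow_path_measurable[OF q that] by simp
  have I_flow: "I x (\<theta> z \<omega>) = I (x + z) \<omega>" if \<omega>: "\<omega> \<in> space M" for x z \<omega>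
  proof -
    note [measurable] = path[OF \<omega>]
    have "I x (\<theta> z \<omega>) = (\<integral>\<^sup>+y. indicator (ball (x + z) 1) (z + y) * ennreal (q (\<theta> (z + y) \<omega>)) \<partial>lborel)"
      unfolding I_def by (intro nn_integral_cong) (auto simp: flow_add[OF \<omega>] add.commute indicator_def dist_norm)
    also have "\<dots> = (\<integral>\<^sup>+y. indicator (ball (x + z) 1) y * ennreal (q (\<theta> y \<omega>)) \<partial>distr lborel borel ((+) z))"
      by (rule nn_integral_distr[symmetric]) measurable
    also have "\<dots> = I (x + z) \<omega>" by (simp add: lborel_distr_plus I_def)
    finally show ?thesis .
  qed
  obtain D :: "(real^'d) set" where D: "countable D" "\<And>X. open X \<Longrightarrow> X \<noteq> {} \<Longrightarrow> \<exists>d\<in>D. d \<in> X"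
    using countable_dense_exists by blast
  \<comment> \<open>Lower semicontinuity of the local integral in the centre makes the uncountable supremum measurable.\<close>
  have dense: "I x \<omega> \<le> c" if \<omega>: "\<omega> \<in> space M" and c: "\<forall>d\<in>D. I d \<omega> \<le> c" for x \<omega> c
  proof -
    note [measurable] = path[OF \<omega>]
    have "\<exists>d\<in>D. d \<in> ball x (1 / real (Suc k))" for k using D(2)[of "ball x (1 / real (Suc k))"] by simp
    then obtain d where d: "\<And>k. d k \<in> D" "\<And>k. d k \<in> ball x (1 / real (Suc k))" by metis
    have dx: "d \<longlonglongrightarrow> x"
    proof (rule metric_LIMSEQ_I)
      fix r :: real assume "0 < r"
      then obtain n where n: "1 / real (Suc n) < r" using nat_approx_posE by blast
      have "dist (d k) x < r" if "k \<ge> n" for k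
      proof -
        have "1 / real (Suc k) \<le> 1 / real (Suc n)" using that by (simp add: frac_le)
        then show ?thesis using d(2)[of k] n by (simp add: dist_commute)
      qed
      then show "\<exists>no. \<forall>n\<ge>no. dist (d n) x < r" by blast
    qed
    have "I x \<omega> \<le> (\<integral>\<^sup>+y. liminf (\<lambda>k. indicator (ball (d k) 1) y * ennreal (q (\<theta> y \<omega>))) \<partial>lborel)"
      unfolding I_def
    proof (rule nn_integral_mono)
      fix y
      show "indicator (ball x 1) y * ennreal (q (\<theta> y \<omega>)) \<le> liminf (\<lambda>k. indicator (ball (d k) 1) y * ennreal (q (\<theta> y \<omega>)))"
      proof (cases "y \<in> ball x 1")
        case True
        have "(\<lambda>k. dist (d k) y) \<longlonglongrightarrow> dist x y" by (intro tendsto_intros dx)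
        from order_tendstoD(2)[OF this, of 1] True
        have "\<forall>\<^sub>F k in sequentially. y \<in> ball (d k) 1" by simp
        then have "\<forall>\<^sub>F k in sequentially. ennreal (q (\<theta> y \<omega>)) \<le> indicator (ball (d k) 1) y * ennreal (q (\<theta> y \<omega>))"
          by eventually_elim simp
        from Liminf_mono[OF this] True show ?thesis by (simp add: Liminf_const)
      qed simp
    qed
    also have "\<dots> \<le> liminf (\<lambda>k. I (d k) \<omega>)"
      unfolding I_def by (rule nn_integral_liminf) measurable
    also have "\<dots> \<le> liminf (\<lambda>k. c)" by (rule Liminf_mono) (use c d(1) in auto)
    also have "\<dots> = c" by (simp add: Liminf_const)
    finally show ?thesis .
  qed
  define E where "E n = {\<omega> \<in> space M. \<forall>d\<in>D. I d \<omega> \<le> ennreal (real n)}" for n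
  have E[measurable]: "E n \<in> sets M" for n unfolding E_def using D(1) by measurable
  \<comment> \<open>The dense set D is not stable under translations, so the bound is first extended
    from D to all centres; this gives strict invariance.\<close>
  have inv: "\<theta> x -` E n \<inter> space M = E n" for x n
  proof (intro set_eqI iffI)
    fix \<omega> assume "\<omega> \<in> \<theta> x -` E n \<inter> space M"
    then have \<omega>: "\<omega> \<in> space M" and "\<forall>d\<in>D. I d (\<theta> x \<omega>) \<le> ennreal (real n)" by (auto simp: E_def)
    then have "I (d - x) (\<theta> x \<omega>) \<le> ennreal (real n)" for d using dense[OF flow_space[OF \<omega>]] by blast
    then show "\<omega> \<in> E n" using \<omega> by (simp add: E_def I_flow)
  next
    fix \<omega> assume "\<omega> \<in> E n"
    then have \<omega>: "\<omega> \<in> space M" and "\<forall>d\<in>D. I d \<omega> \<le> ennreal (real n)" by (auto simp: E_def)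
    then have "I d \<omega> \<le> ennreal (real n)" for d using dense[OF \<omega>] by blast
    then show "\<omega> \<in> \<theta> x -` E n \<inter> space M" using \<omega> by (simp add: E_def I_flow flow_space)
  qed
  have 01: "prob (E n) = 0 \<or> prob (E n) = 1" for n
    by (rule invariant_prob[OF E inv])
  have "\<exists>n. prob (E n) = 1"
  proof (rule ccontr)
    assume "\<not> ?thesis"
    then have "prob (E n) = 0" for n using 01[of n] by blast
    then have "AE \<omega> in M. \<omega> \<notin> E n" for n using prob_eq_0[OF E] by blast
    then have "AE \<omega> in M. \<forall>n. \<omega> \<notin> E n" by (simp add: AE_all_countable)
    then have "AE \<omega> in M. False"
      using bdd AE_space
    proof eventually_elim
      case (elim \<omega>)
      then obtain C where C: "\<And>x. I x \<omega> \<le> ennreal C" by (auto simp: I_def)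
      obtain n where n: "C \<le> real n" using real_arch_simple by blast
      have "\<omega> \<in> E n" using elim(3) C order_trans[OF C ennreal_leI[OF n]] by (simp add: E_def)
      then show False using elim(1) by blast
    qed
    then show False using AE_False by simp
  qed
  then obtain n where "prob (E n) = 1" ..
  then have "AE \<omega> in M. \<omega> \<in> E n" using prob_eq_1[OF E] by blast
  then have "AE \<omega> in M. I 0 \<omega> \<le> ennreal (real n)"
    by eventually_elim (use dense in \<open>auto simp: E_def\<close>)
  then have "(\<integral>\<^sup>+\<omega>. I 0 \<omega> \<partial>M) \<le> (\<integral>\<^sup>+\<omega>. ennreal (real n) \<partial>M)" by (rule nn_integral_mono_AE)
  also have "\<dots> < \<infinity>" by (simp add: emeasure_space_1 ennreal_mult_less_top)
  finally have fin: "(\<integral>\<^sup>+\<omega>. I 0 \<omega> \<partial>M) < \<infinity>" .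
  have "(\<integral>\<^sup>+\<omega>. I 0 \<omega> \<partial>M) = (\<integral>\<^sup>+y. (\<integral>\<^sup>+\<omega>. indicator (ball 0 1) y * ennreal (q (\<theta> y \<omega>)) \<partial>M) \<partial>lborel)"
    unfolding I_def by (rule P.Fubini') measurable
  also have "\<dots> = (\<integral>\<^sup>+y. indicator (ball 0 1) (y::real^'d) * (\<integral>\<^sup>+\<omega>. ennreal (q \<omega>) \<partial>M) \<partial>lborel)"
  proof (rule nn_integral_cong)
    fix y :: "real^'d"
    have "(\<integral>\<^sup>+\<omega>. ennreal (q (\<theta> y \<omega>)) \<partial>M) = (\<integral>\<^sup>+\<omega>. ennreal (q \<omega>) \<partial>distr M M (\<theta> y))"
      by (rule nn_integral_distr[symmetric]) measurable
    then show "(\<integral>\<^sup>+\<omega>. indicator (ball 0 1) y * ennreal (q (\<theta> y \<omega>)) \<partial>M) = indicator (ball 0 1) y * (\<integral>\<^sup>+\<omega>. ennreal (q \<omega>) \<partial>M)"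
      by (simp add: nn_integral_cmult flow_distr)
  qed
  also have "\<dots> = emeasure lborel (ball (0::real^'d) 1) * (\<integral>\<^sup>+\<omega>. ennreal (q \<omega>) \<partial>M)"
    by (simp add: nn_integral_multc)
  finally have "emeasure lborel (ball (0::real^'d) 1) * (\<integral>\<^sup>+\<omega>. ennreal (q \<omega>) \<partial>M) < \<infinity>" using fin by simp
  moreover have "emeasure lborel (ball (0::real^'d) 1) \<noteq> 0"
    using content_ball_pos[of 1 "0::real^'d"] by (auto simp: measure_def)
  ultimately have "(\<integral>\<^sup>+\<omega>. ennreal (q \<omega>) \<partial>M) < \<infinity>"
    by (auto simp: ennreal_mult_less_top)
  then show ?thesis using q q0 by (intro integrableI_bounded) auto
qed

lemma reg_corrector_L2:
  assumes "is_reg_corrector M \<theta> A T \<xi> \<Phi> G"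
  shows "L2 M \<Phi>" "L2 M G"
proof -
  have [measurable]: "\<Phi> \<in> borel_measurable M" "G \<in> borel_measurable M"
    using assms by (auto simp: is_reg_corrector_def)
  let ?q = "\<lambda>\<omega>. (\<Phi> \<omega>)\<^sup>2 + (norm (G \<omega>))\<^sup>2"
  have ae: "AE \<omega> in M. weak_grad (\<lambda>x. \<Phi> (\<theta> x \<omega>)) (\<lambda>x. G (\<theta> x \<omega>)) \<and>
        bdd_above (range (\<lambda>x. set_lebesgue_integral lborel (ball x 1) (\<lambda>y. (\<Phi> (\<theta> y \<omega>))\<^sup>2 + (norm (G (\<theta> y \<omega>)))\<^sup>2)))"
    using assms unfolding is_reg_corrector_def by (auto elim: eventually_mono)
  have "integrable M ?q"
  proof (rule integrable_of_uniform_local_bound)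
    show "AE \<omega> in M. \<exists>C. \<forall>x. (\<integral>\<^sup>+y. indicator (ball x 1) y * ennreal (?q (\<theta> y \<omega>)) \<partial>lborel) \<le> ennreal C"
      using ae
    proof eventually_elim
      case (elim \<omega>)
      then obtain C where C: "\<And>x. set_lebesgue_integral lborel (ball x 1) (\<lambda>y. ?q (\<theta> y \<omega>)) \<le> C"
        by (auto simp: bdd_above_def)
      have "(\<integral>\<^sup>+y. indicator (ball x 1) y * ennreal (?q (\<theta> y \<omega>)) \<partial>lborel) \<le> ennreal C" for x
      proof -
        \<comment> \<open>A Bochner integral is 0 for a non-integrable function, so the assumed
          bound has content only together with the local square integrability contained in
          \<open>weak_grad\<close>.\<close>
        have "set_integrable lborel (cball x 1) (\<lambda>y. ?q (\<theta> y \<omega>))"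
          using elim compact_cball unfolding weak_grad_def by (intro set_integral_add) auto
        then have "set_integrable lborel (ball x 1) (\<lambda>y. ?q (\<theta> y \<omega>))"
          by (rule set_integrable_subset) auto
        then have "(\<integral>\<^sup>+y. ennreal (indicator (ball x 1) y *\<^sub>R ?q (\<theta> y \<omega>)) \<partial>lborel) = ennreal (\<integral>y. indicator (ball x 1) y *\<^sub>R ?q (\<theta> y \<omega>) \<partial>lborel)"
          unfolding set_integrable_def by (intro nn_integral_eq_integral) auto
        moreover have "ennreal (indicator (ball x 1) y *\<^sub>R ?q (\<theta> y \<omega>)) = indicator (ball x 1) y * ennreal (?q (\<theta> y \<omega>))" for y
          by (simp add: indicator_def)
        ultimately show ?thesis using C[of x] by (simp add: set_lebesgue_integral_def ennreal_leI)
      qed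
      then show ?case by blast
    qed
  qed auto
  then have "integrable M (\<lambda>\<omega>. (norm (\<Phi> \<omega>))\<^sup>2)" "integrable M (\<lambda>\<omega>. (norm (G \<omega>))\<^sup>2)"
    by (auto intro: Bochner_Integration.integrable_bound[of M ?q])
  then show "L2 M \<Phi>" "L2 M G" by (auto simp: L2_def)
qed

end

subsection \<open>Convergence\<close>

lemma Mab_bound:
  assumes "B \<in> Mab \<alpha> \<beta>"
  shows "norm (B *v x) \<le> \<beta> * norm x" "\<alpha> * (norm x)\<^sup>2 \<le> x \<bullet> (B *v x)"
  using assms by (auto simp: Mab_def)

text \<open>Coercivity only concerns the quadratic form, which B and its transpose share. The upper
  bound follows from |B^T x|^2 = x . B (B^T x) \<le> \<beta> |x| |B^T x|.\<close>

lemma Mab_transpose: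
  assumes "B \<in> Mab \<alpha> \<beta>"
  shows "transpose B \<in> Mab \<alpha> \<beta>"
  unfolding Mab_def mem_Collect_eq
proof (intro allI conjI)
  fix x
  have "x \<bullet> (transpose B *v x) = x \<bullet> (B *v x)"
    by (metis dot_lmul_matrix inner_commute transpose_matrix_vector)
  then show "x \<bullet> (transpose B *v x) \<ge> \<alpha> * (norm x)\<^sup>2" using Mab_bound(2)[OF assms] by simp
  let ?y = "transpose B *v x"
  have "(norm ?y)\<^sup>2 = x \<bullet> (B *v ?y)"
    by (metis dot_lmul_matrix power2_norm_eq_inner transpose_matrix_vector)
  also have "\<dots> \<le> norm x * norm (B *v ?y)" by (rule norm_cauchy_schwarz)
  also have "\<dots> \<le> norm x * (\<beta> * norm ?y)" by (intro mult_left_mono Mab_bound[OF assms]) simp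
  finally have "norm ?y * norm ?y \<le> (\<beta> * norm x) * norm ?y" by (simp add: power2_eq_square mult_ac)
  then show "norm ?y \<le> \<beta> * norm x"
  proof (cases "norm ?y = 0")
    case True
    have "0 \<le> \<beta> * norm x" using Mab_bound(1)[OF assms, of x] norm_ge_zero order_trans by blast
    then show ?thesis using True by simp
  qed (auto dest: mult_right_le_imp_le)
qed

lemma borel_measurable_matrix_vector_mult:
  fixes A :: "'w \<Rightarrow> real^'d::finite^'d"
  assumes "A \<in> borel_measurable M" "f \<in> borel_measurable M"
  shows "(\<lambda>\<omega>. A \<omega> *v f \<omega>) \<in> borel_measurable M"
proof (rule borel_measurable_continuous_Pair[OF assms])
  show "continuous_on UNIV (\<lambda>x. (fst x :: real^'d^'d) *v snd x)"
    unfolding matrix_vector_mult_def by (intro continuous_intros)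
qed

lemma coeff_field_transpose:
  fixes A :: "'w \<Rightarrow> real^'d::finite^'d"
  assumes "coeff_field M \<alpha> \<beta> A"
  shows "coeff_field M \<alpha> \<beta> (\<lambda>\<omega>. transpose (A \<omega>))"
proof -
  have "continuous_on UNIV (transpose :: real^'d^'d \<Rightarrow> _)"
    unfolding transpose_def by (intro continuous_intros)
  from measurable_compose[of A M borel, OF _ borel_measurable_continuous_onI[OF this]]
  have "(\<lambda>\<omega>. transpose (A \<omega>)) \<in> borel_measurable M" using assms by (simp add: coeff_field_def)
  moreover have "AE \<omega> in M. A \<omega> \<in> Mab \<alpha> \<beta>" using assms by (simp add: coeff_field_def)
  then have "AE \<omega> in M. transpose (A \<omega>) \<in> Mab \<alpha> \<beta>" by eventually_elim (rule Mab_transpose)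
  ultimately show ?thesis by (simp add: coeff_field_def)
qed

lemma L2_coeff:
  assumes "coeff_field M \<alpha> \<beta> A" "L2 M f"
  shows "L2 M (\<lambda>\<omega>. A \<omega> *v f \<omega>)"
proof (rule L2_bound[OF assms(2), where C=\<beta>])
  show "(\<lambda>\<omega>. A \<omega> *v f \<omega>) \<in> borel_measurable M"
    using assms by (intro borel_measurable_matrix_vector_mult) (auto simp: coeff_field_def L2_def)
  show "AE \<omega> in M. norm (A \<omega> *v f \<omega>) \<le> \<beta> * norm (f \<omega>)"
    using assms(1) unfolding coeff_field_def by (auto elim!: eventually_mono dest: Mab_bound(1))
qed

lemma coeff_pairing_bound:
  assumes A: "coeff_field M \<alpha> \<beta> A" and \<beta>: "0 \<le> \<beta>" and f: "L2 M f" and g: "L2 M g"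
  shows "\<bar>\<integral>\<omega>. f \<omega> \<bullet> (A \<omega> *v g \<omega>) \<partial>M\<bar> \<le> \<beta> * sqrt (\<integral>\<omega>. (norm (f \<omega>))\<^sup>2 \<partial>M) * sqrt (\<integral>\<omega>. (norm (g \<omega>))\<^sup>2 \<partial>M)"
proof -
  note Ag = L2_coeff[OF A g]
  have "(\<integral>\<omega>. (norm (A \<omega> *v g \<omega>))\<^sup>2 \<partial>M) \<le> (\<integral>\<omega>. \<beta>\<^sup>2 * (norm (g \<omega>))\<^sup>2 \<partial>M)"
  proof (rule integral_mono_AE)
    show "AE \<omega> in M. (norm (A \<omega> *v g \<omega>))\<^sup>2 \<le> \<beta>\<^sup>2 * (norm (g \<omega>))\<^sup>2"
      using A unfolding coeff_field_def
      by (auto elim!: eventually_mono simp: power_mult_distrib[symmetric] intro!: power_mono Mab_bound(1))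
  qed (use L2_norm_integrable[OF Ag] L2_norm_integrable[OF g] in auto)
  then have "sqrt (\<integral>\<omega>. (norm (A \<omega> *v g \<omega>))\<^sup>2 \<partial>M) \<le> sqrt (\<beta>\<^sup>2 * (\<integral>\<omega>. (norm (g \<omega>))\<^sup>2 \<partial>M))" by simp
  also have "\<dots> = \<beta> * sqrt (\<integral>\<omega>. (norm (g \<omega>))\<^sup>2 \<partial>M)" using \<beta> by (simp add: real_sqrt_mult)
  finally have "sqrt (\<integral>\<omega>. (norm (f \<omega>))\<^sup>2 \<partial>M) * sqrt (\<integral>\<omega>. (norm (A \<omega> *v g \<omega>))\<^sup>2 \<partial>M)
     \<le> sqrt (\<integral>\<omega>. (norm (f \<omega>))\<^sup>2 \<partial>M) * (\<beta> * sqrt (\<integral>\<omega>. (norm (g \<omega>))\<^sup>2 \<partial>M))"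
    by (intro mult_left_mono) auto
  with L2_Cauchy_Schwarz[OF f Ag] show ?thesis by (simp add: mult_ac)
qed

section \<open>The energy estimate and the limit of large T\<close>

context ergodic_flow
begin

lemma corrector_L2:
  assumes "is_corrector M \<theta> A \<xi> \<phi> G"
  shows "L2 M G"
  using assms by (simp add: is_corrector_def L2_def)

lemma corrector_approximation:
  assumes corr: "is_corrector M \<theta> A \<xi> \<phi> G" and "0 < \<epsilon>"
  obtains X DX where "H1 X DX" "(\<integral>\<omega>. (norm (G \<omega> - DX \<omega>))\<^sup>2 \<partial>M) < \<epsilon>"
proof -
  have G: "L2 M G" by (rule corrector_L2[OF corr])
  have "(\<integral>\<omega>. G \<omega> $ i \<partial>M) = 0" for i
  proof -
    have "integrable M G" "(\<integral>\<omega>. G \<omega> \<partial>M) = 0" using corr by (auto simp: is_corrector_def)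
    then show ?thesis using integral_bounded_linear[OF bounded_linear_vec_nth, of M G i] by simp
  qed
  moreover have "AE \<omega> in M. weak_grad (\<lambda>x. \<phi> x \<omega>) (\<lambda>x. G (\<theta> x \<omega>))"
    using corr unfolding is_corrector_def by (auto elim: eventually_mono)
  from gradient_increment[OF G curl_free_of_weak_grad[OF G this]]
  have "\<exists>X. H1 X (\<lambda>\<omega>. G (\<theta> z \<omega>) - G \<omega>)" for z .
  ultimately show ?thesis using gradient_approximation[OF G _ _ \<open>0 < \<epsilon>\<close>] that by blast
qed

text \<open>Test the difference of the two equations with \<open>\<Phi> - X\<close>: only \<^term>\<open>X\<close> has to be square integrable,
  the corrector itself does not.\<close>

lemma reg_corrector_error:
  assumes \<alpha>: "0 < \<alpha>" and A: "coeff_field M \<alpha> \<beta> A" and T: "0 < T"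
    and corr: "is_corrector M \<theta> A \<xi> \<phi> G" and reg: "is_reg_corrector M \<theta> A T \<xi> \<Phi> H" and X: "H1 X DX"
  shows "(\<integral>\<omega>. (norm (H \<omega> - G \<omega>))\<^sup>2 \<partial>M) \<le>
    (\<integral>\<omega>. (X \<omega>)\<^sup>2 \<partial>M) / (2 * \<alpha>) / T + (\<beta>\<^sup>2 / \<alpha>\<^sup>2) * (\<integral>\<omega>. (norm (G \<omega> - DX \<omega>))\<^sup>2 \<partial>M)"
proof -
  note \<Phi> = reg_corrector_L2(1)[OF reg] and H = reg_corrector_L2(2)[OF reg] and G = corrector_L2[OF corr]
  note LX = H1_L2[OF X]
  let ?e = "\<lambda>\<omega>. H \<omega> - G \<omega>" and ?b = "\<lambda>\<omega>. G \<omega> - DX \<omega>" and ?Y = "\<lambda>\<omega>. \<Phi> \<omega> - X \<omega>" and ?DY = "\<lambda>\<omega>. H \<omega> - DX \<omega>"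
  have "AE \<omega> in M. weak_grad (\<lambda>x. \<Phi> (\<theta> x \<omega>)) (\<lambda>x. H (\<theta> x \<omega>))"
    using reg unfolding is_reg_corrector_def by (auto elim: eventually_mono)
  from H1_diff[OF H1_of_weak_grad[OF \<Phi> H this] X] have Y: "H1 ?Y ?DY" .
  have e: "L2 M ?e" and b: "L2 M ?b" by (intro L2_diff H G LX)+
  have c: "L2 M (\<lambda>\<omega>. \<xi> + f \<omega>)" if "L2 M f" for f by (rule L2_add[OF L2_const[OF finite_measure_axioms] that])
  have FH: "L2 M (\<lambda>\<omega>. A \<omega> *v (\<xi> + H \<omega>))" and FG: "L2 M (\<lambda>\<omega>. A \<omega> *v (\<xi> + G \<omega>))"
    by (intro L2_coeff[OF A] c H G)+
  have eqT: "(1 / T) * (\<integral>\<omega>. \<Phi> \<omega> * ?Y \<omega> \<partial>M) + (\<integral>\<omega>. ?DY \<omega> \<bullet> (A \<omega> *v (\<xi> + H \<omega>)) \<partial>M) = 0"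
    by (rule weak_equation_pairing[OF \<Phi> FH Y])
       (use reg in \<open>auto simp: is_reg_corrector_def elim: eventually_mono\<close>)
  \<comment> \<open>The corrector equation has no term of order zero, hence the factor 0.\<close>
  have eq0: "0 * (\<integral>\<omega>. \<Phi> \<omega> * ?Y \<omega> \<partial>M) + (\<integral>\<omega>. ?DY \<omega> \<bullet> (A \<omega> *v (\<xi> + G \<omega>)) \<partial>M) = 0"
    by (rule weak_equation_pairing[OF \<Phi> FG Y])
       (use corr in \<open>auto simp: is_corrector_def elim: eventually_mono\<close>)
  have Ae: "A \<omega> *v (\<xi> + H \<omega>) - A \<omega> *v (\<xi> + G \<omega>) = A \<omega> *v ?e \<omega>" for \<omega>
    by (simp add: matrix_vector_mult_diff_distrib[symmetric])
  have "(\<integral>\<omega>. ?DY \<omega> \<bullet> (A \<omega> *v ?e \<omega>) \<partial>M) = (\<integral>\<omega>. ?DY \<omega> \<bullet> (A \<omega> *v (\<xi> + H \<omega>)) - ?DY \<omega> \<bullet> (A \<omega> *v (\<xi> + G \<omega>)) \<partial>M)"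
    by (simp only: Ae[symmetric] inner_diff_right)
  also have "\<dots> = (\<integral>\<omega>. ?DY \<omega> \<bullet> (A \<omega> *v (\<xi> + H \<omega>)) \<partial>M) - (\<integral>\<omega>. ?DY \<omega> \<bullet> (A \<omega> *v (\<xi> + G \<omega>)) \<partial>M)"
    by (intro Bochner_Integration.integral_diff L2_inner_integrable FH FG H1_L2(2)[OF Y])
  finally have main: "(1 / T) * (\<integral>\<omega>. \<Phi> \<omega> * ?Y \<omega> \<partial>M) + (\<integral>\<omega>. ?DY \<omega> \<bullet> (A \<omega> *v ?e \<omega>) \<partial>M) = 0"
    using eqT eq0 by simp
  have iX: "integrable M (\<lambda>\<omega>. (X \<omega>)\<^sup>2)" using L2_norm_integrable[OF LX(1)] by simp
  have ie: "integrable M (\<lambda>\<omega>. (norm (?e \<omega>))\<^sup>2)" and ib: "integrable M (\<lambda>\<omega>. (norm (?b \<omega>))\<^sup>2)"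
    by (intro L2_norm_integrable e b)+
  \<comment> \<open>Completing the square, \<Phi> (\<Phi> - X) = (\<Phi> - X/2)^2 - X^2/4, removes
    the unknown size of \<Phi>.\<close>
  have "(\<integral>\<omega>. - (1/4) * (X \<omega>)\<^sup>2 \<partial>M) \<le> (\<integral>\<omega>. \<Phi> \<omega> * ?Y \<omega> \<partial>M)"
  proof (rule integral_mono)
    fix \<omega>
    have "0 \<le> (\<Phi> \<omega> - X \<omega> / 2)\<^sup>2" by simp
    then show "- (1/4) * (X \<omega>)\<^sup>2 \<le> \<Phi> \<omega> * ?Y \<omega>" by (simp add: power2_eq_square field_simps)
  qed (use iX L2_mult_integrable[OF \<Phi> H1_L2(1)[OF Y]] in auto)
  then have "- (1/4) * (\<integral>\<omega>. (X \<omega>)\<^sup>2 \<partial>M) \<le> (\<integral>\<omega>. \<Phi> \<omega> * ?Y \<omega> \<partial>M)" by simp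
  from mult_left_mono[OF this, of "1 / T"] T
  have p1: "- (\<integral>\<omega>. (X \<omega>)\<^sup>2 \<partial>M) / (4 * T) \<le> (1 / T) * (\<integral>\<omega>. \<Phi> \<omega> * ?Y \<omega> \<partial>M)" by simp
  \<comment> \<open>Split \<open>?DY\<close> into \<open>?e\<close> plus \<open>?b\<close>.
    Coercivity gives \<alpha> |e|^2, and Young's inequality spends half of it on the cross term with
    b.\<close>
  have "(\<integral>\<omega>. (\<alpha> / 2) * (norm (?e \<omega>))\<^sup>2 - (\<beta>\<^sup>2 / (2 * \<alpha>)) * (norm (?b \<omega>))\<^sup>2 \<partial>M) \<le> (\<integral>\<omega>. ?DY \<omega> \<bullet> (A \<omega> *v ?e \<omega>) \<partial>M)"
  proof (rule integral_mono_AE)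
    have "AE \<omega> in M. A \<omega> \<in> Mab \<alpha> \<beta>" using A by (simp add: coeff_field_def)
    then show "AE \<omega> in M. (\<alpha> / 2) * (norm (?e \<omega>))\<^sup>2 - (\<beta>\<^sup>2 / (2 * \<alpha>)) * (norm (?b \<omega>))\<^sup>2 \<le> ?DY \<omega> \<bullet> (A \<omega> *v ?e \<omega>)"
    proof eventually_elim
      case (elim \<omega>)
      let ?x = "norm (?e \<omega>)" and ?y = "norm (?b \<omega>)"
      have "?DY \<omega> \<bullet> (A \<omega> *v ?e \<omega>) = ?e \<omega> \<bullet> (A \<omega> *v ?e \<omega>) + ?b \<omega> \<bullet> (A \<omega> *v ?e \<omega>)"
        by (simp add: inner_add_left[symmetric])
      moreover have "\<alpha> * ?x\<^sup>2 \<le> ?e \<omega> \<bullet> (A \<omega> *v ?e \<omega>)" by (rule Mab_bound(2)[OF elim])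
      moreover have "\<bar>?b \<omega> \<bullet> (A \<omega> *v ?e \<omega>)\<bar> \<le> ?y * (\<beta> * ?x)"
        using Cauchy_Schwarz_ineq2[of "?b \<omega>" "A \<omega> *v ?e \<omega>"] mult_left_mono[OF Mab_bound(1)[OF elim, of "?e \<omega>"], of ?y] by simp
      moreover have "?y * (\<beta> * ?x) \<le> (\<alpha> / 2) * ?x\<^sup>2 + (\<beta>\<^sup>2 / (2 * \<alpha>)) * ?y\<^sup>2"
      proof -
        have "0 \<le> (\<alpha> * ?x - \<beta> * ?y)\<^sup>2 / (2 * \<alpha>)" using \<alpha> by simp
        also have "\<dots> = (\<alpha> / 2) * ?x\<^sup>2 + (\<beta>\<^sup>2 / (2 * \<alpha>)) * ?y\<^sup>2 - ?y * (\<beta> * ?x)"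
          using \<alpha> by (simp add: power2_eq_square field_simps)
        finally show ?thesis by simp
      qed
      ultimately show ?case by linarith
    qed
  qed (use ie ib L2_inner_integrable[OF H1_L2(2)[OF Y] L2_coeff[OF A e]] in auto)
  then have "(\<alpha> / 2) * (\<integral>\<omega>. (norm (?e \<omega>))\<^sup>2 \<partial>M) - (\<beta>\<^sup>2 / (2 * \<alpha>)) * (\<integral>\<omega>. (norm (?b \<omega>))\<^sup>2 \<partial>M) \<le> (\<integral>\<omega>. ?DY \<omega> \<bullet> (A \<omega> *v ?e \<omega>) \<partial>M)"
    using ie ib by simp
  with main p1 have "(\<alpha> / 2) * (\<integral>\<omega>. (norm (?e \<omega>))\<^sup>2 \<partial>M) \<le> (\<integral>\<omega>. (X \<omega>)\<^sup>2 \<partial>M) / (4 * T) + (\<beta>\<^sup>2 / (2 * \<alpha>)) * (\<integral>\<omega>. (norm (?b \<omega>))\<^sup>2 \<partial>M)"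
    by simp
  from mult_left_mono[OF this, of "2 / \<alpha>"] \<alpha> show ?thesis
    by (simp add: field_simps power2_eq_square)
qed

lemma reg_corrector_tendsto:
  assumes \<alpha>: "0 < \<alpha>" and A: "coeff_field M \<alpha> \<beta> A"
    and corr: "is_corrector M \<theta> A \<xi> \<phi> G" and reg: "\<And>T. T > 0 \<Longrightarrow> is_reg_corrector M \<theta> A T \<xi> (\<Phi> T) (H T)"
  shows "((\<lambda>T. \<integral>\<omega>. (norm (H T \<omega> - G \<omega>))\<^sup>2 \<partial>M) \<longlongrightarrow> 0) at_top"
proof (rule order_tendstoI)
  fix a :: real assume "a < 0"
  then have "a < (\<integral>\<omega>. (norm (H T \<omega> - G \<omega>))\<^sup>2 \<partial>M)" for T
    by (rule less_le_trans) simp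
  then show "\<forall>\<^sub>F T in at_top. a < (\<integral>\<omega>. (norm (H T \<omega> - G \<omega>))\<^sup>2 \<partial>M)" by simp
next
  fix a :: real assume a: "0 < a"
  define c where "c = \<beta>\<^sup>2 / \<alpha>\<^sup>2"
  have c0: "0 \<le> c" by (simp add: c_def)
  \<comment> \<open>The denominator c + 1 leaves the error c a / (c + 1) strictly below a and also
    covers c = 0; the gap is what the term decaying in T may use.\<close>
  then have "0 < a / (c + 1)" using a by simp
  then obtain X DX where X: "H1 X DX" and b: "(\<integral>\<omega>. (norm (G \<omega> - DX \<omega>))\<^sup>2 \<partial>M) < a / (c + 1)"
    using corrector_approximation[OF corr] by metis
  let ?b = "\<integral>\<omega>. (norm (G \<omega> - DX \<omega>))\<^sup>2 \<partial>M" and ?K = "(\<integral>\<omega>. (X \<omega>)\<^sup>2 \<partial>M) / (2 * \<alpha>)"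
  have "c * ?b \<le> c * (a / (c + 1))" using b c0 by (intro mult_left_mono) auto
  also have "\<dots> < a" using a c0 by (simp add: field_simps)
  finally have "0 + c * ?b < a" by simp
  moreover have "((\<lambda>T. ?K / T + c * ?b) \<longlongrightarrow> 0 + c * ?b) at_top"
    by (intro tendsto_intros tendsto_divide_0[OF tendsto_const] filterlim_at_top_imp_at_infinity[OF filterlim_ident])
  ultimately have "\<forall>\<^sub>F T in at_top. ?K / T + c * ?b < a" by (intro order_tendstoD(2))
  then show "\<forall>\<^sub>F T in at_top. (\<integral>\<omega>. (norm (H T \<omega> - G \<omega>))\<^sup>2 \<partial>M) < a"
    using eventually_gt_at_top[of 0]
  proof eventually_elim
    case (elim T)
    from reg_corrector_error[OF \<alpha> A elim(2) corr reg[OF elim(2)] X] elim(1) show ?case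
      by (simp add: c_def)
  qed
qed

end

section \<open>Richardson extrapolation and the homogenized matrix\<close>

lemma L2_rich:
  assumes "\<And>T. T > 0 \<Longrightarrow> L2 M (f T)" "T > 0"
  shows "L2 M (\<lambda>\<omega>. rich (\<lambda>S. f S \<omega>) k T)"
  using assms(2)
proof (induction k arbitrary: T)
  case 0
  then show ?case using assms(1) by simp
next
  case (Suc k)
  show ?case
  proof (cases k)
    case 0
    then show ?thesis using assms(1) Suc.prems by simp
  next
    case (Suc j)
    have "L2 M (\<lambda>\<omega>. rich (\<lambda>S. f S \<omega>) (Suc j) T')" if "T' > 0" for T' using Suc.IH[OF that] Suc by simp
    then show ?thesis
      unfolding Suc rich.simps using Suc.prems by (intro L2_scaleR L2_diff) auto
  qed
qed

text \<open>One step has the weights a at 2T and -b at T, independent of T and with a - b = 1. The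
  error of the combination is therefore the same combination of errors, and both of them
  vanish.\<close>

lemma rich_tendsto:
  assumes L: "\<And>T. T > 0 \<Longrightarrow> L2 M (f T)" and G: "L2 M G"
    and lim: "((\<lambda>T. \<integral>\<omega>. (norm (f T \<omega> - G \<omega>))\<^sup>2 \<partial>M) \<longlongrightarrow> 0) at_top"
  shows "((\<lambda>T. \<integral>\<omega>. (norm (rich (\<lambda>S. f S \<omega>) k T - G \<omega>))\<^sup>2 \<partial>M) \<longlongrightarrow> 0) at_top"
proof (induction k)
  case 0
  then show ?case using lim by simp
next
  case (Suc k)
  show ?case
  \<comment> \<open>Orders 0 and 1 both return f; the recursion proper begins at order 2.\<close>
  proof (cases k)
    case 0
    then show ?thesis using lim by simp
  next
    case k: (Suc j)
    define r where "r T \<omega> = rich (\<lambda>S. f S \<omega>) (Suc j) T" for T \<omega>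
    have Lr: "L2 M (\<lambda>\<omega>. r T \<omega> - G \<omega>)" if "T > 0" for T
      unfolding r_def by (intro L2_diff L2_rich[OF L that] G)
    define N where "N T = (\<integral>\<omega>. (norm (r T \<omega> - G \<omega>))\<^sup>2 \<partial>M)" for T
    have N: "(N \<longlongrightarrow> 0) at_top" using Suc k by (simp add: N_def[abs_def] r_def)
    have N2: "((\<lambda>T. N (2 * T)) \<longlongrightarrow> 0) at_top"
      by (rule filterlim_compose[OF N]) (rule filterlim_tendsto_pos_mult_at_top[OF tendsto_const _ filterlim_ident], simp)
    define b where "b = 1 / (2 ^ Suc j - 1 :: real)"
    define a where "a = b * 2 ^ Suc j"
    have "(1::real) < 2 ^ Suc j" by (rule one_less_power) auto
    then have "(2 ^ Suc j - 1 :: real) \<noteq> 0" by linarith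
    then have "b * (2 ^ Suc j - 1) = 1" by (simp add: b_def del: power_Suc)
    then have ab: "a - b = 1" by (simp add: a_def right_diff_distrib)
    have eq: "rich (\<lambda>S. f S \<omega>) (Suc k) T - G \<omega> = a *\<^sub>R (r (2 * T) \<omega> - G \<omega>) - b *\<^sub>R (r T \<omega> - G \<omega>)" for T \<omega>
    proof -
      have "a *\<^sub>R G \<omega> - b *\<^sub>R G \<omega> = G \<omega>" using ab by (simp add: scaleR_left_diff_distrib[symmetric])
      then show ?thesis
        unfolding k rich.simps(3) r_def[symmetric] b_def[symmetric] by (simp add: a_def algebra_simps)
    qed
    show ?thesis
    proof (rule tendsto_sandwich)
      show "\<forall>\<^sub>F T in at_top. 0 \<le> (\<integral>\<omega>. (norm (rich (\<lambda>S. f S \<omega>) (Suc k) T - G \<omega>))\<^sup>2 \<partial>M)"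
        by simp
      show "\<forall>\<^sub>F T in at_top. (\<integral>\<omega>. (norm (rich (\<lambda>S. f S \<omega>) (Suc k) T - G \<omega>))\<^sup>2 \<partial>M) \<le> 2 * a\<^sup>2 * N (2 * T) + 2 * b\<^sup>2 * N T"
        using eventually_gt_at_top[of 0]
      proof eventually_elim
        case (elim T)
        then have T2: "2 * T > 0" by simp
        note i = L2_norm_integrable[OF Lr[OF elim]] L2_norm_integrable[OF Lr[OF T2]]
        have "(\<integral>\<omega>. (norm (rich (\<lambda>S. f S \<omega>) (Suc k) T - G \<omega>))\<^sup>2 \<partial>M)
          \<le> (\<integral>\<omega>. 2 * a\<^sup>2 * (norm (r (2 * T) \<omega> - G \<omega>))\<^sup>2 + 2 * b\<^sup>2 * (norm (r T \<omega> - G \<omega>))\<^sup>2 \<partial>M)"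
        proof (rule integral_mono)
          fix \<omega>
          show "(norm (rich (\<lambda>S. f S \<omega>) (Suc k) T - G \<omega>))\<^sup>2 \<le> 2 * a\<^sup>2 * (norm (r (2 * T) \<omega> - G \<omega>))\<^sup>2 + 2 * b\<^sup>2 * (norm (r T \<omega> - G \<omega>))\<^sup>2"
            unfolding eq using norm_sq_diff_le[of "a *\<^sub>R (r (2 * T) \<omega> - G \<omega>)" "b *\<^sub>R (r T \<omega> - G \<omega>)"]
            by (simp add: power_mult_distrib)
        next
          show "integrable M (\<lambda>\<omega>. (norm (rich (\<lambda>S. f S \<omega>) (Suc k) T - G \<omega>))\<^sup>2)"
            by (intro L2_norm_integrable L2_diff L2_rich[OF L elim] G)
        qed (use i in auto)
        also have "\<dots> = 2 * a\<^sup>2 * N (2 * T) + 2 * b\<^sup>2 * N T" using i by (simp add: N_def)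
        finally show ?case .
      qed
      have "((\<lambda>T. 2 * a\<^sup>2 * N (2 * T) + 2 * b\<^sup>2 * N T) \<longlongrightarrow> 2 * a\<^sup>2 * 0 + 2 * b\<^sup>2 * 0) at_top"
        by (intro tendsto_intros N N2)
      then show "((\<lambda>T. 2 * a\<^sup>2 * N (2 * T) + 2 * b\<^sup>2 * N T) \<longlongrightarrow> 0) at_top" by simp
    qed simp
  qed
qed

text \<open>Expanding the bilinear form around F and G leaves three error terms, each with a factor
  that tends to 0.\<close>

lemma coeff_pairing_tendsto:
  assumes A: "coeff_field M \<alpha> \<beta> A" and \<beta>: "0 \<le> \<beta>"
    and L: "\<And>T::real. T > 0 \<Longrightarrow> L2 M (f T)" "\<And>T. T > 0 \<Longrightarrow> L2 M (g T)" and F: "L2 M F" and G: "L2 M G"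
    and limf: "((\<lambda>T. \<integral>\<omega>. (norm (f T \<omega> - F \<omega>))\<^sup>2 \<partial>M) \<longlongrightarrow> 0) at_top"
    and limg: "((\<lambda>T. \<integral>\<omega>. (norm (g T \<omega> - G \<omega>))\<^sup>2 \<partial>M) \<longlongrightarrow> 0) at_top"
  shows "((\<lambda>T. \<integral>\<omega>. f T \<omega> \<bullet> (A \<omega> *v g T \<omega>) \<partial>M) \<longlongrightarrow> (\<integral>\<omega>. F \<omega> \<bullet> (A \<omega> *v G \<omega>) \<partial>M)) at_top"
proof (subst LIM_zero_iff[symmetric], rule Lim_null_comparison)
  define p where "p T = sqrt (\<integral>\<omega>. (norm (f T \<omega> - F \<omega>))\<^sup>2 \<partial>M)" for T
  define q where "q T = sqrt (\<integral>\<omega>. (norm (g T \<omega> - G \<omega>))\<^sup>2 \<partial>M)" for T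
  define NF where "NF = sqrt (\<integral>\<omega>. (norm (F \<omega>))\<^sup>2 \<partial>M)"
  define NG where "NG = sqrt (\<integral>\<omega>. (norm (G \<omega>))\<^sup>2 \<partial>M)"
  show "\<forall>\<^sub>F T in at_top. norm ((\<integral>\<omega>. f T \<omega> \<bullet> (A \<omega> *v g T \<omega>) \<partial>M) - (\<integral>\<omega>. F \<omega> \<bullet> (A \<omega> *v G \<omega>) \<partial>M))
      \<le> \<beta> * p T * q T + \<beta> * p T * NG + \<beta> * NF * q T"
    using eventually_gt_at_top[of 0]
  proof eventually_elim
    case (elim T)
    let ?u = "\<lambda>\<omega>. f T \<omega> - F \<omega>" and ?v = "\<lambda>\<omega>. g T \<omega> - G \<omega>"
    have u: "L2 M ?u" and v: "L2 M ?v" using L[OF elim] F G by (auto intro: L2_diff)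
    note i = L2_inner_integrable[OF u L2_coeff[OF A v]] L2_inner_integrable[OF u L2_coeff[OF A G]]
      L2_inner_integrable[OF F L2_coeff[OF A v]] L2_inner_integrable[OF F L2_coeff[OF A G]]
    have "f T \<omega> \<bullet> (A \<omega> *v g T \<omega>) = ?u \<omega> \<bullet> (A \<omega> *v ?v \<omega>) + ?u \<omega> \<bullet> (A \<omega> *v G \<omega>) + F \<omega> \<bullet> (A \<omega> *v ?v \<omega>) + F \<omega> \<bullet> (A \<omega> *v G \<omega>)" for \<omega>
      by (simp add: matrix_vector_mult_diff_distrib inner_diff_left inner_diff_right)
    then have "(\<integral>\<omega>. f T \<omega> \<bullet> (A \<omega> *v g T \<omega>) \<partial>M) = (\<integral>\<omega>. ?u \<omega> \<bullet> (A \<omega> *v ?v \<omega>) \<partial>M) + (\<integral>\<omega>. ?u \<omega> \<bullet> (A \<omega> *v G \<omega>) \<partial>M)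
        + (\<integral>\<omega>. F \<omega> \<bullet> (A \<omega> *v ?v \<omega>) \<partial>M) + (\<integral>\<omega>. F \<omega> \<bullet> (A \<omega> *v G \<omega>) \<partial>M)"
      using i by simp
    then show ?case
      using coeff_pairing_bound[OF A \<beta> u v] coeff_pairing_bound[OF A \<beta> u G] coeff_pairing_bound[OF A \<beta> F v]
      unfolding p_def q_def NF_def NG_def real_norm_def by linarith
  qed
  have "(p \<longlongrightarrow> sqrt 0) at_top" "(q \<longlongrightarrow> sqrt 0) at_top"
    unfolding p_def q_def by (intro tendsto_real_sqrt limf limg)+
  then have "((\<lambda>T. \<beta> * p T * q T + \<beta> * p T * NG + \<beta> * NF * q T) \<longlongrightarrow> \<beta> * sqrt 0 * sqrt 0 + \<beta> * sqrt 0 * NG + \<beta> * NF * sqrt 0) at_top"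
    by (intro tendsto_intros)
  then show "((\<lambda>T. \<beta> * p T * q T + \<beta> * p T * NG + \<beta> * NF * q T) \<longlongrightarrow> 0) at_top" by simp
qed

theorem theorem2p1:
  fixes M :: "'w measure"
    and \<theta> :: "real^'d::finite \<Rightarrow> 'w \<Rightarrow> 'w"
    and A :: "'w \<Rightarrow> real^'d^'d"
    and \<alpha> \<beta> :: real
    and \<phi> \<phi>' :: "real^'d \<Rightarrow> real^'d \<Rightarrow> 'w \<Rightarrow> real"
    and G G' :: "real^'d \<Rightarrow> 'w \<Rightarrow> real^'d"
    and PhiT PhiT' :: "real^'d \<Rightarrow> real \<Rightarrow> 'w \<Rightarrow> real"
    and Gr Gr' :: "real^'d \<Rightarrow> real \<Rightarrow> 'w \<Rightarrow> real^'d"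
    and \<xi> \<xi>' :: "real^'d"
    and k :: nat
  assumes dim: "CARD('d) \<ge> 2"
    and ab: "0 < \<alpha>" "\<alpha> \<le> \<beta>"
    and erg: "ergodic_action M \<theta>"
    and coeff: "coeff_field M \<alpha> \<beta> A"
    and corr: "\<And>\<eta>. is_corrector M \<theta> A \<eta> (\<phi> \<eta>) (G \<eta>)"
    and corr': "\<And>\<eta>. is_corrector M \<theta> (\<lambda>\<omega>. transpose (A \<omega>)) \<eta> (\<phi>' \<eta>) (G' \<eta>)"
    and reg: "\<And>\<eta> T. T > 0 \<Longrightarrow> is_reg_corrector M \<theta> A T \<eta> (PhiT \<eta> T) (Gr \<eta> T)"
    and reg': "\<And>\<eta> T. T > 0 \<Longrightarrow>
                 is_reg_corrector M \<theta> (\<lambda>\<omega>. transpose (A \<omega>)) T \<eta> (PhiT' \<eta> T) (Gr' \<eta> T)"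
    and unit: "norm \<xi> = 1" "norm \<xi>' = 1"
    and k: "k \<ge> 1"
  shows "((\<lambda>T. \<integral>\<omega>. (norm (rich (\<lambda>S. Gr \<xi> S \<omega>) k T - G \<xi> \<omega>))\<^sup>2 \<partial>M) \<longlongrightarrow> 0) at_top \<and>
         ((\<lambda>T. \<integral>\<omega>. (norm (rich (\<lambda>S. Gr' \<xi>' S \<omega>) k T - G' \<xi>' \<omega>))\<^sup>2 \<partial>M) \<longlongrightarrow> 0) at_top \<and>
         ((\<lambda>T. norm (approx_matrix M A Gr Gr' k T - hom_matrix M A G G')) \<longlongrightarrow> 0) at_top"
proof -
  interpret prob_space M using erg by (simp add: ergodic_action_def)
  interpret ergodic_flow M \<theta> by unfold_locales (rule erg)
  \<comment> \<open>The transposed field is again an admissible coefficient field, so the dual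
    correctors fall under the same lemmas.\<close>
  note coeff' = coeff_field_transpose[OF coeff]
  have LG: "L2 M (G \<eta>)" and LG': "L2 M (G' \<eta>)" for \<eta> using corrector_L2 corr corr' by blast+
  have LR: "L2 M (Gr \<eta> T)" and LR': "L2 M (Gr' \<eta> T)" if "T > 0" for \<eta> T
    using reg_corrector_L2(2)[OF reg[OF that]] reg_corrector_L2(2)[OF reg'[OF that]] by auto
  \<comment> \<open>Needed for every direction \<eta>: the matrix entries involve the correctors of
    the axis vectors.\<close>
  have lim: "((\<lambda>T. \<integral>\<omega>. (norm (rich (\<lambda>S. Gr \<eta> S \<omega>) k T - G \<eta> \<omega>))\<^sup>2 \<partial>M) \<longlongrightarrow> 0) at_top" for \<eta>
    by (rule rich_tendsto[OF LR LG reg_corrector_tendsto[OF ab(1) coeff corr reg]])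
  have lim': "((\<lambda>T. \<integral>\<omega>. (norm (rich (\<lambda>S. Gr' \<eta> S \<omega>) k T - G' \<eta> \<omega>))\<^sup>2 \<partial>M) \<longlongrightarrow> 0) at_top" for \<eta>
    by (rule rich_tendsto[OF LR' LG' reg_corrector_tendsto[OF ab(1) coeff' corr' reg']])
  have const: "L2 M (\<lambda>\<omega>. v + f \<omega>)" if "L2 M f" for v :: "real^'d" and f
    by (rule L2_add[OF L2_const[OF finite_measure_axioms] that])
  have "((\<lambda>T. approx_matrix M A Gr Gr' k T $ i $ j) \<longlongrightarrow> hom_matrix M A G G' $ i $ j) at_top" for i j
    unfolding approx_matrix_def hom_matrix_def vec_lambda_beta
    by (rule coeff_pairing_tendsto[OF coeff])
       (use ab lim lim' in \<open>auto intro!: const L2_rich LR LR' LG LG'\<close>)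
  then have "((\<lambda>T. approx_matrix M A Gr Gr' k T) \<longlongrightarrow> hom_matrix M A G G') at_top"
    by (intro vec_tendstoI)
  then have "((\<lambda>T. norm (approx_matrix M A Gr Gr' k T - hom_matrix M A G G')) \<longlongrightarrow> 0) at_top"
    by (intro tendsto_norm_zero LIM_zero)
  with lim lim' show ?thesis by blast
qed

end
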